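(* Let $k$ and $n\ge2$ be integers such that $n$ is odd or $k$ is odd. Then \[ \mathrm{roots}_k^{D_n}=\sum_{C\in\mathrm{Conj}(D_n):\,C^k=\{1\}}\psi_{D_n}^C, \] where $\mathrm{Conj}(D_n)$ is the set of conjugacy classes of $D_n$ and $C^k=\{x^k:x\in C\}$.
   Context: $\mathrm{roots}_k^G(g)=|\{h\in G:h^k=g\}|$. $B_n$ is the group of bijections $w$ of $\{\pm1,\dots,\pm n\}$ with $w(-i)=-w(i)$; $D_n$ is the subgroup of $w\in B_n$ with an even number of $1\le i\le n$ such that $w(i)<0$. Cycles: if $c=(a_1,\dots,a_\ell)$ is a cycle of $w$ on $\{\pm1,\dots,\pm n\}$ so is $\bar c=(-a_1,\dots,-a_\ell)$; if $c\ne\bar c$, $c\bar c$ is a cycle of length $\ell$ and $\mathbb Z_2$-class $+1$; if $c=\bar c$, a cycle of length $\ell/2$ and class $-1$. For $x\in B_n$ with $a_{i,\varepsilon}$ cycles of length $i$ and class $\varepsilon$, $Z_{B_n}(x)\cong\prod_{i,\varepsilon}G_{i,\varepsilon}\wr S_{a_{i,\varepsilon}}$, where $G_{i,+}\cong\mathbb Z_2\times\mathbb Z_i$ is the centralizer in $B_i$ of one cycle of length $i$ and class $+1$ ($\mathbb Z_2$ generated by $[-1,\dots,-i]$, $\mathbb Z_i$ by the cycle) and $G_{i,-}\cong\mathbb Z_{2i}$ is generated by one cycle of class $-1$. $\omega_{i,+}$ is the linear character of $G_{i,+}\wr S_a$ equal on the base group to the product over factors of (trivial on $\mathbb Z_2$)$\times$(faithful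 linear character of $\mathbb Z_i$), trivial on the complement $S_a$; $\omega_{i,-}$ is the product over base factors of a faithful linear character of $\mathbb Z_{2i}$, trivial on $S_a$; $\omega^x=\bigotimes\omega_{i,\varepsilon}$. For a conjugacy class $C$ of $D_n$ and $x\in C$, $\psi_{D_n}^C:=\mathrm{Ind}_{Z_{D_n}(x)}^{D_n}\big(\omega^x|_{Z_{D_n}(x)}\big)$ (independent of $x\in C$). *)

theory Defs
  imports Complex_Main "HOL-Combinatorics.Orbits" "HOL-Algebra.Coset"
begin

definition roots :: "('a, 'b) monoid_scheme \<Rightarrow> int \<Rightarrow> 'a \<Rightarrow> nat" where
  "roots G k g = card {h \<in> carrier G. h [^]\<^bsub>G\<^esub> k = g}"

definition conj_class :: "('a, 'b) monoid_scheme \<Rightarrow> 'a \<Rightarrow> 'a set" where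
  "conj_class G x = (\<lambda>t. t \<otimes>\<^bsub>G\<^esub> x \<otimes>\<^bsub>G\<^esub> inv\<^bsub>G\<^esub> t) ` carrier G"

definition conj_classes :: "('a, 'b) monoid_scheme \<Rightarrow> 'a set set" where
  "conj_classes G = conj_class G ` carrier G"

definition centralizer :: "('a, 'b) monoid_scheme \<Rightarrow> 'a \<Rightarrow> 'a set" where
  "centralizer G x = {z \<in> carrier G. z \<otimes>\<^bsub>G\<^esub> x = x \<otimes>\<^bsub>G\<^esub> z}"

definition complex_mult_group :: "complex monoid" where
  "complex_mult_group = \<lparr>carrier = UNIV - {0}, monoid.mult = (*), one = 1\<rparr>"

text \<open>A linear character is only constrained on the carrier of the group; its values elsewhere are
  irrelevant.\<close>

definition linear_character :: "('a, 'b) monoid_scheme \<Rightarrow> ('a \<Rightarrow> complex) \<Rightarrow> bool" where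
  "linear_character G \<omega> \<longleftrightarrow> \<omega> \<in> hom G complex_mult_group"

text \<open>The character of \<open>G\<close> induced from the class function \<open>\<phi>\<close> on the subgroup \<open>H\<close>.  Only the values of
  \<open>\<phi>\<close> on \<open>H\<close> are used, so that \<open>\<phi>\<close> may be given on a larger group and restriction to \<open>H\<close> is implicit.\<close>

definition induced_character ::
  "('a, 'b) monoid_scheme \<Rightarrow> 'a set \<Rightarrow> ('a \<Rightarrow> complex) \<Rightarrow> 'a \<Rightarrow> complex" where
  "induced_character G H \<phi> g =
     (\<Sum>t \<in> {t \<in> carrier G. inv\<^bsub>G\<^esub> t \<otimes>\<^bsub>G\<^esub> g \<otimes>\<^bsub>G\<^esub> t \<in> H}. \<phi> (inv\<^bsub>G\<^esub> t \<otimes>\<^bsub>G\<^esub> g \<otimes>\<^bsub>G\<^esub> t))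
       / of_nat (card H)"

text \<open>\<open>faithful_root m z\<close> says that \<open>z\<close> is a primitive \<open>m\<close>-th root of unity: the first conjunct makes
  \<open>j \<mapsto> z ^ j\<close> a well-defined linear character of the cyclic group of order \<open>m\<close>, the second
  makes it faithful.  Thus \<open>z\<close> is the value of a faithful linear character at a fixed generator.\<close>

definition faithful_root :: "nat \<Rightarrow> complex \<Rightarrow> bool" where
  "faithful_root m z \<longleftrightarrow> z ^ m = 1 \<and> inj_on (\<lambda>j. z ^ j) {..<m}"


definition signed_points :: "nat \<Rightarrow> int set" where
  "signed_points n = {- int n..int n} - {0}"

text \<open>A bijection of \<open>signed_points n\<close> is represented by its extension to \<open>int\<close> by the identity.\<close>

definition B_group :: "nat \<Rightarrow> (int \<Rightarrow> int) monoid" where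
  "B_group n = \<lparr>carrier = {w. w permutes signed_points n \<and> (\<forall>i \<in> signed_points n. w (- i) = - w i)},
                monoid.mult = (\<circ>), one = id\<rparr>"

definition D_group :: "nat \<Rightarrow> (int \<Rightarrow> int) monoid" where
  "D_group n = (B_group n)
     \<lparr>carrier := {w \<in> carrier (B_group n). even (card {i \<in> {1..int n}. w i < 0})}\<rparr>"

text \<open>The supports of the cycles of \<open>x\<close> as a permutation of \<open>signed_points n\<close> (fixed points included).
  If \<open>c\<close> is the support of a cycle, that of its negative is \<open>uminus ` c\<close>.\<close>

definition cycles_of :: "nat \<Rightarrow> (int \<Rightarrow> int) \<Rightarrow> int set set" where
  "cycles_of n x = Orbits.orbit x ` signed_points n"

text \<open>One reference point on each signed cycle, i.e. on each set \<open>c \<union> uminus ` c\<close>.\<close>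

definition reference_points :: "nat \<Rightarrow> (int \<Rightarrow> int) \<Rightarrow> int set \<Rightarrow> bool" where
  "reference_points n x R \<longleftrightarrow>
     R \<subseteq> signed_points n \<and> (\<forall>c \<in> cycles_of n x. \<exists>!r. r \<in> R \<and> r \<in> c \<union> uminus ` c)"

text \<open>The linear character of the centralizer of \<open>x\<close> in \<open>B_n\<close>, a product of wreath products
  \<open>G_{i,\<epsilon>} \<wr> S_a\<close>.  On the base group it is given by its values on generators of the
  factors, one factor for each signed cycle: \<open>perm_restrict f b\<close> is \<open>f\<close> on \<open>b\<close> and the identity
  elsewhere, so \<open>perm_restrict x (c \<union> uminus ` c)\<close> is a single signed cycle of \<open>x\<close>.
  A cycle of class \<open>+1\<close> (\<open>uminus ` c \<noteq> c\<close>) has length \<open>card c\<close>, one of class \<open>-1\<close> has length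
  \<open>card c div 2\<close>; \<open>\<zeta> i\<close> and \<open>\<eta> i\<close> are the values of the chosen faithful characters of
  the cyclic groups of order \<open>i\<close> and \<open>2 * i\<close>.

  Identifying the centralizer with the product of wreath products amounts to choosing reference
  points \<open>R\<close>; the complement, the product of the symmetric groups permuting signed cycles of the same
  type, is then the set of \<open>s\<close> in the centralizer with \<open>s ` R = R\<close>.  Different choices of \<open>R\<close> give
  complements conjugate under the base group, hence the same character.\<close>

definition is_omega ::
  "nat \<Rightarrow> (nat \<Rightarrow> complex) \<Rightarrow> (nat \<Rightarrow> complex) \<Rightarrow> (int \<Rightarrow> int) \<Rightarrow> ((int \<Rightarrow> int) \<Rightarrow> complex) \<Rightarrow> bool" where
  "is_omega n \<zeta> \<eta> x \<omega> \<longleftrightarrow>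
     linear_character ((B_group n)\<lparr>carrier := centralizer (B_group n) x\<rparr>) \<omega> \<and>
     (\<forall>c \<in> cycles_of n x. uminus ` c \<noteq> c \<longrightarrow>
        \<omega> (perm_restrict uminus (c \<union> uminus ` c)) = 1 \<and>
        \<omega> (perm_restrict x (c \<union> uminus ` c)) = \<zeta> (card c)) \<and>
     (\<forall>c \<in> cycles_of n x. uminus ` c = c \<longrightarrow>
        \<omega> (perm_restrict x c) = \<eta> (card c div 2)) \<and>
     (\<exists>R. reference_points n x R \<and>
        (\<forall>s \<in> centralizer (B_group n) x. s ` R = R \<longrightarrow> \<omega> s = 1))"

text \<open>The conditions determine the values on the centralizer, so the choice only affects irrelevant
  values.\<close>

definition omega ::
  "nat \<Rightarrow> (nat \<Rightarrow> complex) \<Rightarrow> (nat \<Rightarrow> complex) \<Rightarrow> (int \<Rightarrow> int) \<Rightarrow> (int \<Rightarrow> int) \<Rightarrow> complex" where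
  "omega n \<zeta> \<eta> x = (SOME \<omega>. is_omega n \<zeta> \<eta> x \<omega>)"

definition psi_D ::
  "nat \<Rightarrow> (nat \<Rightarrow> complex) \<Rightarrow> (nat \<Rightarrow> complex) \<Rightarrow> (int \<Rightarrow> int) set \<Rightarrow> (int \<Rightarrow> int) \<Rightarrow> complex" where
  "psi_D n \<zeta> \<eta> C =
     (let x = (SOME x. x \<in> C)
      in induced_character (D_group n) (centralizer (D_group n) x) (omega n \<zeta> \<eta> x))"

end

theory Submission
  imports Defs "HOL-Combinatorics.Cycles"
begin

text \<open>Unfolding the induced characters, the right-hand side is the sum of \<open>\<omega>\<^sup>x(g)\<close> over the \<open>x\<close> that commute
  with \<open>g\<close> and satisfy \<open>x\<^sup>k = 1\<close>.  In \<open>B\<^sub>n\<close>, both this sum and the number of \<open>k\<close>-th roots of \<open>g\<close> are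
  sums over the permutations \<open>x\<close> commuting with \<open>g\<close> whose summands are multiplicative over the orbits of
  \<open>\<langle>x, g, -1\<rangle>\<close>, so it suffices to compare the contributions of those \<open>x\<close> for which there is a single orbit.
  Then \<open>x\<close> permutes the signed cycles of \<open>g\<close>, say \<open>d\<close> of them, in one cycle, and \<open>x\<^sup>d\<close> acts as an
  element \<open>h\<close> of \<open>H = \<langle>g, -1\<rangle>\<close>.  Multiplying \<open>x\<close> by the elements of \<open>H\<close> on one signed cycle of \<open>g\<close>
  makes \<open>h\<close> run once through \<open>H\<close>.  For \<open>h = \<plusminus>g\<^sup>a\<close> with a fixed sign, \<open>a \<mapsto> \<omega>\<^sup>x(g)\<close> is a bijection from
  the residues modulo the order of \<open>g\<close> on a cycle to the roots of unity of that order, and it preserves orders;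
  hence the sum over the \<open>h\<close> with \<open>h\<^bsup>k/d\<^esup> = 1\<close> is a sum of all roots of unity of order dividing a
  given number, which is \<open>1\<close> or \<open>0\<close>.

  If \<open>k\<close> is odd, all elements of \<open>B\<^sub>n\<close> involved lie in \<open>D\<^sub>n\<close>.  If \<open>n\<close> is odd and \<open>k\<close> is even, then
  \<open>B\<^sub>n = D\<^sub>n \<times> {\<plusminus>1}\<close>, so exactly half of the roots lie in \<open>D\<^sub>n\<close>, and the sum of \<open>\<omega>\<^sup>x(g)\<close> weighted by the
  sign character of \<open>B\<^sub>n\<close> with kernel \<open>D\<^sub>n\<close> vanishes: this follows by the same reduction.\<close>

section \<open>Roots of unity\<close>

text \<open>The bijection \<open>a -> z\<close>, with \<open>z\<close> the value of the character of
  \<open>x\<close> at \<open>g\<close>, comes from exchanging the roles of \<open>x\<close> and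
  \<open>g\<close>. If \<open>x\<close> has \<open>m\<close> signed cycles in the orbit, the product
  defining \<open>z\<close> telescopes along \<open>p, g p, ..., g^m p\<close>, so a relation
  \<open>g^b p = t x^j p\<close> with a sign \<open>t\<close> makes \<open>z^(b/m)\<close> equal, up
  to a sign attached to \<open>t\<close>, to the \<open>j\<close>-th power of the root of unity
  prescribed on the cycle of \<open>x\<close>. Applied to \<open>x^d p = s g^a p\<close>, this
  exhibits a power of \<open>z\<close> as a primitive root of unity depending, for fixed
  \<open>s\<close>, only on \<open>r = M / gcd(a, M)\<close>, where \<open>M\<close> is the length
  of the cycle of \<open>g\<close>. Hence \<open>z\<close> has order \<open>r\<close>, and
  \<open>a\<close> can be recovered from \<open>z\<close>. The obstacle is the class of the cycles
  of \<open>x\<close>, which varies with \<open>r\<close>, \<open>s\<close> and the class of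
  \<open>g\<close>; it causes the cases in \<open>rho\<close> and a factor 2 in an exponent. In the
  weighted sum, \<open>-g\<close> has sign -1, hence so on some orbit. There the terms cancel under
  \<open>z -> -z\<close> if the cycles of \<open>g\<close> have class -1, and between the two signs
  \<open>s\<close> otherwise. The character in the statement is given by conditions only, hence the
  explicit formula and its uniqueness.\<close>

definition root_order :: "nat \<Rightarrow> complex \<Rightarrow> bool" where
  "root_order r z \<longleftrightarrow> (\<forall>j. z ^ j = 1 \<longleftrightarrow> r dvd j)"

lemma root_orderD: "root_order r z \<Longrightarrow> z ^ j = 1 \<longleftrightarrow> r dvd j"
  by (simp add: root_order_def)

lemma root_order_unique: "root_order r z \<Longrightarrow> root_order s z \<Longrightarrow> r = s"
  by (metis dvd_antisym dvd_refl root_order_def)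

lemma faithful_root_order:
  assumes "faithful_root r z" "r > 0"
  shows "root_order r z"
  unfolding root_order_def
proof
  fix j
  have z: "z ^ r = 1" and inj: "inj_on (\<lambda>j. z ^ j) {..<r}"
    using assms by (auto simp: faithful_root_def)
  have "z ^ j = z ^ (r * (j div r) + j mod r)" by simp
  also have "\<dots> = z ^ (j mod r)" unfolding power_add power_mult z by simp
  finally have eq: "z ^ j = z ^ (j mod r)" .
  show "z ^ j = 1 \<longleftrightarrow> r dvd j"
  proof
    assume "z ^ j = 1"
    then have "z ^ (j mod r) = z ^ 0" using eq by simp
    then have "j mod r = 0" using inj_onD[OF inj, of "j mod r" 0] assms(2) by simp
    then show "r dvd j" by auto
  qed (auto simp: power_mult z)
qed

lemma root_order_power: "root_order (d * r) z \<Longrightarrow> d > 0 \<Longrightarrow> root_order r (z ^ d)"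
  by (simp add: root_order_def flip: power_mult)

lemma root_order_half:
  assumes "root_order (2 * r) z" "r > 0"
  shows "z ^ r = -1"
proof -
  have "(z ^ r)\<^sup>2 = 1" using root_orderD[OF assms(1), of "2 * r"] by (simp add: mult.commute flip: power_mult)
  moreover have "z ^ r \<noteq> 1" using root_orderD[OF assms(1), of r] assms(2) by (auto dest: dvd_imp_le)
  ultimately show ?thesis by (simp add: power2_eq_1_iff)
qed

text \<open>Since \<open>z ^ r = -1\<close> and \<open>r\<close> is odd, \<open>- z\<close> has
  exponent \<open>r\<close>; conversely, squaring removes the sign. This covers cycles of class -1
  at which the sign contributes a factor -1.\<close>

lemma root_order_minus:
  assumes "root_order (2 * r) z" "odd r"
  shows "root_order r (- z)"
  unfolding root_order_def
proof
  fix j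
  have r: "r > 0" using assms(2) by (cases r) auto
  show "(- z) ^ j = 1 \<longleftrightarrow> r dvd j"
  proof
    assume "(- z) ^ j = 1"
    then have "((- z) ^ j)\<^sup>2 = 1" by simp
    then have "z ^ (2 * j) = 1" by (simp add: power_mult power_mult_distrib mult.commute flip: power_mult)
    then show "r dvd j" using root_orderD[OF assms(1)] by simp
  next
    assume "r dvd j"
    then obtain t where "j = r * t" by auto
    then show "(- z) ^ j = 1"
      using root_order_half[OF assms(1) r] assms(2) by (simp add: power_mult)
  qed
qed

section \<open>Order-preserving bijections from residues to roots of unity, and the resulting
  sums\<close>

lemma dvd_mult_iff_div_gcd:
  fixes M a l :: nat
  assumes "M > 0"
  shows "M dvd a * l \<longleftrightarrow> M div gcd a M dvd l"
proof -
  let ?g = "gcd a M"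
  have g: "?g > 0" using assms by simp
  have "M dvd a * l \<longleftrightarrow> ?g * (M div ?g) dvd ?g * ((a div ?g) * l)"
    by (simp add: mult.assoc[symmetric] del: mult.assoc dvd_mult_cancel1)
  also have "\<dots> \<longleftrightarrow> M div ?g dvd (a div ?g) * l" using g by (metis dvd_times_left_cancel_iff neq0_conv)
  also have "\<dots> \<longleftrightarrow> M div ?g dvd l"
    using assms by (intro coprime_dvd_mult_right_iff) (metis coprime_commute div_gcd_coprime neq0_conv)
  finally show ?thesis .
qed

text \<open>\<open>M div gcd a M\<close> is the order of the residue \<open>a\<close>. It is an
  exponent for \<open>w a\<close>, and some power of \<open>w a\<close> is a primitive root of
  exactly this order, so \<open>w a\<close> has this order. If \<open>w a = w b\<close>, the orders
  agree, hence so do the gcds, and comparing the two powers that equal the same value of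
  \<open>\<rho>\<close> gives \<open>M dvd a - b\<close>. An injection into a set with
  \<open>M\<close> elements is onto.\<close>

lemma roots_of_unity_bij:
  fixes w \<rho> :: "nat \<Rightarrow> complex" and c :: "nat \<Rightarrow> nat"
  assumes M: "M > 0"
    and w1: "\<And>a. a < M \<Longrightarrow> w a ^ (M div gcd a M) = 1"
    and w2: "\<And>a. a < M \<Longrightarrow> w a ^ (c (M div gcd a M) * (a div gcd a M)) = \<rho> (M div gcd a M)"
    and \<rho>: "\<And>r. r > 0 \<Longrightarrow> r dvd M \<Longrightarrow> root_order r (\<rho> r)"
  shows "bij_betw w {..<M} {z. z ^ M = 1}" and "a < M \<Longrightarrow> w a ^ j = 1 \<longleftrightarrow> M dvd a * j"
proof -
  have r: "M div gcd a M > 0" "M div gcd a M dvd M" for a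
    using M by (auto simp: div_greater_zero_iff intro!: gcd_le2_nat) (metis dvd_div_mult_self dvd_triv_left gcd_dvd2)
  have ord: "root_order (M div gcd a M) (w a)" if "a < M" for a
    unfolding root_order_def
  proof (intro allI iffI)
    fix j assume "w a ^ j = 1"
    then have "\<rho> (M div gcd a M) ^ j = 1"
      unfolding w2[OF that, symmetric] by (metis mult.commute power_mult power_one)
    then show "M div gcd a M dvd j" using root_orderD[OF \<rho>[OF r]] by blast
  next
    fix j assume "M div gcd a M dvd j"
    then show "w a ^ j = 1" using w1[OF that] by (auto simp: power_mult)
  qed
  show "w a ^ j = 1 \<longleftrightarrow> M dvd a * j" if "a < M" for a j
    using root_orderD[OF ord[OF that]] dvd_mult_iff_div_gcd[OF M] by simp
  have le: "a = b" if a: "a < M" and b: "b < M" and eq: "w a = w b" and le: "b \<le> a" for a b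
  proof -
    define r where "r = M div gcd a M"
    have r': "r = M div gcd b M"
      using root_order_unique[OF ord[OF a]] ord[OF b] eq by (simp add: r_def)
    then have g: "gcd a M = gcd b M"
      unfolding r_def by (metis M dvd_div_eq_cancel dvd_div_mult_self gcd_dvd2 nonzero_mult_div_cancel_left r(1) less_irrefl)
    define t where "t = w a ^ c r"
    have t1: "t ^ (a div gcd a M) = \<rho> r" using w2[OF a] by (simp add: t_def r_def power_mult)
    have t2: "t ^ (b div gcd a M) = \<rho> r" using w2[OF b] eq g r' by (simp add: t_def r_def power_mult)
    have le': "b div gcd a M \<le> a div gcd a M" using le by (simp add: div_le_mono)
    have "t \<noteq> 0"
    proof
      assume "t = 0"
      then have "w a = 0" by (auto simp: t_def)
      then show False using w1[OF a] r(1)[of a] by (simp add: power_0_left split: if_splits)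
    qed
    have \<rho>r: "root_order r (\<rho> r)" using \<rho>[OF r] by (simp add: r_def)
    have "t ^ (a div gcd a M - b div gcd a M) = 1"
      using t1 t2 \<open>t \<noteq> 0\<close> le' by (simp add: power_diff) (metis divide_self power_not_zero)
    \<comment> \<open>As a power of \<open>t\<close>, \<open>\<rho> r\<close> inherits the relation,
      and its order is known to be exactly \<open>r\<close>.\<close>
    then have "\<rho> r ^ (a div gcd a M - b div gcd a M) = 1"
      unfolding t1[symmetric] by (metis mult.commute power_mult power_one)
    then have "r dvd a div gcd a M - b div gcd a M" using root_orderD[OF \<rho>r] by blast
    then have "gcd a M * r dvd gcd a M * (a div gcd a M - b div gcd a M)" by simp
    moreover have "gcd a M * r = M" "gcd a M * (a div gcd a M) = a" "gcd a M * (b div gcd a M) = b"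
      by (simp_all add: r_def) (simp add: g)
    ultimately have "M dvd a - b" by (simp add: diff_mult_distrib2)
    then show "a = b" using a b le by (auto dest: dvd_imp_le)
  qed
  have inj: "inj_on w {..<M}"
    by (rule inj_onI) (metis le lessThan_iff nat_le_linear)
  have "w ` {..<M} \<subseteq> {z. z ^ M = 1}" using ord r(2) by (auto simp: root_order_def)
  moreover have "card (w ` {..<M}) = card {z::complex. z ^ M = 1}"
    using inj M by (simp add: card_image card_roots_unity_eq)
  ultimately have "w ` {..<M} = {z. z ^ M = 1}"
    using M by (intro card_subset_eq finite_roots_unity) auto
  then show "bij_betw w {..<M} {z. z ^ M = 1}" using inj by (simp add: bij_betw_def)
qed

lemma common_roots_of_unity:
  fixes z :: complex
  assumes "M > 0"
  shows "z ^ M = 1 \<and> z ^ l = 1 \<longleftrightarrow> z ^ gcd M l = 1"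
proof (intro iffI conjI)
  assume z: "z ^ M = 1 \<and> z ^ l = 1"
  obtain x y where xy: "M * x = l * y + gcd M l" using bezout_nat[of M l] assms by auto
  have "z ^ (M * x) = 1" using z by (simp add: power_mult)
  then show "z ^ gcd M l = 1" using z unfolding xy by (simp add: power_add power_mult)
qed (metis gcd_dvd1 gcd_dvd2 dvdE power_mult power_one)+

text \<open>A solution is an inverse of \<open>l\<close> modulo \<open>M\<close>. Writing
  \<open>1 mod M\<close> keeps the case \<open>M = 1\<close> correct. On a transitive block this
  counts the exponents \<open>a\<close> for which the \<open>l\<close>-th power of
  \<open>g ^^ a\<close> is \<open>g\<close>.\<close>

lemma card_linear_congruence_one:
  fixes M l :: nat
  assumes "M > 0"
  shows "card {a. a < M \<and> a * l mod M = 1 mod M} = (if coprime M l then 1 else 0)"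
proof (cases "coprime M l")
  case True
  obtain b where b: "b * l mod M = 1 mod M"
  proof -
    show ?thesis
    proof (cases "M = 1")
      case False
      then have "l \<noteq> 0" using True by (metis coprime_0_right_iff One_nat_def nat_dvd_1_iff_1)
      then obtain x y where "l * x = M * y + gcd l M" using bezout_nat[of l M] by auto
      then have "x * l mod M = (M * y + 1) mod M" using True by (simp add: coprime_commute mult.commute coprime_iff_gcd_eq_1)
      also have "\<dots> = 1 mod M" by (rule mod_mult_self4)
      finally show ?thesis by (rule that)
    qed (use that in auto)
  qed
  have "{a. a < M \<and> a * l mod M = 1 mod M} = {b mod M}"
  proof (intro Set.set_eqI iffI)
    fix a assume "a \<in> {a. a < M \<and> a * l mod M = 1 mod M}"
    then have a: "a < M" "a * l mod M = 1 mod M" by auto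
    have "a * (b * l) mod M = a mod M" using mod_mult_right_eq[of a "b * l" M] mod_mult_right_eq[of a 1 M] b by simp
    moreover have "b * (a * l) mod M = b mod M" using mod_mult_right_eq[of b "a * l" M] mod_mult_right_eq[of b 1 M] a(2) by simp
    ultimately show "a \<in> {b mod M}" using a(1) by (simp add: ac_simps)
  next
    fix a assume "a \<in> {b mod M}"
    then show "a \<in> {a. a < M \<and> a * l mod M = 1 mod M}"
      using b assms mod_mult_left_eq[of b M l] by simp
  qed
  then show ?thesis using True by simp
next
  case False
  have "{a. a < M \<and> a * l mod M = 1 mod M} = {}"
  proof (rule ccontr)
    assume "{a. a < M \<and> a * l mod M = 1 mod M} \<noteq> {}"
    then obtain a where a: "a * l mod M = 1 mod M" by auto
    have "gcd M l dvd a * l mod M" by (simp add: dvd_mod)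
    then have "gcd M l dvd 1" unfolding a by (meson dvd_mod_iff gcd_dvd1)
    then show False using False by (simp add: coprime_iff_gcd_eq_1)
  qed
  then show ?thesis using False by simp
qed

context
  fixes w \<rho> :: "nat \<Rightarrow> complex" and c :: "nat \<Rightarrow> nat" and M :: nat
  assumes M: "M > 0"
    and w1: "\<And>a. a < M \<Longrightarrow> w a ^ (M div gcd a M) = 1"
    and w2: "\<And>a. a < M \<Longrightarrow> w a ^ (c (M div gcd a M) * (a div gcd a M)) = \<rho> (M div gcd a M)"
    and \<rho>: "\<And>r. r > 0 \<Longrightarrow> r dvd M \<Longrightarrow> root_order r (\<rho> r)"
begin

text \<open>Because the bijection preserves orders, \<open>M dvd a * l\<close> means
  \<open>w a ^ l = 1\<close>; these \<open>w a\<close> are the common roots of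
  \<open>z ^ M = 1\<close> and \<open>z ^ l = 1\<close>.\<close>

lemma sum_over_torsion:
  "(\<Sum>a | a < M \<and> M dvd a * l. f (w a)) = (\<Sum>z | z ^ gcd M l = 1. f z)"
proof (rule sum.reindex_bij_betw)
  note b = roots_of_unity_bij[OF M w1 w2 \<rho>]
  have "{z::complex. z ^ gcd M l = 1} = {z \<in> {z. z ^ M = 1}. z ^ l = 1}"
    unfolding common_roots_of_unity[OF M, symmetric] by simp
  also have "\<dots> = {z \<in> w ` {..<M}. z ^ l = 1}"
    using b(1) by (simp add: bij_betw_def)
  also have "\<dots> = w ` {a \<in> {..<M}. w a ^ l = 1}" by blast
  also have "{a \<in> {..<M}. w a ^ l = 1} = {a. a < M \<and> M dvd a * l}"
    using b(2) by auto
  finally have "w ` {a. a < M \<and> M dvd a * l} = {z. z ^ gcd M l = 1}" by simp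
  moreover have "inj_on w {a. a < M \<and> M dvd a * l}"
    using b(1) by (auto simp: bij_betw_def inj_on_def)
  ultimately show "bij_betw w {a. a < M \<and> M dvd a * l} {z. z ^ gcd M l = 1}"
    by (simp add: bij_betw_def)
qed

text \<open>The roots of \<open>z ^ e = 1\<close> sum to 1 if \<open>e = 1\<close> and to 0
  otherwise. For \<open>e = gcd M l\<close> this is also the number of inverses of \<open>l\<close>
  modulo \<open>M\<close>: here character values turn into a count of roots.\<close>

lemma sum_torsion_eq_card:
  "(\<Sum>a | a < M \<and> M dvd a * l. w a) = of_nat (card {a. a < M \<and> a * l mod M = 1 mod M})"
proof -
  have "(\<Sum>z::complex | z ^ gcd M l = 1. z) = (if coprime M l then 1 else 0)"
  proof (cases "gcd M l = 1")
    case True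
    then have "{z::complex. z ^ gcd M l = 1} = {1}" by auto
    then show ?thesis using True by (simp add: coprime_iff_gcd_eq_1)
  next
    case False
    then have "gcd M l > 1" using M by (metis gcd_pos_nat less_one linorder_neqE_nat neq0_conv)
    then show ?thesis using sum_roots_unity[of "gcd M l"] False by (simp add: coprime_iff_gcd_eq_1)
  qed
  then show ?thesis
    using sum_over_torsion[of "\<lambda>z. z" l] card_linear_congruence_one[OF M, of l] by simp
qed

text \<open>The sign is itself a function of \<open>w a\<close>: \<open>(-1) ^ a = w a ^ i\<close>,
  because \<open>w a ^ i = 1\<close> iff \<open>2 * i\<close> divides \<open>a * i\<close>. The sum
  then runs over all roots of \<open>z ^ gcd M l = 1\<close> with an even exponent, and
  \<open>z -> -z\<close> negates the summand \<open>z ^ i * z\<close> since \<open>i\<close> is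
  even.\<close>

lemma alternating_sum_torsion:
  assumes "M = 2 * i" "even i" "even l"
  shows "(\<Sum>a | a < M \<and> M dvd a * l. (-1) ^ a * w a) = 0"
proof -
  have sgn: "(-1) ^ a = w a ^ i" if "a < M" for a
  proof -
    have iff: "w a ^ i = 1 \<longleftrightarrow> even a"
      using roots_of_unity_bij(2)[OF M w1 w2 \<rho> that, of i] assms(1) M by auto
    have "(w a ^ i)\<^sup>2 = 1"
      using roots_of_unity_bij(2)[OF M w1 w2 \<rho> that, of M] assms(1) by (simp add: mult.commute flip: power_mult)
    then have "w a ^ i = 1 \<or> w a ^ i = -1" by (simp add: power2_eq_1_iff)
    then show ?thesis using iff by (cases "even a") auto
  qed
  have "(\<Sum>a | a < M \<and> M dvd a * l. (-1) ^ a * w a) = (\<Sum>a | a < M \<and> M dvd a * l. w a ^ i * w a)"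
    by (intro sum.cong) (auto simp: sgn)
  also have "\<dots> = (\<Sum>z | z ^ gcd M l = 1. z ^ i * z)" by (rule sum_over_torsion)
  finally have eq: "(\<Sum>a | a < M \<and> M dvd a * l. (-1) ^ a * w a) = (\<Sum>z | z ^ gcd M l = 1. z ^ i * z)" .
  have "(\<Sum>z::complex | z ^ gcd M l = 1. z ^ i * z) = (\<Sum>z | z ^ gcd M l = 1. - (z ^ i * z))"
    by (rule sum.reindex_bij_witness[of _ uminus uminus])
      (use assms in \<open>auto simp: gcd_nat.bounded_iff\<close>)
  also have "\<dots> = - (\<Sum>z | z ^ gcd M l = 1. z ^ i * z)" by (rule sum_negf)
  finally have "(\<Sum>z::complex | z ^ gcd M l = 1. z ^ i * z) = 0" by (simp add: eq_neg_iff_add_eq_0)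
  then show ?thesis using eq by simp
qed

end

section \<open>Signed permutations\<close>

text \<open>Arbitrary symmetric sets take the place of \<open>signed_points n\<close> because the
  reduction to orbits passes to subsets that need not be intervals.\<close>

definition signed_set :: "int set \<Rightarrow> bool" where
  "signed_set P \<longleftrightarrow> finite P \<and> 0 \<notin> P \<and> uminus ` P = P"

definition signed_bij :: "(int \<Rightarrow> int) \<Rightarrow> bool" where
  "signed_bij w \<longleftrightarrow> bij w \<and> (\<forall>i. w (- i) = - w i)"

abbreviation finv :: "(int \<Rightarrow> int) \<Rightarrow> int \<Rightarrow> int" where "finv \<equiv> inv_into UNIV"

text \<open>Oddness is demanded at all integers so that signs can be moved through \<open>w\<close>
  without membership conditions.\<close>

definition signed_perms :: "int set \<Rightarrow> (int \<Rightarrow> int) set" where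
  "signed_perms P = {w. w permutes P \<and> (\<forall>i. w (- i) = - w i)}"

abbreviation signs :: "int set" where "signs \<equiv> {1, -1}"

lemma signed_setD:
  assumes "signed_set P"
  shows "finite P" "0 \<notin> P" "- p \<in> P \<longleftrightarrow> p \<in> P" "s \<in> signs \<Longrightarrow> s * p \<in> P \<longleftrightarrow> p \<in> P"
proof -
  show "finite P" "0 \<notin> P" using assms by (auto simp: signed_set_def)
  show "- p \<in> P \<longleftrightarrow> p \<in> P"
    using assms unfolding signed_set_def by (metis imageI minus_minus)
  then show "s \<in> signs \<Longrightarrow> s * p \<in> P \<longleftrightarrow> p \<in> P" by auto
qed

lemma signed_permsD:
  assumes "x \<in> signed_perms P"
  shows "x permutes P" "signed_bij x" "x ` P = P" "p \<notin> P \<Longrightarrow> x p = p"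
  using assms by (auto simp: signed_perms_def signed_bij_def permutes_bij permutes_image permutes_not_in)

lemma signed_bij_id: "signed_bij id"
  by (simp add: signed_bij_def)

lemma signed_bij_comp: "signed_bij v \<Longrightarrow> signed_bij w \<Longrightarrow> signed_bij (v \<circ> w)"
  by (simp add: signed_bij_def bij_comp)

lemma signed_bij_funpow: "signed_bij w \<Longrightarrow> signed_bij (w ^^ j)"
  by (induction j) (simp_all add: signed_bij_id signed_bij_comp)

lemma signed_bij_inv:
  assumes "signed_bij w" shows "signed_bij (finv w)"
proof -
  have b: "bij w" and s: "w (- i) = - w i" for i using assms by (auto simp: signed_bij_def)
  have "finv w (- i) = - finv w i" for i
    using s[of "finv w i"] b by (metis bij_inv_eq_iff)
  then show ?thesis using b by (simp add: signed_bij_def bij_imp_bij_inv)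
qed

lemma signed_bijD:
  assumes "signed_bij w"
  shows "w (- i) = - w i" "s \<in> signs \<Longrightarrow> w (s * i) = s * w i" "w i = w j \<longleftrightarrow> i = j" "w (finv w i) = i" "finv w (w i) = i"
  using assms by (auto simp: signed_bij_def bij_def inj_eq surj_f_inv_f)

lemma signed_bij_funpowD:
  assumes "signed_bij w"
  shows "(w ^^ j) (- i) = - (w ^^ j) i" "s \<in> signs \<Longrightarrow> (w ^^ j) (s * i) = s * (w ^^ j) i"
  using signed_bijD[OF signed_bij_funpow[OF assms]] by auto

lemma signed_perms_comp: "v \<in> signed_perms P \<Longrightarrow> w \<in> signed_perms P \<Longrightarrow> v \<circ> w \<in> signed_perms P"
  by (auto simp: signed_perms_def permutes_compose)

lemma signed_perms_id: "id \<in> signed_perms P"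
  by (simp add: signed_perms_def permutes_id)

lemma signed_perms_funpow: "w \<in> signed_perms P \<Longrightarrow> w ^^ j \<in> signed_perms P"
  by (induction j) (simp_all add: signed_perms_comp signed_perms_id)

lemma signed_perms_inv: "w \<in> signed_perms P \<Longrightarrow> finv w \<in> signed_perms P"
  using signed_bijD(1)[OF signed_bij_inv[OF signed_permsD(2), of w P]] permutes_inv[of w P]
  by (simp add: signed_perms_def)

lemma signed_permsI: "signed_bij w \<Longrightarrow> (\<And>p. p \<notin> P \<Longrightarrow> w p = p) \<Longrightarrow> w \<in> signed_perms P"
  by (simp add: signed_perms_def signed_bij_def permutes_def bij_iff)

lemma perm_restrict_signed_perms:
  assumes u: "signed_bij u" and A: "signed_set A" and uA: "u ` A = A"
  shows "perm_restrict u A \<in> signed_perms A"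
proof -
  have uA': "u p \<in> A \<longleftrightarrow> p \<in> A" for p
    using uA u by (metis (no_types, lifting) imageE imageI signed_bijD(3))
  have "bij (perm_restrict u A)"
  proof (rule bijI)
    show "inj (perm_restrict u A)"
      by (rule injI) (metis perm_restrict_def uA' signed_bijD(3)[OF u])
    show "surj (perm_restrict u A)"
    proof (rule surjI)
      fix p
      have "finv u p \<in> A \<longleftrightarrow> p \<in> A" using uA'[of "finv u p"] by (simp add: signed_bijD(4)[OF u])
      then show "perm_restrict u A (if p \<in> A then finv u p else p) = p"
        by (simp add: perm_restrict_def signed_bijD(4)[OF u])
    qed
  qed
  then have "signed_bij (perm_restrict u A)"
    using signed_setD(3)[OF A] signed_bijD(1)[OF u] by (auto simp: signed_bij_def perm_restrict_def)
  then show ?thesis by (intro signed_permsI) (auto simp: perm_restrict_def)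
qed

lemma finite_signed_perms: "finite P \<Longrightarrow> finite (signed_perms P)"
  by (rule finite_subset[OF _ finite_permutations[of P]]) (auto simp: signed_perms_def)

lemma funpow_in_invariant:
  "w ` P = P \<Longrightarrow> p \<in> P \<Longrightarrow> (w ^^ j) p \<in> P"
  by (induction j) auto

lemma funpow_commute_apply:
  assumes "\<And>p. x (w p) = w (x p)"
  shows "(x ^^ j) (w p) = w ((x ^^ j) p)"
  by (induction j) (auto simp: assms)

section \<open>Cycles and signed cycles, their lengths and classes\<close>

definition cyc :: "(int \<Rightarrow> int) \<Rightarrow> int \<Rightarrow> int set" where
  "cyc x p = range (\<lambda>j. (x ^^ j) p)"

definition scyc :: "(int \<Rightarrow> int) \<Rightarrow> int \<Rightarrow> int set" where
  "scyc x p = {s * (x ^^ j) p |s j. s \<in> signs}"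

definition neg_cyc :: "(int \<Rightarrow> int) \<Rightarrow> int \<Rightarrow> bool" where
  "neg_cyc x p \<longleftrightarrow> - p \<in> cyc x p"

definition slen :: "(int \<Rightarrow> int) \<Rightarrow> int \<Rightarrow> nat" where
  "slen x p = card (scyc x p) div 2"

lemma scyc_eq_cyc: "scyc x p = cyc x p \<union> uminus ` cyc x p"
proof -
  have "scyc x p = (\<Union>s\<in>signs. range (\<lambda>j. s * (x ^^ j) p))" unfolding scyc_def by blast
  then show ?thesis by (simp add: cyc_def image_image)
qed

lemma scyc_self: "p \<in> scyc x p"
  unfolding scyc_def by (rule CollectI, rule exI[of _ 1], rule exI[of _ 0]) simp

lemma scycI: "s \<in> signs \<Longrightarrow> s * (x ^^ j) p \<in> scyc x p"
  by (auto simp: scyc_def)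

lemma scycE:
  assumes "q \<in> scyc x p" obtains s j where "s \<in> signs" "q = s * (x ^^ j) p"
  using assms by (auto simp: scyc_def)

lemma cyc_cong:
  assumes "\<And>q. q \<in> B \<Longrightarrow> x q = y q" "x ` B \<subseteq> B" "p \<in> B"
  shows "(x ^^ j) p = (y ^^ j) p" "(x ^^ j) p \<in> B"
  using assms by (induction j) auto

locale signed_perm =
  fixes P :: "int set" and x :: "int \<Rightarrow> int"
  assumes signed_set: "signed_set P" and perm: "x \<in> signed_perms P"
begin

lemmas P = signed_setD[OF signed_set]
lemmas x = signed_permsD[OF perm] signed_bijD[OF signed_permsD(2)[OF perm]]
  signed_bij_funpowD[OF signed_permsD(2)[OF perm]]

lemma permutation: "permutation x"
  using x(1) P(1) by (auto simp: permutation_permutes)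

text \<open>Some positive power of \<open>x\<close> is the identity, so the inverse of a power is
  again a power. This is why natural exponents suffice in all coordinates
  \<open>s * (x ^^ j) p\<close>.\<close>

lemma funpow_inverse: obtains j' where "\<And>p. (x ^^ j') ((x ^^ j) p) = p" "\<And>p. (x ^^ j) ((x ^^ j') p) = p"
proof -
  obtain n where n: "x ^^ n = id" "n > 0" using permutation_is_nilpotent[OF permutation] .
  have e: "j * (n - 1) + j = n * j" using n(2) by (cases n) auto
  have "x ^^ (n * j) = id" using n(1) by (metis funpow_mult id_funpow)
  then have "x ^^ (j * (n - 1)) \<circ> x ^^ j = id" "x ^^ j \<circ> x ^^ (j * (n - 1)) = id"
    using e by (metis funpow_add, metis funpow_add add.commute)
  then show ?thesis using that[of "j * (n - 1)"] by (metis comp_apply id_apply)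
qed

lemma scyc_sym: "q \<in> scyc x p \<Longrightarrow> p \<in> scyc x q"
proof -
  assume "q \<in> scyc x p"
  then obtain s j where s: "s \<in> signs" "q = s * (x ^^ j) p" by (rule scycE)
  obtain j' where "\<And>p. (x ^^ j') ((x ^^ j) p) = p" using funpow_inverse by metis
  then have "p = s * (x ^^ j') q" using s x(11) by auto
  then show "p \<in> scyc x q" using s(1) scycI by metis
qed

lemma scyc_trans: "q \<in> scyc x p \<Longrightarrow> r \<in> scyc x q \<Longrightarrow> r \<in> scyc x p"
proof -
  assume "q \<in> scyc x p" "r \<in> scyc x q"
  then obtain s j s' j' where s: "s \<in> signs" "q = s * (x ^^ j) p" "s' \<in> signs" "r = s' * (x ^^ j') q" by (metis scycE)
  then have "r = (s' * s) * (x ^^ (j' + j)) p" by (auto simp: x(11) funpow_add)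
  then show ?thesis using s scycI[of "s' * s"] by auto
qed

lemma scyc_eq: "q \<in> scyc x p \<Longrightarrow> scyc x q = scyc x p"
  using scyc_sym scyc_trans by blast

lemma scyc_eq_iff: "scyc x q = scyc x p \<longleftrightarrow> q \<in> scyc x p"
  using scyc_eq scyc_self by blast

lemma scyc_x: "x p \<in> scyc x p"
  using scycI[of 1 1 x p] by simp

lemma scyc_minus: "- p \<in> scyc x p"
  using scycI[of "-1" 0 x p] by simp

lemma cyc_subset: "p \<in> P \<Longrightarrow> cyc x p \<subseteq> P"
  using funpow_in_invariant[OF x(3)] by (auto simp: cyc_def)

lemma scyc_subset: "p \<in> P \<Longrightarrow> scyc x p \<subseteq> P"
  using cyc_subset P(3) by (auto simp: scyc_eq_cyc)

lemma finite_scyc: "p \<in> P \<Longrightarrow> finite (scyc x p)"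
  using scyc_subset P(1) finite_subset by blast

lemma cyc_eq_support: "cyc x p = set (support x p)"
  using support_set[OF permutation] by (simp add: cyc_def)

lemma card_cyc: "card (cyc x p) = least_power x p"
  unfolding cyc_eq_support using cycle_of_permutation[OF permutation, of p] distinct_card by fastforce

lemma card_cyc_pos: "card (cyc x p) > 0"
  using least_power_of_permutation(2)[OF permutation] card_cyc by simp

lemma funpow_eq_self_iff: "(x ^^ j) p = p \<longleftrightarrow> card (cyc x p) dvd j"
  using least_power_dvd[OF permutation] card_cyc by simp

lemma neg_cyc_iff: "neg_cyc x p \<longleftrightarrow> (\<exists>a. (x ^^ a) p = - p)"
  by (simp add: neg_cyc_def cyc_def image_iff eq_commute)

lemma neg_cyc_scyc: "q \<in> scyc x p \<Longrightarrow> neg_cyc x q = neg_cyc x p"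
proof -
  have "neg_cyc x q" if q: "q \<in> scyc x p" and n: "neg_cyc x p" for p q
  proof -
    obtain a where a: "(x ^^ a) p = - p" using n by (auto simp: neg_cyc_iff)
    obtain s j where s: "s \<in> signs" "q = s * (x ^^ j) p" using q by (rule scycE)
    have "(x ^^ a) q = s * (x ^^ j) ((x ^^ a) p)"
      unfolding s(2) x(11)[OF s(1)] by (simp only: add.commute flip: comp_apply[of "x ^^ _" "x ^^ _"] funpow_add)
    then have "(x ^^ a) q = - q" using s a x(10) by auto
    then show ?thesis by (auto simp: neg_cyc_iff)
  qed
  then show "q \<in> scyc x p \<Longrightarrow> neg_cyc x q = neg_cyc x p" using scyc_sym by blast
qed

lemma slen_scyc: "q \<in> scyc x p \<Longrightarrow> slen x q = slen x p"
  using scyc_eq by (simp add: slen_def)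

lemma scyc_neg: "neg_cyc x p \<Longrightarrow> scyc x p = cyc x p"
proof -
  assume "neg_cyc x p"
  then obtain a where a: "(x ^^ a) p = - p" by (auto simp: neg_cyc_iff)
  have "- (x ^^ j) p = (x ^^ (j + a)) p" for j using a by (simp only: funpow_add comp_apply x(10))
  then show ?thesis by (auto simp: scyc_eq_cyc cyc_def)
qed

text \<open>If \<open>x ^^ a\<close> takes \<open>p\<close> to \<open>- p\<close>, the cycle length
  divides \<open>2 * a\<close> but not \<open>a\<close>, hence is even.\<close>

lemma card_cyc_neg:
  assumes "neg_cyc x p" "p \<in> P"
  shows "card (cyc x p) = 2 * slen x p"
proof -
  obtain a where a: "(x ^^ a) p = - p" using assms by (auto simp: neg_cyc_iff)
  have "(x ^^ (2 * a)) p = p" using a by (simp only: mult_2 funpow_add comp_apply x(10) minus_minus)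
  then have 1: "card (cyc x p) dvd 2 * a" by (simp add: funpow_eq_self_iff)
  have "- p \<noteq> p" using assms P(2) by auto
  then have "\<not> card (cyc x p) dvd a" using a by (simp flip: funpow_eq_self_iff)
  then have "even (card (cyc x p))"
    using 1 by (metis coprime_commute coprime_dvd_mult_right_iff coprime_left_2_iff_odd)
  then show ?thesis by (simp add: slen_def scyc_neg[OF assms(1)])
qed

lemma card_cyc_pos_type:
  assumes "\<not> neg_cyc x p" "p \<in> P"
  shows "card (cyc x p) = slen x p" "card (scyc x p) = 2 * card (cyc x p)"
proof -
  have "cyc x p \<inter> uminus ` cyc x p = {}"
  proof (rule ccontr)
    assume "cyc x p \<inter> uminus ` cyc x p \<noteq> {}"
    then obtain i j where "(x ^^ i) p = - (x ^^ j) p" by (auto simp: cyc_def)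
    moreover obtain i' where i': "\<And>p. (x ^^ i') ((x ^^ i) p) = p" using funpow_inverse by metis
    ultimately have "p = - (x ^^ (i' + j)) p" by (metis x(10) comp_apply funpow_add)
    then have "neg_cyc x p" unfolding neg_cyc_iff by (metis minus_minus)
    then show False using assms by simp
  qed
  moreover have "finite (cyc x p)" using cyc_subset[OF assms(2)] P(1) finite_subset by blast
  ultimately show "card (scyc x p) = 2 * card (cyc x p)"
    unfolding scyc_eq_cyc by (subst card_Un_disjoint) (auto simp: card_image)
  then show "card (cyc x p) = slen x p" by (simp add: slen_def)
qed

lemma card_scyc: "p \<in> P \<Longrightarrow> card (scyc x p) = 2 * slen x p"
  using card_cyc_neg card_cyc_pos_type scyc_neg by metis

lemma slen_pos: "p \<in> P \<Longrightarrow> slen x p > 0"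
  using card_scyc[of p] finite_scyc[of p] scyc_self[of p x] by (cases "slen x p = 0") auto

context
  fixes w assumes w: "signed_bij w" and comm: "\<And>p. w (x p) = x (w p)"
begin

lemma scyc_image: "w ` scyc x p = scyc x (w p)"
proof -
  have "w (s * (x ^^ j) p) = s * (x ^^ j) (w p)" if "s \<in> signs" for s j
    by (simp only: signed_bijD(2)[OF w that] funpow_commute_apply[of x w, OF comm[symmetric]])
  then have "w ` scyc x p = {s * (x ^^ j) (w p) |s j. s \<in> signs}"
    unfolding scyc_def image_Collect by (intro Collect_cong) metis
  then show ?thesis by (simp add: scyc_def)
qed

lemma scyc_imageI: "q \<in> scyc x p \<Longrightarrow> w q \<in> scyc x (w p)"
  using scyc_image by blast

lemma slen_image: "slen x (w p) = slen x p"
proof -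
  have "inj_on w (scyc x p)" using w by (simp add: signed_bij_def bij_def inj_on_subset[OF _ subset_UNIV])
  then show ?thesis unfolding slen_def scyc_image[symmetric] by (simp add: card_image)
qed

lemma neg_cyc_image: "neg_cyc x (w p) = neg_cyc x p"
proof -
  have "(x ^^ a) (w p) = - w p \<longleftrightarrow> (x ^^ a) p = - p" for a
    by (simp only: funpow_commute_apply[of x w, OF comm[symmetric]] signed_bijD(3)[OF w] flip: signed_bijD(1)[OF w, of p])
  then show ?thesis by (simp add: neg_cyc_iff)
qed

end

end

section \<open>The character of a centralizer\<close>

locale root_choice =
  fixes \<zeta> \<eta> :: "nat \<Rightarrow> complex"
  assumes zeta: "i > 0 \<Longrightarrow> root_order i (\<zeta> i)"
    and eta: "i > 0 \<Longrightarrow> root_order (2 * i) (\<eta> i)"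
begin

text \<open>The value prescribed at the single signed cycle of \<open>x\<close> through
  \<open>p\<close>. In both classes its order is the length of the cycle on the signed
  points.\<close>

definition croot :: "(int \<Rightarrow> int) \<Rightarrow> int \<Rightarrow> complex" where
  "croot x p = (if neg_cyc x p then \<eta> (slen x p) else \<zeta> (slen x p))"

text \<open>The value at the sign \<open>s\<close> acting on the signed cycle through
  \<open>p\<close>. For class -1, negation is the power \<open>slen x p\<close> of the cycle, and
  \<open>\<eta> i ^ i = -1\<close>; for class +1 the character is trivial on it.\<close>

definition csign :: "(int \<Rightarrow> int) \<Rightarrow> int \<Rightarrow> int \<Rightarrow> complex" where
  "csign x p s = (if neg_cyc x p then of_int s else 1)"

text \<open>For every such function \<open>v\<close>, the value of \<open>\<omega>\<^sup>x\<close> at \<open>w\<close> is the product of \<open>v (w r) / v r\<close> over one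
  point \<open>r\<close> of each signed cycle of \<open>x\<close>.\<close>

definition value_function :: "int set \<Rightarrow> (int \<Rightarrow> int) \<Rightarrow> (int \<Rightarrow> complex) \<Rightarrow> bool" where
  "value_function P x v \<longleftrightarrow> (\<forall>p\<in>P. v p \<noteq> 0 \<and>
     (\<forall>s j. s \<in> signs \<longrightarrow> v (s * (x ^^ j) p) = csign x p s * croot x p ^ j * v p))"

text \<open>The maximum depends only on the set \<open>scyc x p\<close>, so restricting
  \<open>x\<close> to a union of signed cycles does not change the representative.\<close>

definition rep :: "(int \<Rightarrow> int) \<Rightarrow> int \<Rightarrow> int" where
  "rep x p = Max (scyc x p)"

text \<open>The value function normalised to 1 at every representative. The coordinates
  \<open>(s, j)\<close> of a point are not unique; \<open>coordinate_value_unique\<close> shows that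
  the result does not depend on their choice.\<close>

definition cval :: "(int \<Rightarrow> int) \<Rightarrow> int \<Rightarrow> complex" where
  "cval x p = (case SOME (s, j). s \<in> signs \<and> p = s * (x ^^ j) (rep x p) of
     (s, j) \<Rightarrow> csign x p s * croot x p ^ j)"

text \<open>On the centralizer this is the product of the nonzero entries of a monomial matrix
  indexed by the signed cycles, that is, its determinant without the sign of the underlying
  permutation.\<close>

definition omega_char :: "int set \<Rightarrow> (int \<Rightarrow> int) \<Rightarrow> (int \<Rightarrow> int) \<Rightarrow> complex" where
  "omega_char P x w = (\<Prod>r \<in> rep x ` P. cval x (w r) / cval x r)"

definition transversal :: "int set \<Rightarrow> (int \<Rightarrow> int) \<Rightarrow> int set \<Rightarrow> bool" where
  "transversal P x R \<longleftrightarrow> R \<subseteq> P \<and> inj_on (scyc x) R \<and> scyc x ` R = scyc x ` P"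

lemma csign_mult: "csign x p (s * t) = csign x p s * csign x p t"
  by (simp add: csign_def)

lemma csign_one [simp]: "csign x p 1 = 1"
  by (simp add: csign_def)

lemma csign_nonzero: "s \<in> signs \<Longrightarrow> csign x p s \<noteq> 0"
  by (auto simp: csign_def)

lemma csign_square: "s \<in> signs \<Longrightarrow> csign x p s * csign x p s = 1"
  by (auto simp: csign_def)

end

locale signed_perm_roots = signed_perm P x + root_choice \<zeta> \<eta> for P x \<zeta> \<eta>
begin

lemma croot_order: "p \<in> P \<Longrightarrow> root_order (card (cyc x p)) (croot x p)"
  using zeta[of "slen x p"] eta[of "slen x p"] slen_pos[of p] card_cyc_neg[of p] card_cyc_pos_type(1)[of p]
  by (simp add: croot_def)

lemma croot_nonzero: "p \<in> P \<Longrightarrow> croot x p \<noteq> 0"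
  using croot_order[of p] card_cyc_pos[of p] root_orderD[of "card (cyc x p)" "croot x p" "card (cyc x p)"]
  by (auto simp: power_0_left split: if_splits)

lemma croot_scyc: "q \<in> scyc x p \<Longrightarrow> croot x q = croot x p"
  by (simp add: croot_def neg_cyc_scyc slen_scyc)

lemma csign_scyc: "q \<in> scyc x p \<Longrightarrow> csign x q s = csign x p s"
  by (simp add: csign_def neg_cyc_scyc)

text \<open>Either \<open>s = 1\<close> and \<open>j\<close> is a multiple of the cycle length, or
  \<open>x ^^ j\<close> takes \<open>p\<close> to \<open>- p\<close>. In the second case
  \<open>croot x p ^ j\<close> squares to 1 without being 1, so it is -1 and cancels
  \<open>csign\<close>.\<close>

lemma stabilizer_value:
  assumes p: "p \<in> P" and s: "s \<in> signs" and eq: "s * (x ^^ j) p = p"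
  shows "csign x p s * croot x p ^ j = 1"
proof (cases "s = 1")
  case True
  then have "card (cyc x p) dvd j" using eq by (simp flip: funpow_eq_self_iff)
  then show ?thesis using root_orderD[OF croot_order[OF p]] True by simp
next
  case False
  then have s: "s = -1" using s by simp
  then have j: "(x ^^ j) p = - p" using eq by simp
  then have n: "neg_cyc x p" by (auto simp: neg_cyc_iff)
  have "(x ^^ (2 * j)) p = p" using j by (simp only: mult_2 funpow_add comp_apply x(10) minus_minus)
  then have "croot x p ^ (2 * j) = 1" using root_orderD[OF croot_order[OF p]] by (simp add: funpow_eq_self_iff)
  then have "(croot x p ^ j)\<^sup>2 = 1" by (simp add: mult.commute flip: power_mult)
  moreover have "(x ^^ j) p \<noteq> p" using j p P(2) by auto
  then have "croot x p ^ j \<noteq> 1" using root_orderD[OF croot_order[OF p]] by (simp add: funpow_eq_self_iff)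
  ultimately have "croot x p ^ j = -1" by (simp add: power2_eq_1_iff)
  then show ?thesis using n s by (simp add: csign_def)
qed

text \<open>Two pairs of coordinates of one point differ by an element stabilizing \<open>p\<close>,
  whose value is 1. The difference of exponents is formed for \<open>j' \<le> j\<close>, the other
  case being symmetric.\<close>

lemma coordinate_value_unique:
  assumes p: "p \<in> P" and s: "s \<in> signs" "s' \<in> signs" and eq: "s * (x ^^ j) p = s' * (x ^^ j') p"
  shows "csign x p s * croot x p ^ j = csign x p s' * croot x p ^ j'"
proof -
  have *: "csign x p s * croot x p ^ j = csign x p s' * croot x p ^ j'"
    if s: "s \<in> signs" "s' \<in> signs" and eq: "s * (x ^^ j) p = s' * (x ^^ j') p" and le: "j' \<le> j" for s s' j j'
  proof -
    obtain b where b: "\<And>p. (x ^^ b) ((x ^^ j') p) = p" using funpow_inverse by metis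
    have "(x ^^ b) (s * (x ^^ j) p) = (x ^^ b) (s' * (x ^^ j') p)" by (simp only: eq)
    then have "s * (x ^^ b) ((x ^^ j) p) = s' * p" by (simp only: x(11) s b)
    moreover have "(x ^^ b) ((x ^^ j) p) = (x ^^ (j - j')) p"
      using b[of "(x ^^ (j - j')) p"] le by (metis comp_apply funpow_add le_add_diff_inverse)
    ultimately have "(s' * s) * (x ^^ (j - j')) p = p" using s by auto
    then have "csign x p (s' * s) * croot x p ^ (j - j') = 1"
      using s by (intro stabilizer_value[OF p]) auto
    then have 1: "csign x p s' * csign x p s * croot x p ^ (j - j') = 1" by (simp add: csign_mult)
    have "csign x p s * croot x p ^ j = (csign x p s' * csign x p s') * csign x p s * (croot x p ^ (j - j') * croot x p ^ j')"
      using le by (simp only: csign_square[OF s(2)] flip: power_add) simp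
    also have "\<dots> = csign x p s' * croot x p ^ j' * (csign x p s' * csign x p s * croot x p ^ (j - j'))" by (simp only: mult_ac)
    finally show ?thesis by (simp only: 1 mult_1_right)
  qed
  show ?thesis using *[OF s eq] *[OF s(2,1) eq[symmetric]] by (metis nat_le_linear)
qed

lemma rep_in: "p \<in> P \<Longrightarrow> rep x p \<in> scyc x p"
  unfolding rep_def using finite_scyc[of p] scyc_self[of p x] by (intro Max_in) auto

lemma rep_in_P: "p \<in> P \<Longrightarrow> rep x p \<in> P"
  using rep_in scyc_subset by blast

lemma rep_scyc: "q \<in> scyc x p \<Longrightarrow> rep x q = rep x p"
  using scyc_eq by (simp add: rep_def)

lemma cval_eq:
  assumes p: "p \<in> P" and s: "s \<in> signs" and eq: "p = s * (x ^^ j) (rep x p)"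
  shows "cval x p = csign x p s * croot x p ^ j"
proof -
  obtain s' j' where sj: "(SOME (s, j). s \<in> signs \<and> p = s * (x ^^ j) (rep x p)) = (s', j')" by fastforce
  have "case (s', j') of (s, j) \<Rightarrow> s \<in> signs \<and> p = s * (x ^^ j) (rep x p)"
    unfolding sj[symmetric] by (rule someI[of _ "(s, j)"]) (use s eq in auto)
  then have s': "s' \<in> signs" "p = s' * (x ^^ j') (rep x p)" by auto
  have "cval x p = csign x p s' * croot x p ^ j'" unfolding cval_def sj by simp
  then show ?thesis
    using coordinate_value_unique[OF rep_in_P[OF p] s'(1) s, of j' j] s' eq
      croot_scyc[OF rep_in[OF p]] csign_scyc[OF rep_in[OF p]] by metis
qed

lemma value_function_cval: "value_function P x (cval x)"
  unfolding value_function_def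
proof (intro ballI conjI allI impI)
  fix p assume p: "p \<in> P"
  obtain t i where t: "t \<in> signs" "p = t * (x ^^ i) (rep x p)"
    using scyc_sym[OF rep_in[OF p]] by (rule scycE)
  have v: "cval x p = csign x p t * croot x p ^ i" by (rule cval_eq[OF p t])
  show "cval x p \<noteq> 0" using v csign_nonzero[OF t(1)] croot_nonzero[OF p] by simp
  fix s :: int and j assume s: "s \<in> signs"
  define q where "q = s * (x ^^ j) p"
  have q: "q \<in> scyc x p" using scycI[OF s] by (simp add: q_def)
  have "q = (s * t) * (x ^^ (j + i)) (rep x p)"
    unfolding q_def by (subst t(2)) (simp only: x(11) t(1) funpow_add comp_apply mult.assoc)
  then have "q = (s * t) * (x ^^ (j + i)) (rep x q)" unfolding rep_scyc[OF q] .
  then have "cval x q = csign x q (s * t) * croot x q ^ (j + i)"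
    using s t(1) scyc_subset[OF p] q by (intro cval_eq) auto
  then show "cval x (s * (x ^^ j) p) = csign x p s * croot x p ^ j * cval x p"
    by (simp add: csign_mult power_add croot_scyc[OF q] csign_scyc[OF q] v flip: q_def)
qed

lemma value_functionD:
  assumes "value_function P x v" "p \<in> P"
  shows "v p \<noteq> 0" "s \<in> signs \<Longrightarrow> v (s * (x ^^ j) p) = csign x p s * croot x p ^ j * v p"
    "v (x p) = croot x p * v p" "v (- p) = csign x p (-1) * v p"
proof -
  show "v p \<noteq> 0" and *: "s \<in> signs \<Longrightarrow> v (s * (x ^^ j) p) = csign x p s * croot x p ^ j * v p" for s j
    using assms by (auto simp: value_function_def)
  show "v (x p) = croot x p * v p" "v (- p) = csign x p (-1) * v p"
    using *[of 1 1] *[of "-1" 0] by simp_all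
qed

lemma transversal_rep: "transversal P x (rep x ` P)"
  unfolding transversal_def
proof (intro conjI)
  show "rep x ` P \<subseteq> P" using rep_in_P by auto
  show "inj_on (scyc x) (rep x ` P)"
    by (rule inj_onI) (metis (no_types, lifting) imageE rep_def rep_in scyc_eq)
  show "scyc x ` rep x ` P = scyc x ` P"
    unfolding image_image using scyc_eq[OF rep_in] by (intro image_cong) auto
qed

lemma prod_transversal:
  assumes R: "transversal P x R" "transversal P x R'"
    and f: "\<And>p q. p \<in> P \<Longrightarrow> q \<in> scyc x p \<Longrightarrow> f q = f p"
  shows "(\<Prod>r\<in>R. f r) = (\<Prod>r\<in>R'. f r :: complex)"
proof -
  define F where "F Q = f (SOME q. q \<in> Q)" for Q
  have F: "F (scyc x p) = f p" if "p \<in> P" for p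
    unfolding F_def using someI[of "\<lambda>q. q \<in> scyc x p" p] f[OF that] scyc_self by blast
  have *: "(\<Prod>r\<in>R. f r) = (\<Prod>Q\<in>scyc x ` P. F Q)" if "transversal P x R" for R
  proof -
    have "(\<Prod>Q\<in>scyc x ` P. F Q) = (\<Prod>Q\<in>scyc x ` R. F Q)" using that by (simp add: transversal_def)
    also have "\<dots> = (\<Prod>r\<in>R. F (scyc x r))"
      using that by (subst prod.reindex) (auto simp: transversal_def)
    also have "\<dots> = (\<Prod>r\<in>R. f r)" using that by (intro prod.cong) (auto simp: transversal_def F)
    finally show ?thesis by simp
  qed
  show ?thesis using *[OF R(1)] *[OF R(2)] by simp
qed

end

locale commuting = signed_perm_roots P x \<zeta> \<eta> for P x \<zeta> \<eta> +
  fixes w :: "int \<Rightarrow> int"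
  assumes w: "signed_bij w" and wP: "w ` P = P" and comm: "\<And>p. w (x p) = x (w p)"
begin

lemma w_in: "p \<in> P \<Longrightarrow> w p \<in> P" using wP by auto

lemmas image = scyc_image[OF w comm] scyc_imageI[OF w comm] slen_image[OF w comm] neg_cyc_image[OF w comm]

lemma croot_image: "croot x (w p) = croot x p" and csign_image: "csign x (w p) s = csign x p s"
  by (simp_all add: croot_def csign_def image)

lemma transversal_image: "transversal P x R \<Longrightarrow> transversal P x (w ` R)"
proof -
  assume R: "transversal P x R"
  have inj: "p = q" if "w ` A = w ` B" "A = scyc x p" "B = scyc x q" "p \<in> R" "q \<in> R" for A B p q
  proof -
    have "A = B" using that(1) w by (auto simp: signed_bij_def bij_def inj_image_eq_iff)
    then show ?thesis using that R by (auto simp: transversal_def inj_on_def)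
  qed
  show ?thesis unfolding transversal_def
  proof (intro conjI)
    show "w ` R \<subseteq> P" using R w_in by (auto simp: transversal_def)
    show "inj_on (scyc x) (w ` R)" using inj by (auto simp: inj_on_def image(1)[symmetric])
    have "scyc x ` w ` R = (`) w ` scyc x ` R" by (simp add: image_image image(1))
    also have "\<dots> = (`) w ` scyc x ` P" using R by (simp add: transversal_def)
    also have "\<dots> = scyc x ` w ` P" by (simp add: image_image image(1))
    finally show "scyc x ` w ` R = scyc x ` P" by (simp add: wP)
  qed
qed

lemma prod_shift:
  assumes R: "transversal P x R" and f: "\<And>p q. p \<in> P \<Longrightarrow> q \<in> scyc x p \<Longrightarrow> f q = f p"
  shows "(\<Prod>r\<in>R. f (w r)) = (\<Prod>r\<in>R. f r :: complex)"
proof -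
  have "(\<Prod>r\<in>w ` R. f r) = (\<Prod>r\<in>R. f (w r))"
    using w by (subst prod.reindex) (auto simp: signed_bij_def bij_def intro: inj_on_subset)
  then show ?thesis using prod_transversal[OF transversal_image[OF R] R f] by simp
qed

text \<open>Commuting with \<open>x\<close> and with negation, \<open>w\<close> preserves
  coordinates; it also preserves lengths and classes. Numerator and denominator therefore acquire
  the same factor along a signed cycle.\<close>

lemma ratio_const:
  assumes v: "value_function P x v" and p: "p \<in> P" and q: "q \<in> scyc x p"
  shows "v (w q) / v q = v (w p) / v p"
proof -
  obtain s j where s: "s \<in> signs" "q = s * (x ^^ j) p" using q by (rule scycE)
  have "w q = s * (x ^^ j) (w p)"
    using signed_bijD(2)[OF w s(1)] funpow_commute_apply[of x w, OF comm[symmetric]] s(2) by simp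
  then show ?thesis
    using s value_functionD[OF v p] value_functionD[OF v w_in[OF p]] csign_nonzero[OF s(1), of x p] croot_nonzero[OF p]
    by (simp add: croot_image csign_image)
qed

text \<open>Two value functions differ by a factor that is constant on signed cycles, and
  \<open>w\<close> permutes these, so the factor cancels from the product. The freedom in
  \<open>v\<close> and \<open>R\<close> is used for conjugation, for the complement, and for a
  transversal made of powers of \<open>g\<close>.\<close>

lemma omega_char_eq:
  assumes v: "value_function P x v" and R: "transversal P x R"
  shows "omega_char P x w = (\<Prod>r\<in>R. v (w r) / v r)"
proof -
  define f where "f p = cval x p / v p" for p
  have f: "f q = f p" if p: "p \<in> P" and q: "q \<in> scyc x p" for p q
  proof -
    obtain s j where s: "s \<in> signs" "q = s * (x ^^ j) p" using q by (rule scycE)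
    show ?thesis
      using s value_functionD(1,2)[OF v p] value_functionD(1,2)[OF value_function_cval p]
        csign_nonzero[OF s(1), of x p] croot_nonzero[OF p] by (simp add: f_def)
  qed
  have RP: "R \<subseteq> P" using R by (simp add: transversal_def)
  have fR: "(\<Prod>r\<in>R. f r) \<noteq> 0"
    using RP P(1) value_functionD(1)[OF v] value_functionD(1)[OF value_function_cval]
    by (subst prod_zero_iff) (auto simp: f_def intro: finite_subset)
  have "omega_char P x w = (\<Prod>r\<in>R. cval x (w r) / cval x r)"
    unfolding omega_char_def by (rule prod_transversal[OF transversal_rep R ratio_const[OF value_function_cval]])
  also have "\<dots> = (\<Prod>r\<in>R. (v (w r) / v r) * (f (w r) / f r))"
    using RP value_functionD(1)[OF v] value_functionD(1)[OF value_function_cval] w_in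
    by (intro prod.cong refl) (simp add: f_def subset_iff)
  also have "\<dots> = (\<Prod>r\<in>R. v (w r) / v r) * ((\<Prod>r\<in>R. f (w r)) / (\<Prod>r\<in>R. f r))"
    by (simp add: prod.distrib prod_dividef)
  also have "(\<Prod>r\<in>R. f (w r)) = (\<Prod>r\<in>R. f r)" by (rule prod_shift[OF R f])
  finally show ?thesis using fR by simp
qed

lemma omega_char_nonzero: "omega_char P x w \<noteq> 0"
  unfolding omega_char_def using P(1) rep_in_P w_in value_functionD(1)[OF value_function_cval]
  by (subst prod_zero_iff) auto

end

section \<open>The explicit character: multiplicativity, conjugation, restriction to subsets\<close>

context signed_perm_roots
begin

lemma commutingI:
  "signed_bij w \<Longrightarrow> w ` P = P \<Longrightarrow> (\<And>p. w (x p) = x (w p)) \<Longrightarrow> commuting P x \<zeta> \<eta> w"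
  by unfold_locales

text \<open>A cocycle identity: the quotient of \<open>v \<circ> w\<close> at \<open>r\<close> is
  that of \<open>v\<close> at \<open>w r\<close> times that of \<open>w\<close> at \<open>r\<close>,
  and the former can be moved back from \<open>w r\<close> to \<open>r\<close> because
  \<open>w\<close> permutes the signed cycles.\<close>

lemma omega_char_comp:
  assumes v: "commuting P x \<zeta> \<eta> v" and w: "commuting P x \<zeta> \<eta> w"
  shows "omega_char P x (v \<circ> w) = omega_char P x v * omega_char P x w"
proof -
  interpret v: commuting P x \<zeta> \<eta> v by fact
  interpret w: commuting P x \<zeta> \<eta> w by fact
  let ?f = "\<lambda>p. cval x (v p) / cval x p"
  have nz: "cval x p \<noteq> 0" if "p \<in> P" for p by (rule value_functionD(1)[OF value_function_cval that])
  have "omega_char P x (v \<circ> w) = (\<Prod>r \<in> rep x ` P. ?f (w r) * (cval x (w r) / cval x r))"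
    unfolding omega_char_def using nz rep_in_P w.w_in by (intro prod.cong) auto
  also have "\<dots> = (\<Prod>r \<in> rep x ` P. ?f (w r)) * omega_char P x w" by (simp only: prod.distrib omega_char_def)
  also have "(\<Prod>r \<in> rep x ` P. ?f (w r)) = (\<Prod>r \<in> rep x ` P. ?f r)"
    by (rule w.prod_shift[OF transversal_rep v.ratio_const[OF value_function_cval]])
  finally show ?thesis by (simp add: omega_char_def)
qed

end

context root_choice
begin

text \<open>Transport of structure: composing \<open>cval x\<close> with the inverse of
  \<open>t\<close> gives a value function for \<open>x'\<close>, and \<open>t\<close> maps a
  transversal to a transversal. Neither is the canonical one for \<open>x'\<close> in general, since
  a maximum is not preserved by \<open>t\<close>.\<close>

lemma omega_char_conjugate:
  assumes x: "signed_perm P x" and x': "signed_perm P x'" and w: "commuting P x \<zeta> \<eta> w" and w': "commuting P x' \<zeta> \<eta> w'"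
    and t: "t \<in> signed_perms P" and tx: "\<And>p. x' (t p) = t (x p)" and tw: "\<And>p. w' (t p) = t (w p)"
  shows "omega_char P x' w' = omega_char P x w"
proof -
  interpret x: signed_perm_roots P x \<zeta> \<eta> using x by (intro signed_perm_roots.intro root_choice_axioms)
  interpret x': signed_perm_roots P x' \<zeta> \<eta> using x' by (intro signed_perm_roots.intro root_choice_axioms)
  interpret w: commuting P x \<zeta> \<eta> w by fact
  interpret w': commuting P x' \<zeta> \<eta> w' by fact
  note t = signed_permsD[OF t] signed_bijD[OF signed_permsD(2)[OF t]]
  have act: "s * (x' ^^ j) (t p) = t (s * (x ^^ j) p)" if "s \<in> signs" for s j p
  proof -
    have "(x' ^^ j) (t p) = t ((x ^^ j) p)" by (induction j) (auto simp: tx)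
    then show ?thesis by (simp add: t(6)[OF that])
  qed
  have scyc: "scyc x' (t p) = t ` scyc x p" for p
    unfolding scyc_def image_Collect by (intro Collect_cong) (metis act)
  have slen: "slen x' (t p) = slen x p" for p
    unfolding slen_def scyc using t(2) by (simp add: card_image signed_bij_def bij_def inj_on_subset[OF _ subset_UNIV])
  have neg: "neg_cyc x' (t p) = neg_cyc x p" for p
    using act[of 1] by (simp add: x.neg_cyc_iff x'.neg_cyc_iff t(7) flip: t(5)[of p])
  have croot: "croot x' (t p) = croot x p" and csign: "csign x' (t p) s = csign x p s" for p s
    by (simp_all add: croot_def csign_def slen neg)
  have tP: "p \<in> P \<longleftrightarrow> t p \<in> P" for p using t(1) by (simp add: permutes_in_image)
  define v where "v p = cval x (finv t p)" for p
  have v: "v (t p) = cval x p" for p by (simp add: v_def t(9))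
  have vf: "value_function P x' v"
    unfolding value_function_def
  proof
    fix p' assume p': "p' \<in> P"
    define p where "p = finv t p'"
    have p: "p' = t p" "p \<in> P" using p' t(8)[of p'] tP[of "finv t p'"] by (simp_all add: p_def)
    show "v p' \<noteq> 0 \<and> (\<forall>s j. s \<in> signs \<longrightarrow> v (s * (x' ^^ j) p') = csign x' p' s * croot x' p' ^ j * v p')"
      unfolding p(1)
    proof (intro conjI allI impI)
      show "v (t p) \<noteq> 0" using x.value_functionD(1)[OF x.value_function_cval p(2)] by (simp only: v not_False_eq_True)
      show "v (s * (x' ^^ j) (t p)) = csign x' (t p) s * croot x' (t p) ^ j * v (t p)" if "s \<in> signs" for s j
        unfolding act[OF that] v croot csign by (rule x.value_functionD(2)[OF x.value_function_cval p(2) that])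
    qed
  qed
  let ?R = "rep x ` P"
  have R: "transversal P x ?R" by (rule x.transversal_rep)
  have tR: "transversal P x' (t ` ?R)"
    unfolding transversal_def
  proof (intro conjI)
    show "t ` ?R \<subseteq> P" using x.rep_in_P tP by auto
    have inj: "p = q" if "p \<in> ?R" "q \<in> ?R" "t ` scyc x p = t ` scyc x q" for p q
    proof -
      have "scyc x p = scyc x q" using that(3) t(2) by (auto simp: signed_bij_def bij_def inj_image_eq_iff)
      then show ?thesis using R that by (auto simp: transversal_def inj_on_def)
    qed
    show "inj_on (scyc x') (t ` ?R)"
    proof (rule inj_onI, elim imageE[of _ t])
      fix a b p q assume "scyc x' a = scyc x' b" "a = t p" "b = t q" "p \<in> ?R" "q \<in> ?R"
      moreover from this have "p = q" by (intro inj) (simp_all only: scyc)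
      ultimately show "a = b" by simp
    qed
    have "scyc x' ` t ` ?R = (`) t ` scyc x ` ?R" by (simp add: image_image scyc)
    also have "\<dots> = (`) t ` scyc x ` P" using R by (simp only: transversal_def)
    also have "\<dots> = scyc x' ` t ` P" by (simp add: image_image scyc)
    finally show "scyc x' ` t ` ?R = scyc x' ` P" by (simp add: t(3))
  qed
  have "omega_char P x' w' = (\<Prod>r\<in>t ` ?R. v (w' r) / v r)" by (rule w'.omega_char_eq[OF vf tR])
  also have "\<dots> = (\<Prod>r\<in>?R. v (w' (t r)) / v (t r))"
    using t(2) by (subst prod.reindex) (auto simp: signed_bij_def bij_def intro: inj_on_subset)
  also have "\<dots> = omega_char P x w" by (simp add: tw v omega_char_def)
  finally show ?thesis .
qed

lemma scyc_cong:
  assumes "\<And>q. q \<in> B \<Longrightarrow> x q = y q" "x ` B \<subseteq> B" "p \<in> B"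
  shows "scyc x p = scyc y p" "neg_cyc x p = neg_cyc y p" "slen x p = slen y p"
    "croot x p = croot y p" "csign x p s = csign y p s"
proof -
  have eq: "(x ^^ j) p = (y ^^ j) p" for j using cyc_cong(1)[of B x y p j] assms by blast
  then show s: "scyc x p = scyc y p" and n: "neg_cyc x p = neg_cyc y p"
    by (simp_all add: scyc_def neg_cyc_def cyc_def)
  show "slen x p = slen y p" by (simp add: slen_def s)
  then show "croot x p = croot y p" "csign x p s = csign y p s" by (simp_all add: croot_def csign_def n)
qed

text \<open>This lets \<open>x\<close> and \<open>w\<close> be replaced by their restrictions to a
  block, or be extended again.\<close>

lemma omega_char_cong:
  assumes x: "\<And>q. q \<in> B \<Longrightarrow> x q = y q" "x ` B \<subseteq> B" and w: "\<And>q. q \<in> B \<Longrightarrow> w q = w' q" "w ` B \<subseteq> B"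
    and rep: "\<And>q. q \<in> B \<Longrightarrow> rep x q \<in> B"
  shows "omega_char B x w = omega_char B y w'"
proof -
  have r: "rep x p = rep y p" if "p \<in> B" for p using scyc_cong(1)[OF x that] by (simp add: rep_def)
  have v: "cval x p = cval y p" if "p \<in> B" for p
  proof -
    have "(x ^^ j) (rep x p) = (y ^^ j) (rep y p)" for j
      using cyc_cong(1)[of B x y "rep x p" j] x rep[OF that] r[OF that] by simp
    then show ?thesis unfolding cval_def using scyc_cong(4,5)[OF x that] by simp
  qed
  have "rep x ` B = rep y ` B" using r by auto
  moreover have "cval x (w q) / cval x q = cval y (w' q) / cval y q" if "q \<in> rep x ` B" for q
  proof -
    have "q \<in> B" using that rep by auto
    then show ?thesis using v w by (metis imageI subsetD)
  qed
  ultimately show ?thesis unfolding omega_char_def by (intro prod.cong) auto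
qed

end

context signed_perm_roots
begin

lemma omega_char_union:
  assumes "A \<subseteq> P" "B \<subseteq> P" "A \<inter> B = {}"
    and "\<And>p. p \<in> A \<Longrightarrow> scyc x p \<subseteq> A" "\<And>p. p \<in> B \<Longrightarrow> scyc x p \<subseteq> B"
  shows "omega_char (A \<union> B) x w = omega_char A x w * omega_char B x w"
proof -
  have "rep x ` A \<subseteq> A" "rep x ` B \<subseteq> B" using assms rep_in by blast+
  moreover have "finite A" "finite B" using assms(1,2) P(1) by (auto intro: finite_subset)
  ultimately show ?thesis unfolding omega_char_def image_Un
    using assms(3) by (intro prod.union_disjoint) auto
qed

definition Z :: "(int \<Rightarrow> int) set" where
  "Z = {z \<in> signed_perms P. \<forall>p. z (x p) = x (z p)}"

lemma Z_commuting: "z \<in> Z \<Longrightarrow> commuting P x \<zeta> \<eta> z"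
  by (intro commutingI) (auto simp: Z_def signed_permsD)

lemma Z_comp: "u \<in> Z \<Longrightarrow> v \<in> Z \<Longrightarrow> u \<circ> v \<in> Z"
  by (auto simp: Z_def intro: signed_perms_comp)

lemma Z_inv: "u \<in> Z \<Longrightarrow> finv u \<in> Z"
proof -
  assume u: "u \<in> Z"
  then have s: "u \<in> signed_perms P" and c: "u (x p) = x (u p)" for p by (auto simp: Z_def)
  note d = signed_bijD[OF signed_permsD(2)[OF s]]
  have "finv u (x p) = x (finv u p)" for p
    using c[of "finv u p"] d(4,5) by metis
  then show "finv u \<in> Z" using signed_perms_inv[OF s] by (simp add: Z_def)
qed

lemma omega_char_Z_comp: "u \<in> Z \<Longrightarrow> v \<in> Z \<Longrightarrow> omega_char P x (u \<circ> v) = omega_char P x u * omega_char P x v"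
  by (intro omega_char_comp Z_commuting)

lemma restrict_in_Z:
  assumes u: "signed_bij u" and comm: "\<And>p. u (x p) = x (u p)"
    and A: "A \<subseteq> P" "u ` A = A" "\<And>p. p \<in> A \<Longrightarrow> scyc x p \<subseteq> A"
  shows "perm_restrict u A \<in> Z"
proof -
  have xA: "x p \<in> A \<longleftrightarrow> p \<in> A" for p
    using A(3)[of p] A(3)[of "x p"] scyc_x[of p] scyc_sym[OF scyc_x[of p]] by blast
  have mA: "- p \<in> A \<longleftrightarrow> p \<in> A" for p
    using A(3)[of p] A(3)[of "- p"] scyc_minus[of p] scyc_minus[of "- p"] by auto
  have "signed_set A"
  proof -
    have "uminus ` A = A" using mA by (auto simp: image_iff) (metis minus_minus)
    then show ?thesis using A(1) P(1,2) by (auto simp: signed_set_def intro: finite_subset)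
  qed
  then have "perm_restrict u A \<in> signed_perms A" using u A(2) by (intro perm_restrict_signed_perms)
  then have "perm_restrict u A \<in> signed_perms P"
    using A(1) by (auto simp: signed_perms_def intro: permutes_subset)
  moreover have "perm_restrict u A (x p) = x (perm_restrict u A p)" for p
    using xA comm by (simp add: perm_restrict_def)
  ultimately show ?thesis by (simp add: Z_def)
qed

lemma restrict_scyc_in_Z:
  assumes u: "signed_bij u" and comm: "\<And>p. u (x p) = x (u p)" and p: "p \<in> P" "u p \<in> scyc x p"
  shows "perm_restrict u (scyc x p) \<in> Z"
  using scyc_image[OF u comm, of p] scyc_eq p scyc_subset[OF p(1)]
  by (intro restrict_in_Z[OF u comm]) blast+

text \<open>All representatives outside \<open>scyc x p\<close> are fixed, so one factor survives;
  by constancy of the ratio it can be read off at \<open>p\<close> itself.\<close>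

lemma omega_char_restrict_scyc:
  assumes u: "signed_bij u" "u ` P = P" and comm: "\<And>p. u (x p) = x (u p)" and p: "p \<in> P" "u p \<in> scyc x p"
  shows "omega_char P x (perm_restrict u (scyc x p)) = cval x (u p) / cval x p"
proof -
  interpret u: commuting P x \<zeta> \<eta> u using u comm by (rule commutingI)
  let ?r = "rep x p"
  have nz: "cval x r \<noteq> 0" if "r \<in> P" for r using value_functionD(1)[OF value_function_cval that] .
  have "omega_char P x (perm_restrict u (scyc x p)) = (\<Prod>r\<in>rep x ` P. if r = ?r then cval x (u r) / cval x r else 1)"
    unfolding omega_char_def
  proof (rule prod.cong)
    fix r assume "r \<in> rep x ` P"
    then obtain q where q: "q \<in> P" "r = rep x q" by auto
    have "r \<in> scyc x p \<longleftrightarrow> r = ?r"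
      using rep_in[OF p(1)] rep_in[OF q(1)] q(2) rep_scyc scyc_sym scyc_trans by metis
    then show "cval x (perm_restrict u (scyc x p) r) / cval x r = (if r = ?r then cval x (u r) / cval x r else 1)"
      using nz[OF rep_in_P[OF q(1)]] q(2) by (simp add: perm_restrict_def)
  qed simp
  also have "\<dots> = cval x (u ?r) / cval x ?r" using P(1) p(1) by (subst prod.delta) auto
  also have "\<dots> = cval x (u p) / cval x p" by (rule u.ratio_const[OF value_function_cval p(1) rep_in[OF p(1)]])
  finally show ?thesis .
qed

end

context signed_perm_roots
begin

lemma funpow_in_Z: "u \<in> Z \<Longrightarrow> u ^^ j \<in> Z"
proof (induction j)
  case 0
  show ?case by (simp add: Z_def signed_perms_id flip: id_def)
qed (simp add: Z_comp)

lemma signed_bij_uminus: "signed_bij uminus"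
  by (simp add: signed_bij_def bij_uminus)

lemma uminus_image: "uminus ` P = P"
  using signed_set by (simp add: signed_set_def)

lemma restrict_minus_in_Z: "p \<in> P \<Longrightarrow> perm_restrict uminus (scyc x p) \<in> Z"
  by (intro restrict_scyc_in_Z signed_bij_uminus) (simp_all add: x(5) scyc_minus)

lemma restrict_x_in_Z: "p \<in> P \<Longrightarrow> perm_restrict x (scyc x p) \<in> Z"
  by (intro restrict_scyc_in_Z x(2)) (simp_all add: scyc_x)

lemma omega_char_restrict_minus:
  "p \<in> P \<Longrightarrow> omega_char P x (perm_restrict uminus (scyc x p)) = csign x p (-1)"
  using omega_char_restrict_scyc[OF signed_bij_uminus uminus_image, of p] value_functionD[OF value_function_cval, of p]
  by (simp add: x(5) scyc_minus)

lemma omega_char_restrict_x: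
  "p \<in> P \<Longrightarrow> omega_char P x (perm_restrict x (scyc x p)) = croot x p"
  using omega_char_restrict_scyc[OF x(2,3), of p] value_functionD[OF value_function_cval, of p]
  by (simp add: scyc_x)

lemma omega_char_id: "omega_char P x id = 1"
  unfolding omega_char_def using value_functionD(1)[OF value_function_cval] rep_in_P
  by (intro prod.neutral) auto

text \<open>If the product is taken over \<open>R\<close>, the numerators are a permutation of the
  denominators.\<close>

lemma omega_char_stabilizer:
  assumes R: "transversal P x R" and s: "s \<in> Z" "s ` R = R"
  shows "omega_char P x s = 1"
proof -
  interpret s: commuting P x \<zeta> \<eta> s using s(1) by (rule Z_commuting)
  have RP: "R \<subseteq> P" "finite R" using R P(1) by (auto simp: transversal_def intro: finite_subset)
  have "(\<Prod>r\<in>R. cval x (s r)) = (\<Prod>r\<in>s ` R. cval x r)"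
    using s.w by (subst prod.reindex) (auto simp: signed_bij_def bij_def intro: inj_on_subset)
  then have "omega_char P x s = (\<Prod>r\<in>R. cval x r) / (\<Prod>r\<in>R. cval x r)"
    using s.omega_char_eq[OF value_function_cval R] s(2) by (simp add: prod_dividef)
  moreover have "(\<Prod>r\<in>R. cval x r) \<noteq> 0"
    using RP value_functionD(1)[OF value_function_cval] by (subst prod_zero_iff) auto
  ultimately show ?thesis by simp
qed

section \<open>Uniqueness of the character with the prescribed values\<close>

context
  fixes \<omega> :: "(int \<Rightarrow> int) \<Rightarrow> complex" and R
  assumes mult: "\<And>u v. u \<in> Z \<Longrightarrow> v \<in> Z \<Longrightarrow> \<omega> (u \<circ> v) = \<omega> u * \<omega> v"
    and minus: "\<And>p. p \<in> P \<Longrightarrow> \<not> neg_cyc x p \<Longrightarrow> \<omega> (perm_restrict uminus (scyc x p)) = 1"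
    and cycle: "\<And>p. p \<in> P \<Longrightarrow> \<omega> (perm_restrict x (scyc x p)) = croot x p"
    and R: "transversal P x R" and complement: "\<And>s. s \<in> Z \<Longrightarrow> s ` R = R \<Longrightarrow> \<omega> s = 1"
begin

lemma id_in_Z: "id \<in> Z"
  by (simp add: Z_def signed_perms_id)

lemma character_id: "\<omega> id = 1"
  by (rule complement[OF id_in_Z]) simp

text \<open>An element commuting with \<open>x\<close> is determined on a signed cycle by the image
  of one point. Hence it acts there as \<open>s * x ^^ j\<close>, a product of the elements at which
  \<open>\<omega>\<close> is prescribed.\<close>

lemma character_restrict_scyc:
  assumes b: "b \<in> Z" and p: "p \<in> P" and bp: "b p \<in> scyc x p"
  shows "\<omega> (perm_restrict b (scyc x p)) = omega_char P x (perm_restrict b (scyc x p))"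
proof -
  let ?Q = "scyc x p"
  interpret b: commuting P x \<zeta> \<eta> b using b by (rule Z_commuting)
  have bp': "b p \<in> cyc x p" if "neg_cyc x p" using bp scyc_neg[OF that] by simp
  \<comment> \<open>For class -1 the sign is absorbed into \<open>j\<close>, since
    \<open>\<omega>\<close> is prescribed at negation only for class +1.\<close>
  obtain s j where s: "s \<in> signs" "b p = s * (x ^^ j) p" and pos: "neg_cyc x p \<Longrightarrow> s = 1"
  proof (cases "neg_cyc x p")
    case True
    then obtain j where "b p = (x ^^ j) p" using bp' by (auto simp: cyc_def)
    then show ?thesis using that[of 1 j] by simp
  next
    case False
    obtain s j where "s \<in> signs" "b p = s * (x ^^ j) p" using bp by (rule scycE)
    then show ?thesis using that False by blast
  qed
  have bq: "b q = s * (x ^^ j) q" if q: "q \<in> ?Q" for q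
  proof -
    obtain t i where t: "t \<in> signs" "q = t * (x ^^ i) p" using q by (rule scycE)
    have "b q = t * (x ^^ i) (b p)"
      unfolding t(2) by (simp only: signed_bijD(2)[OF b.w t(1)] funpow_commute_apply[of x b, OF b.comm[symmetric]])
    also have "\<dots> = s * (t * (x ^^ i) ((x ^^ j) p))" by (simp only: s(2) x(11)[OF s(1)] mult.left_commute)
    also have "(x ^^ i) ((x ^^ j) p) = (x ^^ j) ((x ^^ i) p)" by (metis add.commute comp_apply funpow_add)
    finally show ?thesis unfolding t(2) by (simp only: x(11)[OF t(1)])
  qed
  define e where "e = (if s = 1 then id else perm_restrict uminus ?Q)"
  let ?c = "perm_restrict x ?Q"
  have c: "?c \<in> Z" and e: "e \<in> Z" using restrict_x_in_Z[OF p] restrict_minus_in_Z[OF p] id_in_Z by (auto simp: e_def)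
  have "(?c ^^ j) q = perm_restrict (x ^^ j) ?Q q" for q
  proof (cases "q \<in> ?Q")
    case True
    have "x ` ?Q \<subseteq> ?Q" using scyc_x scyc_trans by blast
    then show ?thesis using cyc_cong(1)[of ?Q ?c x q j] True by (auto simp: perm_restrict_def)
  next
    case False
    then show ?thesis by (induction j) (auto simp: perm_restrict_def)
  qed
  moreover have "(x ^^ j) q \<in> ?Q" if "q \<in> ?Q" for q
    using scycI[of 1 j x q] scyc_eq[OF that] by simp
  ultimately have split: "perm_restrict b ?Q = e \<circ> ?c ^^ j"
    using s(1) bq by (auto simp: fun_eq_iff perm_restrict_def e_def)
  have "\<omega> (?c ^^ j) = omega_char P x (?c ^^ j)"
  proof (induction j)
    case (Suc j)
    then show ?case
      by (simp only: funpow.simps(2) mult[OF c funpow_in_Z[OF c]] omega_char_Z_comp[OF c funpow_in_Z[OF c]]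
          cycle[OF p] omega_char_restrict_x[OF p])
  qed (simp_all add: character_id omega_char_id flip: id_def)
  moreover have "\<omega> e = omega_char P x e"
    using s(1) pos minus[OF p] omega_char_restrict_minus[OF p] by (auto simp: e_def character_id omega_char_id csign_def)
  ultimately show ?thesis
    unfolding split using c e by (simp add: mult omega_char_Z_comp funpow_in_Z)
qed

text \<open>An element preserving every signed cycle is the product of its restrictions to them,
  each of which lies in the centralizer.\<close>

lemma character_base:
  assumes b: "b \<in> Z" and fix_cyc: "\<And>p. p \<in> P \<Longrightarrow> b p \<in> scyc x p"
  shows "\<omega> b = omega_char P x b"
proof -
  interpret b: commuting P x \<zeta> \<eta> b using b by (rule Z_commuting)
  have bQ: "b ` scyc x p = scyc x p" if "p \<in> P" for p
    using b.image(1)[of p] scyc_eq[OF fix_cyc[OF that]] by simp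
  have "perm_restrict b (\<Union>\<A>) \<in> Z \<and> \<omega> (perm_restrict b (\<Union>\<A>)) = omega_char P x (perm_restrict b (\<Union>\<A>))"
    if "finite \<A>" "\<A> \<subseteq> scyc x ` P" for \<A>
    using that
  proof (induction rule: finite_induct)
    case empty
    have "perm_restrict b {} = id" by (simp add: fun_eq_iff perm_restrict_def)
    then show ?case by (simp only: Union_empty character_id omega_char_id id_in_Z simp_thms)
  next
    case (insert Q \<A>)
    then obtain p where p: "p \<in> P" "Q = scyc x p" by auto
    have A: "\<Union>\<A> \<subseteq> P" "b ` \<Union>\<A> = \<Union>\<A>" "\<Union>\<A> \<inter> Q = {}"
    proof -
      show "\<Union>\<A> \<subseteq> P" using insert.prems scyc_subset by blast
      have "b ` A = A" if "A \<in> \<A>" for A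
      proof -
        obtain p where "p \<in> P" "A = scyc x p" using \<open>A \<in> \<A>\<close> insert.prems by auto
        then show ?thesis using bQ by simp
      qed
      then show "b ` \<Union>\<A> = \<Union>\<A>" by (simp only: image_Union image_cong[OF refl, of \<A> "(`) b" "\<lambda>A. A"] image_ident)
      show "\<Union>\<A> \<inter> Q = {}"
      proof (rule ccontr)
        assume "\<Union>\<A> \<inter> Q \<noteq> {}"
        then obtain q A where A: "A \<in> \<A>" "q \<in> A" "q \<in> Q" by auto
        obtain p' where "A = scyc x p'" using A(1) insert.prems by auto
        then have "A = Q" using A(2,3) p(2) scyc_eq by metis
        then show False using A(1) insert.hyps by simp
      qed
    qed
    have bQ': "b q \<in> Q" if "q \<in> Q" for q using bQ[OF p(1)] that p(2) by auto
    have split: "perm_restrict b (\<Union>(insert Q \<A>)) = perm_restrict b Q \<circ> perm_restrict b (\<Union>\<A>)"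
    proof
      fix q
      show "perm_restrict b (\<Union>(insert Q \<A>)) q = (perm_restrict b Q \<circ> perm_restrict b (\<Union>\<A>)) q"
        using A(2,3) by (cases "q \<in> \<Union>\<A>") (auto simp: perm_restrict_def disjoint_iff)
    qed
    have 1: "perm_restrict b Q \<in> Z" "\<omega> (perm_restrict b Q) = omega_char P x (perm_restrict b Q)"
      using restrict_scyc_in_Z[OF b.w b.comm p(1) fix_cyc[OF p(1)]] character_restrict_scyc[OF b p(1) fix_cyc[OF p(1)]] p(2) by simp_all
    have 2: "perm_restrict b (\<Union>\<A>) \<in> Z" "\<omega> (perm_restrict b (\<Union>\<A>)) = omega_char P x (perm_restrict b (\<Union>\<A>))"
      using insert by auto
    show ?case unfolding split by (intro conjI Z_comp 1 2) (simp only: mult[OF 1(1) 2(1)] omega_char_Z_comp[OF 1(1) 2(1)] 1(2) 2(2))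
  qed
  from this[of "scyc x ` P"] P(1) have "\<omega> (perm_restrict b (\<Union>(scyc x ` P))) = omega_char P x (perm_restrict b (\<Union>(scyc x ` P)))"
    by simp
  moreover have "\<Union>(scyc x ` P) = P" using scyc_subset scyc_self by blast
  moreover have "perm_restrict b P = b" using b by (auto simp: Z_def signed_perms_def)
  ultimately show ?thesis by simp
qed

text \<open>The wreath product decomposition: \<open>w = b \<circ> s\<close>, where \<open>b\<close>
  preserves every signed cycle and \<open>s\<close> permutes the reference points
  \<open>R\<close>.\<close>

lemma character_unique:
  assumes w: "w \<in> Z"
  shows "\<omega> w = omega_char P x w"
proof -
  interpret w: commuting P x \<zeta> \<eta> w using w by (rule Z_commuting)
  have iw: "finv w \<in> Z" by (rule Z_inv[OF w])
  interpret iw: commuting P x \<zeta> \<eta> "finv w" using iw by (rule Z_commuting)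
  have RP: "R \<subseteq> P" "finite R" using R P(1) by (auto simp: transversal_def intro: finite_subset)
  have ex1: "\<exists>!r. r \<in> R \<and> scyc x r = scyc x p" if "p \<in> P" for p
  proof -
    have "scyc x p \<in> scyc x ` R" using R that by (auto simp: transversal_def)
    then obtain r where r: "r \<in> R" "scyc x r = scyc x p" by auto
    have "inj_on (scyc x) R" using R by (simp add: transversal_def)
    then show ?thesis using r by (intro ex1I[of _ r]) (simp_all add: inj_on_def)
  qed
  define ref where "ref p = (THE r. r \<in> R \<and> scyc x r = scyc x p)" for p
  have ref: "ref p \<in> R" "scyc x (ref p) = scyc x p" if "p \<in> P" for p
    using theI'[OF ex1[OF that]] by (simp_all add: ref_def)
  have ref_eq: "ref p = r" if "p \<in> P" "r \<in> R" "scyc x r = scyc x p" for p r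
    using ex1[OF that(1)] ref[OF that(1)] that(2,3) by blast
  have ref_scyc: "ref q = ref p" if "scyc x q = scyc x p" for p q
    using that by (simp add: ref_def)
  \<comment> \<open>The image under \<open>w\<close> of the reference point whose signed cycle is
    mapped onto that of \<open>p\<close>. The base element \<open>b\<close> is built to send each
    reference point \<open>r\<close> to \<open>u r\<close>; then the inverse of \<open>b\<close>
    followed after \<open>w\<close> preserves \<open>R\<close>.\<close>
  define u where "u p = w (ref (finv w p))" for p
  have u: "u p \<in> scyc x p" if "p \<in> P" for p
  proof -
    have "scyc x (ref (finv w p)) = scyc x (finv w p)" using ref(2)[OF iw.w_in[OF that]] .
    then have "scyc x (u p) = scyc x (w (finv w p))" unfolding u_def by (simp flip: w.image(1))
    then show ?thesis using scyc_self signed_bijD(4)[OF w.w] by metis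
  qed
  have u_scyc: "u q = u p" if "scyc x q = scyc x p" for p q
    using ref_scyc[of "finv w q" "finv w p"] that by (simp add: u_def flip: iw.image(1))
  \<comment> \<open>The chosen coordinates depend only on the signed cycle of \<open>p\<close>, so
    one pair serves all of it; this makes \<open>b\<close> commute with \<open>x\<close>.\<close>
  define co where "co p = (SOME c. fst c \<in> signs \<and> u p = fst c * (x ^^ snd c) (ref p))" for p
  have co: "fst (co p) \<in> signs \<and> u p = fst (co p) * (x ^^ snd (co p)) (ref p)" if p: "p \<in> P" for p
    unfolding co_def
  proof (rule someI_ex)
    have "u p \<in> scyc x (ref p)" using u[OF p] ref(2)[OF p] by simp
    then obtain s j where "s \<in> signs" "u p = s * (x ^^ j) (ref p)" by (rule scycE)
    then show "\<exists>c. fst c \<in> signs \<and> u p = fst c * (x ^^ snd c) (ref p)"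
      by (intro exI[of _ "(s, j)"]) simp
  qed
  have co_scyc: "co q = co p" if "scyc x q = scyc x p" for p q
    using u_scyc[OF that] ref_scyc[OF that] by (simp add: co_def)
  define b where "b p = (if p \<in> P then fst (co p) * (x ^^ snd (co p)) p else p)" for p
  have b_scyc: "b p \<in> scyc x p" for p
    using co[of p] scycI[of "fst (co p)" "snd (co p)" x p] scyc_self[of p x] by (simp add: b_def)
  have b_in: "b p \<in> P \<longleftrightarrow> p \<in> P" for p
    using b_scyc[of p] scyc_subset[of p] by (auto simp: b_def)
  have bR: "b r = u r" if "r \<in> R" for r
  proof -
    have "ref r = r" using RP that by (intro ref_eq) auto
    moreover have "r \<in> P" using RP that by auto
    ultimately show ?thesis using co[of r] by (simp add: b_def)
  qed
  have inj_b: "inj b"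
  proof (rule injI)
    fix p q assume eq: "b p = b q"
    then have pq: "p \<in> P \<longleftrightarrow> q \<in> P" using b_in by metis
    have "scyc x p = scyc x q" using eq b_scyc scyc_eq by metis
    then have "co p = co q" by (rule co_scyc)
    show "p = q"
    proof (cases "p \<in> P")
      case True
      then have "fst (co p) * (x ^^ snd (co p)) p = fst (co p) * (x ^^ snd (co p)) q"
        using eq pq \<open>co p = co q\<close> by (simp add: b_def)
      moreover have "fst (co p) \<noteq> 0" using co[OF True] by auto
      ultimately show ?thesis by (simp add: signed_bijD(3)[OF signed_bij_funpow[OF x(2)]])
    next
      case False
      then show ?thesis using eq pq by (simp add: b_def)
    qed
  qed
  have "b \<in> signed_perms P"
  proof (rule signed_permsI)
    have "b ` P = P" using b_in by (intro endo_inj_surj P(1) inj_on_subset[OF inj_b]) auto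
    have "\<exists>q. p = b q" for p
    proof (cases "p \<in> P")
      case True
      then show ?thesis using \<open>b ` P = P\<close> by (metis imageE)
    qed (auto simp: b_def)
    then have "bij b" using inj_b by (simp add: bij_def surj_def)
    moreover have "b (- p) = - b p" for p
      using co_scyc[OF scyc_eq[OF scyc_minus], of p] P(3)[of p] x(10) by (simp add: b_def)
    ultimately show "signed_bij b" by (simp add: signed_bij_def)
  qed (simp add: b_def)
  moreover have "b (x p) = x (b p)" for p
  proof (cases "p \<in> P")
    case True
    then have "x p \<in> P" using x(3) by auto
    then have "b (x p) = fst (co p) * (x ^^ snd (co p)) (x p)"
      using co_scyc[OF scyc_eq[OF scyc_x], of p] by (simp add: b_def)
    also have "\<dots> = x (fst (co p) * (x ^^ snd (co p)) p)"
      using co[OF True] by (simp only: x(6) funpow_swap1)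
    finally show ?thesis using True by (simp add: b_def)
  next
    case False
    then show ?thesis by (simp add: b_def x(4))
  qed
  ultimately have bZ: "b \<in> Z" by (simp add: Z_def)
  interpret b: commuting P x \<zeta> \<eta> b using bZ by (rule Z_commuting)
  define s where "s = finv b \<circ> w"
  have sZ: "s \<in> Z" unfolding s_def by (intro Z_comp Z_inv bZ w)
  have "s ` R \<subseteq> R"
  proof
    fix q assume "q \<in> s ` R"
    then obtain r where r: "r \<in> R" "q = finv b (w r)" by (auto simp: s_def)
    define r' where "r' = ref (w r)"
    have wr: "w r \<in> P" using r RP w.w_in by auto
    have r': "r' \<in> R" "scyc x r' = scyc x (w r)" using ref[OF wr] by (simp_all add: r'_def)
    have "scyc x (finv w r') = scyc x (finv w (w r))" using r'(2) by (simp flip: iw.image(1))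
    then have "ref (finv w r') = r"
      using r(1) r'(1) RP iw.w_in signed_bijD(5)[OF w.w] by (intro ref_eq) auto
    then have "b r' = w r" using bR[OF r'(1)] by (simp add: u_def)
    then have "q = r'" using r(2) signed_bijD(5)[OF b.w] by metis
    then show "q \<in> R" using r'(1) by simp
  qed
  moreover have "inj_on s R"
    using Z_commuting[OF sZ] by (auto simp: commuting_def commuting_axioms_def signed_bij_def bij_def intro: inj_on_subset)
  ultimately have sR: "s ` R = R" using RP(2) by (intro endo_inj_surj)
  have "w = b \<circ> s" by (simp add: s_def fun_eq_iff signed_bijD(4)[OF b.w])
  then show ?thesis
    using mult[OF bZ sZ] omega_char_Z_comp[OF bZ sZ] character_base[OF bZ b_scyc] complement[OF sZ sR] omega_char_stabilizer[OF R sZ sR] by simp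
qed

end

end

section \<open>Identification of the explicit character with the one in the statement\<close>

lemma signed_set_signed_points: "signed_set (signed_points n)"
  unfolding signed_set_def signed_points_def
  by (simp add: image_set_diff)

lemma carrier_B_group: "carrier (B_group n) = signed_perms (signed_points n)"
proof -
  have "w (- i) = - w i" if "w permutes signed_points n" "\<forall>i \<in> signed_points n. w (- i) = - w i" for w i
  proof (cases "i \<in> signed_points n")
    case False
    then have "- i \<notin> signed_points n" using signed_setD(3)[OF signed_set_signed_points] by simp
    then show ?thesis using False that(1) by (simp add: permutes_not_in)
  qed (use that in simp)
  then show ?thesis by (auto simp: B_group_def signed_perms_def)
qed

lemma mult_B_group [simp]: "u \<otimes>\<^bsub>B_group n\<^esub> v = u \<circ> v"
  by (simp add: B_group_def)

locale signed_points_perm = signed_perm_roots "signed_points n" x \<zeta> \<eta> for n x \<zeta> \<eta>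
begin

abbreviation "SP \<equiv> signed_points n"

lemma centralizer_B_group: "centralizer (B_group n) x = Z"
  by (auto simp: centralizer_def carrier_B_group Z_def fun_eq_iff)

lemma orbit_eq_cyc: "orbit x p = cyc x p"
  by (simp add: orbit_altdef_permutation[OF permutation] cyc_def full_SetCompr_eq)

lemma uminus_cyc_iff: "uminus ` cyc x p = cyc x p \<longleftrightarrow> neg_cyc x p"
proof
  have "p \<in> cyc x p" unfolding cyc_def by (rule range_eqI[of _ _ 0]) simp
  moreover assume "uminus ` cyc x p = cyc x p"
  ultimately show "neg_cyc x p" unfolding neg_cyc_def by blast
next
  assume "neg_cyc x p"
  then have "uminus ` cyc x p \<subseteq> cyc x p" using scyc_neg[of p] scyc_eq_cyc[of x p] by blast
  moreover from this have "uminus ` uminus ` cyc x p \<subseteq> uminus ` cyc x p" by (rule image_mono)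
  ultimately show "uminus ` cyc x p = cyc x p" by (simp add: image_image)
qed

lemma reference_points_iff: "reference_points n x R \<longleftrightarrow> transversal SP x R"
proof -
  have "reference_points n x R \<longleftrightarrow> R \<subseteq> SP \<and> (\<forall>p\<in>SP. \<exists>!r. r \<in> R \<and> r \<in> scyc x p)"
    by (simp add: reference_points_def cycles_of_def orbit_eq_cyc scyc_eq_cyc)
  also have "\<dots> \<longleftrightarrow> transversal SP x R"
  proof (intro iffI conjI ballI)
    assume *: "R \<subseteq> SP \<and> (\<forall>p\<in>SP. \<exists>!r. r \<in> R \<and> r \<in> scyc x p)"
    have "inj_on (scyc x) R"
    proof (rule inj_onI)
      fix r r' assume "r \<in> R" "r' \<in> R" "scyc x r = scyc x r'"
      then have "r \<in> SP" "r \<in> scyc x r" "r' \<in> scyc x r" using * scyc_self by auto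
      then show "r = r'" using * \<open>r \<in> R\<close> \<open>r' \<in> R\<close> by blast
    qed
    moreover have "scyc x ` SP \<subseteq> scyc x ` R"
    proof
      fix Q assume "Q \<in> scyc x ` SP"
      then obtain p where p: "p \<in> SP" "Q = scyc x p" by auto
      then obtain r where "r \<in> R" "r \<in> scyc x p" using * by blast
      then show "Q \<in> scyc x ` R" using scyc_eq[of r p] p(2) by auto
    qed
    ultimately show "transversal SP x R" using * by (auto simp: transversal_def)
  next
    assume R: "transversal SP x R"
    then show "R \<subseteq> SP" by (simp add: transversal_def)
    fix p assume "p \<in> SP"
    then have "scyc x p \<in> scyc x ` R" using R by (simp add: transversal_def)
    then obtain r where r: "r \<in> R" "scyc x r = scyc x p" by auto
    show "\<exists>!r. r \<in> R \<and> r \<in> scyc x p"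
    proof (rule ex1I[of _ r])
      show "r \<in> R \<and> r \<in> scyc x p" using r scyc_self[of r x] by simp
      fix r' assume "r' \<in> R \<and> r' \<in> scyc x p"
      then have "r' \<in> R" "scyc x r' = scyc x r" using scyc_eq[of r' p] r(2) by auto
      then show "r' = r" using R r(1) by (auto simp: transversal_def dest: inj_onD)
    qed
  qed
  finally show ?thesis .
qed

text \<open>Conditions on cycles become conditions on points, and the values at a single signed
  cycle of either class are merged into \<open>croot\<close>, in the form that the uniqueness
  argument expects.\<close>

lemma is_omega_iff:
  "is_omega n \<zeta> \<eta> x \<omega> \<longleftrightarrow>
     \<omega> \<in> hom ((B_group n)\<lparr>carrier := Z\<rparr>) complex_mult_group \<and>
     (\<forall>p\<in>SP. \<not> neg_cyc x p \<longrightarrow> \<omega> (perm_restrict uminus (scyc x p)) = 1) \<and>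
     (\<forall>p\<in>SP. \<omega> (perm_restrict x (scyc x p)) = croot x p) \<and>
     (\<exists>R. transversal SP x R \<and> (\<forall>s\<in>Z. s ` R = R \<longrightarrow> \<omega> s = 1))"
proof -
  have 1: "(\<forall>c \<in> cycles_of n x. uminus ` c \<noteq> c \<longrightarrow>
        \<omega> (perm_restrict uminus (c \<union> uminus ` c)) = 1 \<and>
        \<omega> (perm_restrict x (c \<union> uminus ` c)) = \<zeta> (card c)) \<longleftrightarrow>
     (\<forall>p\<in>SP. \<not> neg_cyc x p \<longrightarrow> \<omega> (perm_restrict uminus (scyc x p)) = 1 \<and> \<omega> (perm_restrict x (scyc x p)) = croot x p)"
    by (simp add: cycles_of_def orbit_eq_cyc uminus_cyc_iff croot_def card_cyc_pos_type(1) flip: scyc_eq_cyc)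
  have 2: "(\<forall>c \<in> cycles_of n x. uminus ` c = c \<longrightarrow> \<omega> (perm_restrict x c) = \<eta> (card c div 2)) \<longleftrightarrow>
     (\<forall>p\<in>SP. neg_cyc x p \<longrightarrow> \<omega> (perm_restrict x (scyc x p)) = croot x p)"
    by (simp add: cycles_of_def orbit_eq_cyc uminus_cyc_iff croot_def card_cyc_neg scyc_neg)
  have 3: "((\<forall>p\<in>SP. \<not> neg_cyc x p \<longrightarrow> A p \<and> B p) \<and> (\<forall>p\<in>SP. neg_cyc x p \<longrightarrow> B p) \<and> E) =
    ((\<forall>p\<in>SP. \<not> neg_cyc x p \<longrightarrow> A p) \<and> (\<forall>p\<in>SP. B p) \<and> E)" for A B and E :: bool
    by blast
  show ?thesis
    unfolding is_omega_def linear_character_def centralizer_B_group reference_points_iff 1 2 3 ..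
qed

lemma is_omega_omega_char: "is_omega n \<zeta> \<eta> x (omega_char SP x)"
  unfolding is_omega_iff
proof (intro conjI exI[of _ "rep x ` SP"] ballI impI transversal_rep)
  show "omega_char SP x \<in> hom ((B_group n)\<lparr>carrier := Z\<rparr>) complex_mult_group"
  proof (rule homI)
    show "omega_char SP x u \<in> carrier complex_mult_group" if "u \<in> carrier ((B_group n)\<lparr>carrier := Z\<rparr>)" for u
      using commuting.omega_char_nonzero[OF Z_commuting] that by (simp add: complex_mult_group_def)
  qed (simp add: omega_char_Z_comp complex_mult_group_def)
qed (simp_all add: omega_char_restrict_minus omega_char_restrict_x csign_def omega_char_stabilizer[OF transversal_rep])

lemma omega_eq:
  assumes "w \<in> Z"
  shows "omega n \<zeta> \<eta> x w = omega_char SP x w"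
proof -
  have "is_omega n \<zeta> \<eta> x (omega n \<zeta> \<eta> x)"
    unfolding omega_def by (rule someI[of "is_omega n \<zeta> \<eta> x", OF is_omega_omega_char])
  then obtain R where o: "omega n \<zeta> \<eta> x \<in> hom ((B_group n)\<lparr>carrier := Z\<rparr>) complex_mult_group"
     "\<And>p. p\<in>SP \<Longrightarrow> \<not> neg_cyc x p \<Longrightarrow> omega n \<zeta> \<eta> x (perm_restrict uminus (scyc x p)) = 1"
     "\<And>p. p\<in>SP \<Longrightarrow> omega n \<zeta> \<eta> x (perm_restrict x (scyc x p)) = croot x p"
     "transversal SP x R" "\<And>s. s\<in>Z \<Longrightarrow> s ` R = R \<Longrightarrow> omega n \<zeta> \<eta> x s = 1"
    unfolding is_omega_iff by blast
  show ?thesis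
  proof (rule character_unique[OF _ o(2-5) assms])
    fix u v assume "u \<in> Z" "v \<in> Z"
    then show "omega n \<zeta> \<eta> x (u \<circ> v) = omega n \<zeta> \<eta> x u * omega n \<zeta> \<eta> x v"
      using hom_mult[OF o(1), of u v] by (simp add: complex_mult_group_def)
  qed
qed

end

section \<open>The groups \<open>B\<^sub>n\<close> and \<open>D\<^sub>n\<close>\<close>

text \<open>On \<open>B\<^sub>n\<close>, the linear character with kernel \<open>D\<^sub>n\<close>.\<close>

definition parity :: "int set \<Rightarrow> (int \<Rightarrow> int) \<Rightarrow> int" where
  "parity P w = (\<Prod>i\<in>{i\<in>P. i > 0}. sgn (w i))"

lemma parity_id: "parity P id = 1"
  by (simp add: parity_def)

lemma parity_cong: "(\<And>p. p \<in> P \<Longrightarrow> v p = w p) \<Longrightarrow> parity P v = parity P w"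
  unfolding parity_def by (intro prod.cong) auto

lemma parity_union: "finite A \<Longrightarrow> finite B \<Longrightarrow> A \<inter> B = {} \<Longrightarrow> parity (A \<union> B) w = parity A w * parity B w"
proof -
  assume *: "finite A" "finite B" "A \<inter> B = {}"
  have "{i \<in> A \<union> B. i > 0} = {i \<in> A. i > 0} \<union> {i \<in> B. i > 0}" by auto
  then show ?thesis unfolding parity_def using * by (simp add: prod.union_disjoint disjoint_iff)
qed

lemma signed_image_abs_bij:
  assumes P: "signed_set P" "signed_set P'" and v: "signed_bij v" "v ` P = P'"
  shows "bij_betw (\<lambda>i. \<bar>v i\<bar>) {i\<in>P. i > 0} {i\<in>P'. i > 0}"
  unfolding bij_betw_def
proof
  show "inj_on (\<lambda>i. \<bar>v i\<bar>) {i\<in>P. i > 0}"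
  proof (rule inj_onI)
    fix i j assume ij: "i \<in> {i\<in>P. i > 0}" "j \<in> {i\<in>P. i > 0}" "\<bar>v i\<bar> = \<bar>v j\<bar>"
    then have "v i = v j \<or> v i = v (- j)" by (simp add: signed_bijD(1)[OF v(1)] abs_eq_iff)
    then have "i = j \<or> i = - j" by (simp only: signed_bijD(3)[OF v(1)])
    then show "i = j" using ij by auto
  qed
  show "(\<lambda>i. \<bar>v i\<bar>) ` {i\<in>P. i > 0} = {i\<in>P'. i > 0}"
  proof (intro Set.set_eqI iffI)
    fix j assume "j \<in> (\<lambda>i. \<bar>v i\<bar>) ` {i\<in>P. i > 0}"
    then obtain i where i: "i \<in> P" "j = \<bar>v i\<bar>" by auto
    then have "v i \<in> P'" using v(2) by auto
    moreover from this have "v i \<noteq> 0" using signed_setD(2)[OF P(2)] by metis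
    ultimately show "j \<in> {i\<in>P'. i > 0}"
      unfolding i(2) by (simp add: abs_if signed_setD(3)[OF P(2)])
  next
    fix j assume j: "j \<in> {i\<in>P'. i > 0}"
    then obtain i where i: "i \<in> P" "j = v i" using v(2) by auto
    then have "v \<bar>i\<bar> = j \<or> v \<bar>i\<bar> = - j" by (auto simp: abs_if signed_bijD(1)[OF v(1)])
    moreover have "i \<noteq> 0" using i(1) signed_setD(2)[OF P(1)] by metis
    then have "\<bar>i\<bar> \<in> P" "\<bar>i\<bar> > 0" using i(1) by (simp_all add: abs_if signed_setD(3)[OF P(1)])
    ultimately show "j \<in> (\<lambda>i. \<bar>v i\<bar>) ` {i\<in>P. i > 0}" using j by (intro image_eqI[of _ _ "\<bar>i\<bar>"]) auto
  qed
qed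

lemma signed_sgn_abs:
  assumes "signed_bij w" shows "sgn (w \<bar>i\<bar>) * sgn i = sgn (w i)"
proof -
  have "w 0 = 0" using signed_bijD(1)[OF assms, of 0] by simp
  then show ?thesis by (cases i "0 :: int" rule: linorder_cases) (simp_all add: signed_bijD(1)[OF assms] sgn_minus)
qed

text \<open>The positive points of \<open>P'\<close> are reindexed by the absolute values of the
  \<open>v i\<close>. Allowing \<open>P'\<close> to differ from \<open>P\<close> makes it possible
  to compare the parities of one map on different signed cycles.\<close>

lemma parity_comp_aux:
  assumes P: "signed_set P" "signed_set P'" and v: "signed_bij v" "v ` P = P'" and w: "signed_bij w"
  shows "parity P (w \<circ> v) = parity P' w * parity P v"
proof -
  have "parity P' w = (\<Prod>i\<in>{i\<in>P. i > 0}. sgn (w \<bar>v i\<bar>))"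
    unfolding parity_def by (rule prod.reindex_bij_betw[symmetric, OF signed_image_abs_bij[OF P v]])
  then show ?thesis
    by (simp add: parity_def signed_sgn_abs[OF w] flip: prod.distrib)
qed

lemma parity_comp:
  assumes "signed_set P" "signed_bij v" "v ` P = P" "signed_bij w"
  shows "parity P (w \<circ> v) = parity P w * parity P v"
  using parity_comp_aux[OF assms(1,1,2,3,4)] .

lemma parity_sign:
  assumes P: "signed_set P" and w: "w ` P \<subseteq> P"
  shows "parity P w = (-1) ^ card {i\<in>P. i > 0 \<and> w i < 0}" "parity P w * parity P w = 1"
proof -
  have "parity P w = (\<Prod>i\<in>{i\<in>P. i > 0}. if w i < 0 then -1 else 1)"
    unfolding parity_def using signed_setD(2)[OF P] w by (intro prod.cong) (auto simp: sgn_if)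
  also have "\<dots> = (-1) ^ card {i\<in>P. i > 0 \<and> w i < 0}"
    using signed_setD(1)[OF P] by (simp add: prod.If_cases Int_def conj_assoc)
  finally show "parity P w = (-1) ^ card {i\<in>P. i > 0 \<and> w i < 0}" .
  then show "parity P w * parity P w = 1" by (simp flip: power2_eq_square power_mult add: power_mult_distrib)
qed

lemma carrier_D_group: "carrier (D_group n) = {w \<in> signed_perms (signed_points n). parity (signed_points n) w = 1}"
proof -
  have e: "{i \<in> {1..int n}. w i < 0} = {i \<in> signed_points n. i > 0 \<and> w i < 0}" for w
    by (auto simp: signed_points_def)
  have "even (card {i \<in> {1..int n}. w i < 0}) \<longleftrightarrow> parity (signed_points n) w = 1" if "w \<in> signed_perms (signed_points n)" for w
    using parity_sign(1)[OF signed_set_signed_points, of w n] signed_permsD(3)[OF that]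
    unfolding e by (auto simp: uminus_power_if)
  then show ?thesis by (auto simp: D_group_def carrier_B_group)
qed

lemma mult_D_group [simp]: "u \<otimes>\<^bsub>D_group n\<^esub> v = u \<circ> v"
  by (simp add: D_group_def)

lemma one_D_group [simp]: "\<one>\<^bsub>D_group n\<^esub> = id"
  by (simp add: D_group_def B_group_def)

lemma group_D_group: "group (D_group n)"
proof (rule groupI)
  let ?P = "signed_points n"
  note c = carrier_D_group and S = signed_set_signed_points
  fix u v assume u: "u \<in> carrier (D_group n)" and v: "v \<in> carrier (D_group n)"
  show "u \<otimes>\<^bsub>D_group n\<^esub> v \<in> carrier (D_group n)"
    using u v parity_comp[OF S signed_permsD(2,3)[of v ?P] signed_permsD(2)[of u ?P]]
    by (simp add: c signed_perms_comp)
next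
  show "\<one>\<^bsub>D_group n\<^esub> \<in> carrier (D_group n)"
    by (simp only: one_D_group carrier_D_group mem_Collect_eq signed_perms_id parity_id simp_thms)
next
  let ?P = "signed_points n"
  note c = carrier_D_group and S = signed_set_signed_points
  fix u assume u: "u \<in> carrier (D_group n)"
  then have us: "u \<in> signed_perms ?P" by (simp add: c)
  have i: "finv u \<circ> u = id" by (simp add: fun_eq_iff signed_bijD(5)[OF signed_permsD(2)[OF us]])
  have "parity ?P (finv u \<circ> u) = parity ?P (finv u) * parity ?P u"
    by (rule parity_comp[OF S signed_permsD(2,3)[OF us] signed_permsD(2)[OF signed_perms_inv[OF us]]])
  then have "parity ?P (finv u) = 1" using u by (simp only: i parity_id) (simp add: c)
  then have "finv u \<in> carrier (D_group n)" using signed_perms_inv[OF us] by (simp add: c)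
  then show "\<exists>y\<in>carrier (D_group n). y \<otimes>\<^bsub>D_group n\<^esub> u = \<one>\<^bsub>D_group n\<^esub>"
    using i by (intro bexI[of _ "finv u"]) (simp_all only: mult_D_group one_D_group)
qed (simp_all add: comp_assoc fun_eq_iff)

lemma inv_D_group:
  assumes "t \<in> carrier (D_group n)"
  shows "inv\<^bsub>D_group n\<^esub> t = finv t"
proof -
  interpret group "D_group n" by (rule group_D_group)
  have "t \<in> signed_perms (signed_points n)" using assms by (simp add: carrier_D_group)
  then have b: "bij t" using signed_permsD(2) by (simp add: signed_bij_def)
  have "inv\<^bsub>D_group n\<^esub> t \<circ> t = id" using l_inv[OF assms] by (simp only: mult_D_group one_D_group)
  then have "(inv\<^bsub>D_group n\<^esub> t) p = finv t p" for p
    using bij_inv_eq_iff[OF b] b by (metis comp_apply id_apply bij_is_surj surj_f_inv_f)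
  then show ?thesis by blast
qed

lemma nat_pow_D_group: "h [^]\<^bsub>D_group n\<^esub> (m::nat) = h ^^ m"
proof -
  interpret group "D_group n" by (rule group_D_group)
  show ?thesis
  proof (induction m)
    case (Suc m)
    then show ?case by (simp only: nat_pow_Suc mult_D_group funpow_Suc_right)
  qed (simp only: nat_pow_0 one_D_group funpow.simps)
qed

lemma int_pow_D_group_eq_one:
  assumes "x \<in> carrier (D_group n)"
  shows "x [^]\<^bsub>D_group n\<^esub> (k::int) = \<one>\<^bsub>D_group n\<^esub> \<longleftrightarrow> x ^^ nat \<bar>k\<bar> = id"
proof -
  interpret group "D_group n" by (rule group_D_group)
  show ?thesis
    using assms nat_pow_closed[of x "nat (- k)"] inv_eq_1_iff[of "x [^]\<^bsub>D_group n\<^esub> nat (- k)"]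
    by (auto simp only: int_pow_def2 nat_pow_D_group one_D_group abs_if split: if_splits)
qed

text \<open>For negative \<open>k\<close>, inversion maps the solutions for \<open>k\<close>
  bijectively to those for the absolute value of \<open>k\<close>.\<close>

lemma roots_D_group:
  "roots (D_group n) k g = card {h \<in> carrier (D_group n). h ^^ nat \<bar>k\<bar> = g}"
proof (cases "k < 0")
  case True
  interpret group "D_group n" by (rule group_D_group)
  let ?G = "D_group n"
  have pow: "h [^]\<^bsub>?G\<^esub> k = (inv\<^bsub>?G\<^esub> h) ^^ nat \<bar>k\<bar>" if "h \<in> carrier ?G" for h
  proof -
    have "(inv\<^bsub>?G\<^esub> h) ^^ nat \<bar>k\<bar> = inv\<^bsub>?G\<^esub> (h [^]\<^bsub>?G\<^esub> nat (- k))"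
      using True nat_pow_inv[OF that, of "nat (- k)"] by (simp only: nat_pow_D_group abs_if if_True)
    then show ?thesis using True by (simp only: int_pow_def2 if_True)
  qed
  have "bij_betw (m_inv ?G) {h \<in> carrier ?G. h [^]\<^bsub>?G\<^esub> k = g} {h \<in> carrier ?G. h ^^ nat \<bar>k\<bar> = g}"
    by (rule bij_betwI[of _ _ _ "m_inv ?G"]) (auto simp: pow)
  then show ?thesis unfolding roots_def by (rule bij_betw_same_card)
next
  case False
  then show ?thesis by (simp add: roots_def int_pow_def2 nat_pow_D_group)
qed

section \<open>Sums over conjugates and over conjugacy classes\<close>

context group
begin

lemma conj_class_self: "x \<in> carrier G \<Longrightarrow> x \<in> conj_class G x"
  unfolding conj_class_def by (rule image_eqI[of _ _ "\<one>"]) simp_all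

lemma conj_class_closed: "x \<in> carrier G \<Longrightarrow> conj_class G x \<subseteq> carrier G"
  unfolding conj_class_def by auto

lemma conj_class_trans:
  assumes "x \<in> carrier G" "y \<in> conj_class G x" shows "conj_class G y \<subseteq> conj_class G x"
proof
  fix z assume "z \<in> conj_class G y"
  then obtain t u where t: "t \<in> carrier G" "z = t \<otimes> y \<otimes> inv t" and u: "u \<in> carrier G" "y = u \<otimes> x \<otimes> inv u"
    using assms(2) by (auto simp: conj_class_def)
  then have "z = (t \<otimes> u) \<otimes> x \<otimes> inv (t \<otimes> u)" using assms(1) by (simp add: inv_mult_group m_assoc)
  then show "z \<in> conj_class G x" using t u by (auto simp: conj_class_def)
qed

lemma conj_class_sym:
  assumes "x \<in> carrier G" "y \<in> conj_class G x" shows "x \<in> conj_class G y"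
proof -
  obtain u where u: "u \<in> carrier G" "y = u \<otimes> x \<otimes> inv u" using assms(2) by (auto simp: conj_class_def)
  then have "x = inv u \<otimes> y \<otimes> inv (inv u)"
    using assms(1) by (simp add: m_assoc) (simp flip: m_assoc)
  then show ?thesis unfolding conj_class_def by (rule image_eqI) (use u(1) in simp)
qed

lemma conj_class_eq:
  assumes "x \<in> carrier G" "y \<in> conj_class G x" shows "conj_class G y = conj_class G x"
  using assms conj_class_trans conj_class_sym conj_class_closed by (meson subset_antisym subsetD)

text \<open>The elements taking \<open>x\<close> to a given conjugate form a coset of the
  centralizer of \<open>x\<close>.\<close>

lemma sum_conjugates:
  fixes F :: "'a \<Rightarrow> complex"
  assumes fin: "finite (carrier G)" and x: "x \<in> carrier G"
  shows "(\<Sum>t\<in>carrier G. F (t \<otimes> x \<otimes> inv t)) = of_nat (card (centralizer G x)) * (\<Sum>y\<in>conj_class G x. F y)"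
proof -
  have card: "card {t \<in> carrier G. t \<otimes> x \<otimes> inv t = y} = card (centralizer G x)" if y: "y \<in> conj_class G x" for y
  proof -
    obtain u where u: "u \<in> carrier G" "y = u \<otimes> x \<otimes> inv u" using y by (auto simp: conj_class_def)
    have iff: "(u \<otimes> z) \<otimes> x \<otimes> inv (u \<otimes> z) = y \<longleftrightarrow> z \<otimes> x = x \<otimes> z" if z: "z \<in> carrier G" for z
    proof -
      have "(u \<otimes> z) \<otimes> x \<otimes> inv (u \<otimes> z) = u \<otimes> (z \<otimes> x \<otimes> inv z) \<otimes> inv u"
        using u(1) x z by (simp add: inv_mult_group m_assoc)
      moreover have "z \<otimes> x \<otimes> inv z = x \<longleftrightarrow> z \<otimes> x = x \<otimes> z"
        using inv_solve_right[OF x _ z, of "z \<otimes> x"] x z by auto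
      ultimately show ?thesis using u x z by simp
    qed
    have "bij_betw (\<lambda>z. u \<otimes> z) (centralizer G x) {t \<in> carrier G. t \<otimes> x \<otimes> inv t = y}"
    proof (rule bij_betwI[of _ _ _ "\<lambda>t. inv u \<otimes> t"])
      show "(\<lambda>z. u \<otimes> z) \<in> centralizer G x \<rightarrow> {t \<in> carrier G. t \<otimes> x \<otimes> inv t = y}"
        using u(1) iff by (auto simp: centralizer_def)
      show "(\<lambda>t. inv u \<otimes> t) \<in> {t \<in> carrier G. t \<otimes> x \<otimes> inv t = y} \<rightarrow> centralizer G x"
      proof
        fix t assume t: "t \<in> {t \<in> carrier G. t \<otimes> x \<otimes> inv t = y}"
        then have "u \<otimes> (inv u \<otimes> t) = t" using u(1) by (simp flip: m_assoc)
        then show "inv u \<otimes> t \<in> centralizer G x"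
          using iff[of "inv u \<otimes> t"] t u(1) by (simp add: centralizer_def)
      qed
    qed (use u(1) in \<open>auto simp: centralizer_def simp flip: m_assoc\<close>)
    then show ?thesis by (rule bij_betw_same_card[symmetric])
  qed
  have "(\<Sum>t\<in>carrier G. F (t \<otimes> x \<otimes> inv t)) =
    (\<Sum>y\<in>conj_class G x. of_nat (card {t \<in> carrier G. t \<otimes> x \<otimes> inv t = y}) * F y)"
    using fin by (intro sum_fun_comp) (auto simp: conj_class_def)
  also have "\<dots> = (\<Sum>y\<in>conj_class G x. of_nat (card (centralizer G x)) * F y)"
    by (intro sum.cong refl) (simp only: card)
  finally show ?thesis by (simp add: sum_distrib_left)
qed

lemma sum_conj_classes:
  fixes F :: "'a \<Rightarrow> complex"
  assumes fin: "finite (carrier G)"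
    and Q: "\<And>x y. x \<in> carrier G \<Longrightarrow> y \<in> conj_class G x \<Longrightarrow> Q x \<Longrightarrow> Q y"
  shows "(\<Sum>C\<in>{C \<in> conj_classes G. \<forall>y\<in>C. Q y}. \<Sum>y\<in>C. F y) = (\<Sum>y\<in>{y \<in> carrier G. Q y}. F y)"
proof -
  let ?C = "{C \<in> conj_classes G. \<forall>y\<in>C. Q y}"
  have U: "\<Union>?C = {y \<in> carrier G. Q y}"
  proof (intro Set.set_eqI iffI)
    fix y assume "y \<in> \<Union>?C"
    then show "y \<in> {y \<in> carrier G. Q y}" using conj_class_closed by (auto simp: conj_classes_def)
  next
    fix y assume "y \<in> {y \<in> carrier G. Q y}"
    then show "y \<in> \<Union>?C" using Q conj_class_self by (auto simp: conj_classes_def)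
  qed
  have "sum F (\<Union>?C) = (sum \<circ> sum) F ?C"
  proof (rule sum.Union_disjoint)
    show "\<forall>A\<in>?C. finite A"
      using fin conj_class_closed by (auto simp: conj_classes_def intro: finite_subset)
    show "\<forall>A\<in>?C. \<forall>B\<in>?C. A \<noteq> B \<longrightarrow> A \<inter> B = {}"
    proof (intro ballI impI, rule ccontr)
      fix A B assume AB: "A \<in> ?C" "B \<in> ?C" "A \<noteq> B" "A \<inter> B \<noteq> {}"
      obtain a b where "a \<in> carrier G" "A = conj_class G a" "b \<in> carrier G" "B = conj_class G b"
        using AB(1,2) by (auto simp: conj_classes_def)
      then show False using AB(3,4) conj_class_eq by blast
    qed
  qed
  then show ?thesis by (simp add: U)
qed

end

section \<open>The induced characters as sums over elements commuting with \<open>g\<close>\<close>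

context root_choice
begin

lemma commuting_centralizer:
  assumes "x \<in> signed_perms P" "w \<in> signed_perms P" "signed_set P" "w \<circ> x = x \<circ> w"
  shows "commuting P x \<zeta> \<eta> w"
proof -
  interpret signed_perm_roots P x \<zeta> \<eta> by unfold_locales (use assms in auto)
  show ?thesis by (rule commutingI) (use assms signed_permsD in \<open>auto simp: fun_eq_iff\<close>)
qed

lemma omega_char_conjugate_finv:
  assumes P: "signed_set P" and x: "x \<in> signed_perms P" and g: "g \<in> signed_perms P" and t: "t \<in> signed_perms P"
    and comm: "(t \<circ> x \<circ> finv t) \<circ> g = g \<circ> (t \<circ> x \<circ> finv t)"
  shows "finv t \<circ> g \<circ> t \<in> signed_perms P" "(finv t \<circ> g \<circ> t) \<circ> x = x \<circ> (finv t \<circ> g \<circ> t)"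
    "omega_char P (t \<circ> x \<circ> finv t) g = omega_char P x (finv t \<circ> g \<circ> t)"
proof -
  note b = signed_bijD[OF signed_permsD(2)[OF t]]
  show w: "finv t \<circ> g \<circ> t \<in> signed_perms P" by (intro signed_perms_comp signed_perms_inv t g)
  have c: "t (x (finv t (g p))) = g (t (x (finv t p)))" for p using comm by (simp add: fun_eq_iff)
  show wx: "(finv t \<circ> g \<circ> t) \<circ> x = x \<circ> (finv t \<circ> g \<circ> t)"
  proof
    fix p
    show "((finv t \<circ> g \<circ> t) \<circ> x) p = (x \<circ> (finv t \<circ> g \<circ> t)) p"
      using arg_cong[OF c[of "t p"], of "finv t"] by (simp add: b(5))
  qed
  have x': "t \<circ> x \<circ> finv t \<in> signed_perms P" by (intro signed_perms_comp signed_perms_inv t x)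
  show "omega_char P (t \<circ> x \<circ> finv t) g = omega_char P x (finv t \<circ> g \<circ> t)"
  proof (rule omega_char_conjugate[OF _ _ _ _ t])
    show "commuting P x \<zeta> \<eta> (finv t \<circ> g \<circ> t)" by (rule commuting_centralizer[OF x w P wx])
    show "commuting P (t \<circ> x \<circ> finv t) \<zeta> \<eta> g" by (rule commuting_centralizer[OF x' g P comm[symmetric]])
  qed (use P x x' in \<open>simp_all add: signed_perm_def b(4,5)\<close>)
qed

text \<open>A conjugate of \<open>g\<close> by the inverse of \<open>t\<close> lies in the
  centralizer of \<open>x\<close> iff \<open>g\<close> commutes with
  \<open>t \<circ> x \<circ> finv t\<close>, and by conjugation invariance the character values
  agree. As \<open>t\<close> varies, each \<open>y \<in> C\<close> occurs as often as the
  centralizer has elements, which cancels the denominator.\<close>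

lemma psi_D_eq:
  assumes g: "g \<in> carrier (D_group n)" and C: "C \<in> conj_classes (D_group n)"
  shows "psi_D n \<zeta> \<eta> C g = (\<Sum>y\<in>C. if y \<circ> g = g \<circ> y then omega_char (signed_points n) y g else 0)"
proof -
  interpret group "D_group n" by (rule group_D_group)
  let ?G = "D_group n" and ?P = "signed_points n"
  note S = signed_set_signed_points
  have fin: "finite (carrier ?G)"
    using finite_signed_perms[OF signed_setD(1)[OF S]] by (simp add: carrier_D_group)
  define x where "x = (SOME x. x \<in> C)"
  obtain x0 where x0: "x0 \<in> carrier ?G" "C = conj_class ?G x0" using C by (auto simp: conj_classes_def)
  then have "x0 \<in> C" using conj_class_self by simp
  then have "x \<in> C" unfolding x_def by (rule someI[of "\<lambda>x. x \<in> C"])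
  then have x: "x \<in> carrier ?G" "C = conj_class ?G x"
    using x0 conj_class_closed[OF x0(1)] conj_class_eq[OF x0(1)] by auto
  have SP: "t \<in> signed_perms ?P" if "t \<in> carrier ?G" for t using that by (simp add: carrier_D_group)
  interpret x: signed_points_perm n x \<zeta> \<eta>
    by unfold_locales (use S SP[OF x(1)] in auto)
  define F where "F y = (if y \<circ> g = g \<circ> y then omega_char ?P y g else 0)" for y
  let ?Z = "centralizer ?G x"
  have eq: "inv\<^bsub>?G\<^esub> t \<otimes>\<^bsub>?G\<^esub> g \<otimes>\<^bsub>?G\<^esub> t = finv t \<circ> g \<circ> t"
    "t \<otimes>\<^bsub>?G\<^esub> x \<otimes>\<^bsub>?G\<^esub> inv\<^bsub>?G\<^esub> t = t \<circ> x \<circ> finv t" if "t \<in> carrier ?G" for t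
    by (simp_all add: inv_D_group[OF that])
  have t: "finv t \<circ> g \<circ> t \<in> ?Z \<longleftrightarrow> (t \<circ> x \<circ> finv t) \<circ> g = g \<circ> (t \<circ> x \<circ> finv t)" (is "?L \<longleftrightarrow> ?R")
    if t: "t \<in> carrier ?G" for t
  proof
    note b = signed_bijD[OF signed_permsD(2)[OF SP[OF t]]]
    assume ?L
    then have c: "finv t (g (t (x p))) = x (finv t (g (t p)))" for p by (simp add: centralizer_def fun_eq_iff)
    show ?R
    proof
      fix p
      show "((t \<circ> x \<circ> finv t) \<circ> g) p = (g \<circ> (t \<circ> x \<circ> finv t)) p"
        using arg_cong[OF c[of "finv t p"], of t] by (simp add: b(4))
    qed
  next
    assume ?R
    have "finv t \<circ> g \<circ> t \<in> carrier ?G"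
      unfolding eq(1)[OF t, symmetric] by (intro m_closed inv_closed t g)
    then show ?L using omega_char_conjugate_finv(2)[OF S SP[OF x(1)] SP[OF g] SP[OF t] \<open>?R\<close>]
      by (simp add: centralizer_def)
  qed
  let ?c = "\<lambda>t. inv\<^bsub>?G\<^esub> t \<otimes>\<^bsub>?G\<^esub> g \<otimes>\<^bsub>?G\<^esub> t"
  let ?h = "\<lambda>t. if ?c t \<in> ?Z then omega n \<zeta> \<eta> x (?c t) else 0"
  have "(\<Sum>t \<in> {t \<in> carrier ?G. ?c t \<in> ?Z}. omega n \<zeta> \<eta> x (?c t))
    = (\<Sum>t \<in> carrier ?G. ?h t)"
    using fin by (rule sum.inter_filter)
  also have "\<dots> = (\<Sum>t \<in> carrier ?G. F (t \<otimes>\<^bsub>?G\<^esub> x \<otimes>\<^bsub>?G\<^esub> inv\<^bsub>?G\<^esub> t))"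
  proof (intro sum.cong refl)
    fix t assume tc: "t \<in> carrier ?G"
    show "?h t =
        F (t \<otimes>\<^bsub>?G\<^esub> x \<otimes>\<^bsub>?G\<^esub> inv\<^bsub>?G\<^esub> t)"
    proof (cases "(t \<circ> x \<circ> finv t) \<circ> g = g \<circ> (t \<circ> x \<circ> finv t)")
      case True
      note c = omega_char_conjugate_finv[OF S SP[OF x(1)] SP[OF g] SP[OF tc] True]
      have "finv t \<circ> g \<circ> t \<in> x.Z" unfolding x.Z_def using c(1,2) by (simp add: fun_eq_iff)
      then have "omega n \<zeta> \<eta> x (finv t \<circ> g \<circ> t) = omega_char ?P x (finv t \<circ> g \<circ> t)" by (rule x.omega_eq)
      then show ?thesis unfolding eq[OF tc] t[OF tc] F_def if_P[OF True] c(3) .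
    next
      case False
      then show ?thesis unfolding eq[OF tc] t[OF tc] F_def by (simp only: if_False)
    qed
  qed
  also have "\<dots> = of_nat (card ?Z) * (\<Sum>y\<in>C. F y)"
    unfolding x(2) by (rule sum_conjugates[OF fin x(1)])
  finally have "psi_D n \<zeta> \<eta> C g = of_nat (card ?Z) * (\<Sum>y\<in>C. F y) / of_nat (card ?Z)"
    unfolding psi_D_def Let_def x_def[symmetric] induced_character_def by (simp only:)
  moreover have "card ?Z \<noteq> 0"
    using fin x(1) by (subst card_0_eq) (auto simp: centralizer_def intro: finite_subset)
  ultimately show ?thesis by (simp add: F_def)
qed

lemma funpow_conjugate_eq_id:
  assumes "bij t" "x ^^ m = id" shows "(t \<circ> x \<circ> finv t) ^^ m = id"
proof -
  have "((t \<circ> x \<circ> finv t) ^^ m) (t p) = t ((x ^^ m) p)" for p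
    using assms(1) by (induction m) (simp_all add: bij_def)
  then have "((t \<circ> x \<circ> finv t) ^^ m) (t p) = t p" for p using assms(2) by simp
  then have "((t \<circ> x \<circ> finv t) ^^ m) p = p" for p using bij_is_surj[OF assms(1)] by (metis surj_f_inv_f)
  then show ?thesis by (simp add: fun_eq_iff)
qed

lemma sum_psi_D:
  assumes g: "g \<in> carrier (D_group n)"
  shows "(\<Sum>C \<in> {C \<in> conj_classes (D_group n). (\<lambda>x. x [^]\<^bsub>D_group n\<^esub> k) ` C = {\<one>\<^bsub>D_group n\<^esub>}}. psi_D n \<zeta> \<eta> C g)
    = (\<Sum>x \<in> {x \<in> carrier (D_group n). x ^^ nat \<bar>k\<bar> = id \<and> x \<circ> g = g \<circ> x}. omega_char (signed_points n) x g)"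
proof -
  interpret group "D_group n" by (rule group_D_group)
  let ?G = "D_group n" and ?P = "signed_points n"
  have fin: "finite (carrier ?G)"
    using finite_signed_perms[OF signed_setD(1)[OF signed_set_signed_points]] by (simp add: carrier_D_group)
  define F where "F y = (if y \<circ> g = g \<circ> y then omega_char ?P y g else 0)" for y
  have "(\<lambda>x. x [^]\<^bsub>?G\<^esub> k) ` C = {\<one>\<^bsub>?G\<^esub>} \<longleftrightarrow> (\<forall>y\<in>C. y ^^ nat \<bar>k\<bar> = id)" if "C \<in> conj_classes ?G" for C
  proof -
    have "C \<noteq> {}" "C \<subseteq> carrier ?G"
      using that conj_class_self conj_class_closed by (auto simp: conj_classes_def)
    have "f ` C = {a} \<longleftrightarrow> (\<forall>y\<in>C. f y = a)" for f :: "(int \<Rightarrow> int) \<Rightarrow> int \<Rightarrow> int" and a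
      using \<open>C \<noteq> {}\<close> by auto
    also have "(\<forall>y\<in>C. y [^]\<^bsub>?G\<^esub> k = \<one>\<^bsub>?G\<^esub>) \<longleftrightarrow> (\<forall>y\<in>C. y ^^ nat \<bar>k\<bar> = id)"
      using \<open>C \<subseteq> carrier ?G\<close> by (intro ball_cong refl int_pow_D_group_eq_one) auto
    finally show ?thesis .
  qed
  then have "{C \<in> conj_classes ?G. (\<lambda>x. x [^]\<^bsub>?G\<^esub> k) ` C = {\<one>\<^bsub>?G\<^esub>}} = {C \<in> conj_classes ?G. \<forall>y\<in>C. y ^^ nat \<bar>k\<bar> = id}"
    by blast
  moreover have "(\<Sum>C\<in>{C \<in> conj_classes ?G. \<forall>y\<in>C. y ^^ nat \<bar>k\<bar> = id}. psi_D n \<zeta> \<eta> C g) =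
     (\<Sum>C\<in>{C \<in> conj_classes ?G. \<forall>y\<in>C. y ^^ nat \<bar>k\<bar> = id}. \<Sum>y\<in>C. F y)"
    unfolding F_def by (intro sum.cong refl psi_D_eq[OF g]) simp
  moreover have "\<dots> = (\<Sum>y\<in>{y \<in> carrier ?G. y ^^ nat \<bar>k\<bar> = id}. F y)"
  proof (rule sum_conj_classes[OF fin])
    fix x y assume xy: "x \<in> carrier ?G" "y \<in> conj_class ?G x" and m: "x ^^ nat \<bar>k\<bar> = id"
    then obtain t where t: "t \<in> carrier ?G" "y = t \<circ> x \<circ> finv t"
      by (auto simp: conj_class_def inv_D_group)
    have "bij t" using t(1) by (auto simp: carrier_D_group signed_perms_def permutes_bij)
    then show "y ^^ nat \<bar>k\<bar> = id" unfolding t(2) using m by (rule funpow_conjugate_eq_id)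
  qed
  moreover have "\<dots> = (\<Sum>x \<in> {x \<in> carrier ?G. x ^^ nat \<bar>k\<bar> = id \<and> x \<circ> g = g \<circ> x}. omega_char ?P x g)"
    unfolding F_def using fin by (simp add: sum.inter_filter[symmetric] conj_assoc)
  ultimately show ?thesis by simp
qed

end

section \<open>Decomposition into blocks\<close>

lemma perm_restrict_funpow:
  assumes "x ` A \<subseteq> A"
  shows "(perm_restrict x A ^^ j) p = (if p \<in> A then (x ^^ j) p else p)"
proof (cases "p \<in> A")
  case True
  then show ?thesis using cyc_cong(1)[of A "perm_restrict x A" x p j] assms by (auto simp: perm_restrict_def)
next
  case False
  then show ?thesis by (induction j) (auto simp: perm_restrict_def)
qed

lemma signed_bij_image_eq:
  assumes "signed_bij w" "finite A" "w ` A \<subseteq> A" shows "w ` A = A"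
  using assms by (intro endo_inj_surj) (auto simp: signed_bij_def bij_def intro: inj_on_subset)

lemma signed_set_diff: "signed_set P \<Longrightarrow> signed_set A \<Longrightarrow> signed_set (P - A)"
  by (simp add: signed_set_def image_set_diff)

lemma signed_bij_image_diff: "signed_bij w \<Longrightarrow> w ` P = P \<Longrightarrow> w ` A = A \<Longrightarrow> w ` (P - A) = P - A"
  by (simp add: image_set_diff signed_bij_def bij_def)

text \<open>The map \<open>g\<close> may move points outside the set under consideration, so the
  same \<open>g\<close> serves for \<open>P\<close>, a block and its complement throughout the
  recursion.\<close>

locale signed_map =
  fixes g :: "int \<Rightarrow> int"
  assumes g: "signed_bij g"
begin

definition cent :: "int set \<Rightarrow> (int \<Rightarrow> int) set" where
  "cent P = {x \<in> signed_perms P. \<forall>p. x (g p) = g (x p)}"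

text \<open>For \<open>x\<close> commuting with \<open>g\<close>, both of finite order on an
  invariant finite set, these products already give the orbit of the group generated by
  \<open>x\<close>, \<open>g\<close> and negation.\<close>

definition joint_orbit :: "(int \<Rightarrow> int) \<Rightarrow> int \<Rightarrow> int set" where
  "joint_orbit x p = {s * (x ^^ j) ((g ^^ l) p) |s j l. s \<in> signs}"

definition inv_set :: "int set \<Rightarrow> bool" where
  "inv_set P \<longleftrightarrow> signed_set P \<and> g ` P = P"

definition trans_perms :: "int set \<Rightarrow> int \<Rightarrow> (int \<Rightarrow> int) set" where
  "trans_perms B p = {x \<in> cent B. joint_orbit x p = B}"

lemma inv_setD: "inv_set P \<Longrightarrow> signed_set P" "inv_set P \<Longrightarrow> g ` P = P"
  by (simp_all add: inv_set_def)

lemma centD: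
  assumes "x \<in> cent P"
  shows "x \<in> signed_perms P" "x (g p) = g (x p)"
  using assms by (auto simp: cent_def)

lemma finite_cent: "inv_set P \<Longrightarrow> finite (cent P)"
  using finite_signed_perms[of P] by (auto simp: cent_def inv_set_def signed_set_def)

lemma cent_empty: "cent {} = {id}"
  by (auto simp: cent_def signed_perms_def)

lemma blkI: "s \<in> signs \<Longrightarrow> s * (x ^^ j) ((g ^^ l) p) \<in> joint_orbit x p"
  by (auto simp: joint_orbit_def)

lemma blkE:
  assumes "q \<in> joint_orbit x p" obtains s j l where "s \<in> signs" "q = s * (x ^^ j) ((g ^^ l) p)"
  using assms by (auto simp: joint_orbit_def)

lemma joint_orbit_cong:
  assumes "\<And>q. q \<in> B \<Longrightarrow> x q = y q" "x ` B \<subseteq> B" "g ` B = B" "p \<in> B"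
  shows "joint_orbit x p = joint_orbit y p"
proof -
  have "(x ^^ j) ((g ^^ l) p) = (y ^^ j) ((g ^^ l) p)" for j l
    using cyc_cong(1)[of B x y "(g ^^ l) p" j] assms funpow_in_invariant[of g B p l] by auto
  then show ?thesis by (simp add: joint_orbit_def)
qed

lemma joint_orbit_props:
  assumes P: "inv_set P" and x: "x \<in> cent P" and p: "p \<in> P"
  shows "joint_orbit x p \<subseteq> P" "p \<in> joint_orbit x p" "inv_set (joint_orbit x p)" "x ` joint_orbit x p = joint_orbit x p"
proof -
  note xs = centD(1)[OF x] and xb = signed_permsD(2,3)[OF centD(1)[OF x]] and S = signed_setD[OF inv_setD(1)[OF P]]
  show sub: "joint_orbit x p \<subseteq> P"
  proof
    fix q assume "q \<in> joint_orbit x p"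
    then obtain s j l where q: "s \<in> signs" "q = s * (x ^^ j) ((g ^^ l) p)" by (rule blkE)
    have "(x ^^ j) ((g ^^ l) p) \<in> P"
      by (intro funpow_in_invariant[OF xb(2)] funpow_in_invariant[OF inv_setD(2)[OF P]] p)
    then show "q \<in> P" using S(4)[OF q(1)] q(2) by simp
  qed
  show "p \<in> joint_orbit x p" using blkI[of 1 0 x 0 p] by simp
  have fin: "finite (joint_orbit x p)" using sub S(1) finite_subset by blast
  have "x q \<in> joint_orbit x p \<and> g q \<in> joint_orbit x p \<and> - q \<in> joint_orbit x p" if "q \<in> joint_orbit x p" for q
  proof -
    obtain s j l where q: "s \<in> signs" "q = s * (x ^^ j) ((g ^^ l) p)" using \<open>q \<in> joint_orbit x p\<close> by (rule blkE)
    have "x q = s * (x ^^ Suc j) ((g ^^ l) p)" using q by (simp only: signed_bijD(2)[OF xb(1)] funpow.simps comp_apply)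
    moreover have "g q = s * (x ^^ j) ((g ^^ Suc l) p)"
      using q by (simp only: signed_bijD(2)[OF g] funpow.simps comp_apply funpow_commute_apply[of x g, OF centD(2)[OF x]])
    moreover have "- q = (- s) * (x ^^ j) ((g ^^ l) p)" using q by simp
    moreover have "- s \<in> signs" using q(1) by auto
    ultimately show ?thesis using blkI q(1) by metis
  qed
  then have c: "x ` joint_orbit x p \<subseteq> joint_orbit x p" "g ` joint_orbit x p \<subseteq> joint_orbit x p" "uminus ` joint_orbit x p \<subseteq> joint_orbit x p" by blast+
  show "x ` joint_orbit x p = joint_orbit x p" by (rule signed_bij_image_eq[OF xb(1) fin c(1)])
  have "signed_bij uminus" by (simp add: signed_bij_def bij_uminus)
  then have "uminus ` joint_orbit x p = joint_orbit x p" by (rule signed_bij_image_eq[OF _ fin c(3)])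
  then show "inv_set (joint_orbit x p)"
    using signed_bij_image_eq[OF g fin c(2)] fin sub S(2) by (auto simp: inv_set_def signed_set_def)
qed

lemma restrict_in_X:
  assumes A: "inv_set A" and x: "x \<in> cent P" and xA: "x ` A = A"
  shows "perm_restrict x A \<in> cent A"
proof -
  have "signed_bij x" using centD(1)[OF x] by (rule signed_permsD)
  then have "perm_restrict x A \<in> signed_perms A"
    using inv_setD(1)[OF A] xA by (rule perm_restrict_signed_perms)
  moreover have "g p \<in> A \<longleftrightarrow> p \<in> A" for p
    using inv_setD(2)[OF A] signed_bijD(3)[OF g] by (metis imageE imageI)
  ultimately show ?thesis using centD(2)[OF x] by (simp add: cent_def perm_restrict_def)
qed

lemma inv_set_diff: "inv_set P \<Longrightarrow> inv_set A \<Longrightarrow> inv_set (P - A)"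
  using signed_set_diff signed_bij_image_diff[OF g] by (simp add: inv_set_def)

definition multiplicative :: "(int set \<Rightarrow> (int \<Rightarrow> int) \<Rightarrow> complex) \<Rightarrow> bool" where
  "multiplicative W \<longleftrightarrow> (\<forall>P A x. inv_set P \<and> inv_set A \<and> A \<subseteq> P \<and> x \<in> cent P \<and> x ` A = A \<longrightarrow>
     W P x = W A (perm_restrict x A) * W (P - A) (perm_restrict x (P - A)))"

lemma comp_in_X:
  assumes "B \<subseteq> P" and u: "u \<in> cent B" and v: "v \<in> cent (P - B)"
  shows "u \<circ> v \<in> cent P" "\<And>p. p \<in> B \<Longrightarrow> (u \<circ> v) p = u p" "\<And>p. p \<notin> B \<Longrightarrow> (u \<circ> v) p = v p" "(u \<circ> v) ` B = B"
proof -
  have sub: "signed_perms A \<subseteq> signed_perms P" if "A \<subseteq> P" for A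
    using that by (auto simp: signed_perms_def intro: permutes_subset)
  have "u \<in> signed_perms P" "v \<in> signed_perms P" using sub[OF assms(1)] sub[of "P - B"] centD(1)[OF u] centD(1)[OF v] by auto
  then have "u \<circ> v \<in> signed_perms P" by (rule signed_perms_comp)
  then show "u \<circ> v \<in> cent P" using centD(2)[OF u] centD(2)[OF v] by (simp add: cent_def)
  show b: "(u \<circ> v) p = u p" if "p \<in> B" for p using signed_permsD(4)[OF centD(1)[OF v], of p] that by simp
  have "v p \<notin> B" if "p \<notin> B" for p
  proof (cases "p \<in> P")
    case True
    then have "v p \<in> P - B" using that signed_permsD(3)[OF centD(1)[OF v]] by blast
    then show ?thesis by simp
  next
    case False
    then show ?thesis using that signed_permsD(4)[OF centD(1)[OF v], of p] by simp
  qed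
  then show "(u \<circ> v) p = v p" if "p \<notin> B" for p using signed_permsD(4)[OF centD(1)[OF u], of "v p"] that by simp
  show "(u \<circ> v) ` B = B" using b signed_permsD(3)[OF centD(1)[OF u]] by (simp cong: image_cong_simp)
qed

text \<open>The \<open>x\<close> are sorted by the joint orbit \<open>B\<close> of \<open>p\<close>.
  Those with a given \<open>B\<close> correspond to pairs of a transitive element on
  \<open>B\<close> and an arbitrary element of \<open>cent (P - B)\<close>.\<close>

lemma block_recursion:
  assumes P: "inv_set P" and p: "p \<in> P" and W: "multiplicative W"
  shows "(\<Sum>x\<in>cent P. W P x) =
    (\<Sum>B\<in>{B. B \<subseteq> P \<and> p \<in> B \<and> inv_set B}. (\<Sum>u\<in>trans_perms B p. W B u) * (\<Sum>v\<in>cent (P - B). W (P - B) v))"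
proof -
  let ?B = "{B. B \<subseteq> P \<and> p \<in> B \<and> inv_set B}"
  have finP: "finite P" using P by (simp add: inv_set_def signed_set_def)
  have fin: "finite ?B" using finP by simp
  have "(\<Sum>x\<in>cent P. W P x) = (\<Sum>B\<in>?B. \<Sum>x\<in>{x \<in> cent P. joint_orbit x p = B}. W P x)"
    using fin finite_cent[OF P] joint_orbit_props[OF P _ p] by (intro sum.group[symmetric]) auto
  also have "\<dots> = (\<Sum>B\<in>?B. (\<Sum>u\<in>trans_perms B p. W B u) * (\<Sum>v\<in>cent (P - B). W (P - B) v))"
  proof (intro sum.cong refl)
    fix B assume "B \<in> ?B"
    then have B: "B \<subseteq> P" "p \<in> B" "inv_set B" by auto
    have D: "inv_set (P - B)" by (rule inv_set_diff[OF P B(3)])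
    have "(\<Sum>x\<in>{x \<in> cent P. joint_orbit x p = B}. W P x) = (\<Sum>(u, v)\<in>trans_perms B p \<times> cent (P - B). W B u * W (P - B) v)"
    proof (rule sum.reindex_bij_witness[of _ "\<lambda>(u, v). u \<circ> v" "\<lambda>x. (perm_restrict x B, perm_restrict x (P - B))"])
      fix x assume x: "x \<in> {x \<in> cent P. joint_orbit x p = B}"
      then have xX: "x \<in> cent P" and xB: "x ` B = B" using joint_orbit_props(4)[OF P _ p] by auto
      note xs = signed_permsD[OF centD(1)[OF xX]]
      have xD: "x ` (P - B) = P - B" by (rule signed_bij_image_diff[OF xs(2,3) xB])
      show "(case (perm_restrict x B, perm_restrict x (P - B)) of (u, v) \<Rightarrow> u \<circ> v) = x"
        using xD xs(4) by (auto simp: fun_eq_iff perm_restrict_def)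
      have r: "perm_restrict x B \<in> cent B" "perm_restrict x (P - B) \<in> cent (P - B)"
        by (rule restrict_in_X[OF B(3) xX xB], rule restrict_in_X[OF D xX xD])
      have "joint_orbit (perm_restrict x B) p = joint_orbit x p"
        by (rule joint_orbit_cong[of B]) (use B inv_setD xB in \<open>auto simp: perm_restrict_def\<close>)
      then show "(perm_restrict x B, perm_restrict x (P - B)) \<in> trans_perms B p \<times> cent (P - B)"
        using r x by (simp add: trans_perms_def)
      show "(case (perm_restrict x B, perm_restrict x (P - B)) of (u, v) \<Rightarrow> W B u * W (P - B) v) = W P x"
        using W P B xX xB by (simp add: multiplicative_def)
    next
      fix c assume "c \<in> trans_perms B p \<times> cent (P - B)"
      then obtain u v where c: "c = (u, v)" "u \<in> cent B" "joint_orbit u p = B" "v \<in> cent (P - B)" by (auto simp: trans_perms_def)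
      note uv = comp_in_X[OF B(1) c(2,4)]
      have "perm_restrict (u \<circ> v) B = u"
        using uv(2) signed_permsD(4)[OF centD(1)[OF c(2)]] by (auto simp: fun_eq_iff perm_restrict_def)
      moreover have "perm_restrict (u \<circ> v) (P - B) = v"
        using uv(3) signed_permsD(4)[OF centD(1)[OF c(4)]] by (auto simp: fun_eq_iff perm_restrict_def)
      ultimately show "(perm_restrict (case c of (u, v) \<Rightarrow> u \<circ> v) B, perm_restrict (case c of (u, v) \<Rightarrow> u \<circ> v) (P - B)) = c"
        by (simp only: c(1) prod.case)
      have "joint_orbit u p = joint_orbit (u \<circ> v) p"
        by (rule joint_orbit_cong[of B]) (use B inv_setD uv(2,4) signed_permsD(3)[OF centD(1)[OF c(2)]] in auto)
      then show "(case c of (u, v) \<Rightarrow> u \<circ> v) \<in> {x \<in> cent P. joint_orbit x p = B}" using uv(1) c(1,3) by (simp only: prod.case mem_Collect_eq)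
    qed
    also have "\<dots> = (\<Sum>u\<in>trans_perms B p. W B u) * (\<Sum>v\<in>cent (P - B). W (P - B) v)"
      by (simp add: sum_product sum.cartesian_product)
    finally show "(\<Sum>x\<in>{x \<in> cent P. joint_orbit x p = B}. W P x) = (\<Sum>u\<in>trans_perms B p. W B u) * (\<Sum>v\<in>cent (P - B). W (P - B) v)" .
  qed
  finally show ?thesis .
qed

lemma sum_eq_by_blocks:
  assumes W: "multiplicative V" "multiplicative W" "V {} id = W {} id"
    and loc: "\<And>B p. inv_set B \<Longrightarrow> p \<in> B \<Longrightarrow> (\<Sum>u\<in>trans_perms B p. V B u) = (\<Sum>u\<in>trans_perms B p. W B u)"
    and "inv_set P"
  shows "(\<Sum>x\<in>cent P. V P x) = (\<Sum>x\<in>cent P. W P x)"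
  using \<open>inv_set P\<close>
proof (induction "card P" arbitrary: P rule: less_induct)
  case less
  show ?case
  proof (cases "P = {}")
    case True
    then show ?thesis using W(3) by (simp add: cent_empty)
  next
    case False
    then obtain p where p: "p \<in> P" by auto
    have "finite P" using less.prems by (simp add: inv_set_def signed_set_def)
    show ?thesis
      unfolding block_recursion[OF less.prems p W(1)] block_recursion[OF less.prems p W(2)]
    proof (rule sum.cong[OF refl], rule arg_cong2[where f = "(*)"])
      fix B assume B: "B \<in> {B. B \<subseteq> P \<and> p \<in> B \<and> inv_set B}"
      then show "(\<Sum>u\<in>trans_perms B p. V B u) = (\<Sum>u\<in>trans_perms B p. W B u)" using loc by simp
      have "card (P - B) < card P" using B p \<open>finite P\<close> by (intro psubset_card_mono) auto
      then show "(\<Sum>x\<in>cent (P - B). V (P - B) x) = (\<Sum>x\<in>cent (P - B). W (P - B) x)"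
        using less.hyps less.prems inv_set_diff B by simp
    qed
  qed
qed

text \<open>In every splitting, \<open>\<epsilon>\<close> passes to the block, whose sum vanishes,
  or to the complement, where induction applies; in either case the product is 0.\<close>

lemma sum_eq_0_by_blocks:
  assumes W: "multiplicative W"
    and loc: "\<And>B p. inv_set B \<Longrightarrow> p \<in> B \<Longrightarrow> \<epsilon> B \<Longrightarrow> (\<Sum>u\<in>trans_perms B p. W B u) = 0"
    and \<epsilon>: "\<not> \<epsilon> {}" "\<And>P A. inv_set P \<Longrightarrow> inv_set A \<Longrightarrow> A \<subseteq> P \<Longrightarrow> \<epsilon> P \<Longrightarrow> \<epsilon> A \<or> \<epsilon> (P - A)"
    and "inv_set P" "\<epsilon> P"
  shows "(\<Sum>x\<in>cent P. W P x) = 0"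
  using \<open>inv_set P\<close> \<open>\<epsilon> P\<close>
proof (induction "card P" arbitrary: P rule: less_induct)
  case less
  then obtain p where p: "p \<in> P" using \<epsilon>(1) by (metis all_not_in_conv)
  have "finite P" using less.prems by (simp add: inv_set_def signed_set_def)
  show ?case
    unfolding block_recursion[OF less.prems(1) p W]
  proof (intro sum.neutral ballI)
    fix B assume B: "B \<in> {B. B \<subseteq> P \<and> p \<in> B \<and> inv_set B}"
    have "card (P - B) < card P" using B p \<open>finite P\<close> by (intro psubset_card_mono) auto
    then have "\<epsilon> (P - B) \<Longrightarrow> (\<Sum>x\<in>cent (P - B). W (P - B) x) = 0"
      using less.hyps less.prems inv_set_diff B by simp
    then show "(\<Sum>u\<in>trans_perms B p. W B u) * (\<Sum>v\<in>cent (P - B). W (P - B) v) = 0"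
      using \<epsilon>(2)[of P B] less.prems B loc[of B p] by auto
  qed
qed

end

section \<open>Transitive blocks\<close>

context signed_perm
begin

text \<open>Here \<open>y\<close> permutes the signed cycles of \<open>x\<close> in a single cycle; it has \<open>card P div card (scyc x p)\<close> steps.\<close>

context
  fixes y p
  assumes y: "signed_bij y" and comm: "\<And>q. y (x q) = x (y q)"
    and p: "p \<in> P" and cover: "\<And>q. q \<in> P \<Longrightarrow> \<exists>j. q \<in> scyc x ((y ^^ j) p)" and yP: "y ` P = P"
begin

lemma funpow_image_scyc: "(y ^^ j) ` scyc x p = scyc x ((y ^^ j) p)"
proof -
  have "(y ^^ j) (x q) = x ((y ^^ j) q)" for q
    by (rule funpow_commute_apply[of y x]) (rule comm)
  then show ?thesis by (rule scyc_image[OF signed_bij_funpow[OF y]])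
qed

text \<open>Let \<open>D\<close> be the period of \<open>scyc x p\<close> under the action of
  \<open>y\<close> on subsets. The \<open>D\<close> translates are disjoint, of equal size and cover
  \<open>P\<close>, so \<open>D\<close> is the stated quotient. This is applied with
  \<open>g\<close> in the role of \<open>x\<close>, and again with the two permutations
  exchanged.\<close>

lemma return_time:
  shows "card P div card (scyc x p) > 0" "card P = card P div card (scyc x p) * card (scyc x p)"
    "(y ^^ j) p \<in> scyc x p \<longleftrightarrow> card P div card (scyc x p) dvd j"
    "inj_on (\<lambda>j. scyc x ((y ^^ j) p)) {..<card P div card (scyc x p)}"
    "(\<Union>j<card P div card (scyc x p). scyc x ((y ^^ j) p)) = P"
proof -
  let ?O = "scyc x p" and ?F = "(`) y"
  define D where "D = least_power ?F ?O"
  have F: "(?F ^^ j) ?O = scyc x ((y ^^ j) p)" for j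
    unfolding funpow_image_scyc[symmetric] by (induction j) (simp_all add: image_comp)
  have yj: "(y ^^ j) p \<in> P" for j by (rule funpow_in_invariant[OF yP p])
  \<comment> \<open>Off \<open>P\<close> nothing is known about \<open>y\<close>, so the finite
    order is taken from its restriction.\<close>
  obtain n where n: "n > 0" "(?F ^^ n) ?O = ?O"
  proof -
    interpret ys: signed_perm P "perm_restrict y P"
      by unfold_locales (rule signed_set, rule perm_restrict_signed_perms[OF y signed_set yP])
    obtain n where "perm_restrict y P ^^ n = id" "n > 0" using permutation_is_nilpotent[OF ys.permutation] .
    then have "(y ^^ n) p = p" using perm_restrict_funpow[of y P n p] yP p by simp
    then show ?thesis using that \<open>n > 0\<close> F by simp
  qed
  have D: "D > 0" "(?F ^^ D) ?O = ?O" using least_powerI[of n ?F ?O] n by (simp_all add: D_def)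
  have D_iff: "(?F ^^ j) ?O = ?O \<longleftrightarrow> D dvd j" for j
  proof
    assume "D dvd j"
    then obtain t where "j = D * t" by auto
    have "(?F ^^ (D * t)) ?O = ?O" by (induction t) (simp_all add: funpow_add D(2))
    then show "(?F ^^ j) ?O = ?O" by (simp only: \<open>j = D * t\<close>)
  qed (use least_power_minimal[of j ?F ?O] in \<open>simp add: D_def\<close>)
  have iff: "(y ^^ j) p \<in> ?O \<longleftrightarrow> D dvd j" for j
    using D_iff[of j] F[of j] scyc_eq_iff[of "(y ^^ j) p" p] by simp
  have shift: "i = j" if "i \<le> j" "j < D" "scyc x ((y ^^ i) p) = scyc x ((y ^^ j) p)" for i j
  proof -
    have "(y ^^ i) ` ?O = (y ^^ i) ` (y ^^ (j - i)) ` ?O"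
      using that(1,3) by (simp add: funpow_image_scyc[symmetric] image_comp flip: funpow_add)
    then have "?O = (y ^^ (j - i)) ` ?O"
      using signed_bij_funpow[OF y, of i] by (simp add: signed_bij_def bij_def inj_image_eq_iff)
    then have "(?F ^^ (j - i)) ?O = ?O" unfolding F funpow_image_scyc[symmetric] by (rule sym)
    then have "D dvd j - i" by (simp only: D_iff)
    then show ?thesis using that(1,2) by (auto dest: dvd_imp_le)
  qed
  have inj: "inj_on (\<lambda>j. scyc x ((y ^^ j) p)) {..<D}"
    by (rule inj_onI) (metis lessThan_iff nat_le_linear shift)
  have U: "(\<Union>j<D. scyc x ((y ^^ j) p)) = P"
  proof
    show "(\<Union>j<D. scyc x ((y ^^ j) p)) \<subseteq> P" using scyc_subset[OF yj] by auto
    show "P \<subseteq> (\<Union>j<D. scyc x ((y ^^ j) p))"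
    proof
      fix q assume "q \<in> P"
      then obtain j where j: "q \<in> scyc x ((y ^^ j) p)" using cover by blast
      have "(?F ^^ j) ?O = (?F ^^ (j mod D)) ?O" using funpow_mod_eq[of D ?F ?O j] D by simp
      then have "q \<in> scyc x ((y ^^ (j mod D)) p)" using j F by simp
      then show "q \<in> (\<Union>j<D. scyc x ((y ^^ j) p))" using D(1) by (auto intro!: bexI[of _ "j mod D"])
    qed
  qed
  have "card P = (\<Sum>j<D. card (scyc x ((y ^^ j) p)))"
    unfolding U[symmetric]
  proof (rule card_UN_disjoint)
    show "\<forall>i\<in>{..<D}. finite (scyc x ((y ^^ i) p))" using finite_scyc[OF yj] by simp
    show "\<forall>i\<in>{..<D}. \<forall>j\<in>{..<D}. i \<noteq> j \<longrightarrow> scyc x ((y ^^ i) p) \<inter> scyc x ((y ^^ j) p) = {}"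
    proof (intro ballI impI, rule ccontr)
      fix i j assume *: "i \<in> {..<D}" "j \<in> {..<D}" "i \<noteq> j" "scyc x ((y ^^ i) p) \<inter> scyc x ((y ^^ j) p) \<noteq> {}"
      then have "scyc x ((y ^^ i) p) = scyc x ((y ^^ j) p)" using scyc_eq by blast
      then show False using inj_onD[OF inj] * by blast
    qed
  qed simp
  also have "\<dots> = (\<Sum>j<D. card ?O)"
  proof (rule sum.cong)
    fix j
    show "card (scyc x ((y ^^ j) p)) = card ?O"
      unfolding funpow_image_scyc[symmetric] using signed_bij_funpow[OF y, of j]
      by (intro card_image) (auto simp: signed_bij_def bij_def intro: inj_on_subset)
  qed simp
  finally have c: "card P = D * card ?O" by simp
  have "card ?O > 0" using finite_scyc[OF p] scyc_self[of p x] by (auto simp: card_gt_0_iff)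
  then have "card P div card ?O = D" using c by simp
  then show "card P div card ?O > 0" "card P = card P div card ?O * card ?O"
    "(y ^^ j) p \<in> ?O \<longleftrightarrow> card P div card ?O dvd j"
    "inj_on (\<lambda>j. scyc x ((y ^^ j) p)) {..<card P div card ?O}"
    "(\<Union>j<card P div card ?O. scyc x ((y ^^ j) p)) = P"
    using c D(1) iff inj U by simp_all
qed

end

end

locale block = signed_perm B g + root_choice \<zeta> \<eta> for B g \<zeta> \<eta> +
  fixes p :: int
  assumes p: "p \<in> B"
begin

sublocale signed_map g by unfold_locales (rule x(2))

abbreviation "Orb \<equiv> scyc g p"

text \<open>The number of signed cycles of \<open>g\<close> in \<open>B\<close> once
  \<open>TB\<close> is nonempty. The formula does not mention \<open>y\<close>, so the same
  \<open>d\<close> serves all elements of \<open>TB\<close>.\<close>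

definition d :: nat where "d = card B div card Orb"

abbreviation TB :: "(int \<Rightarrow> int) set" where "TB \<equiv> trans_perms B p"

lemma inv_set_B: "inv_set B"
  using signed_set x(3) by (simp add: inv_set_def)

lemma TD:
  assumes "y \<in> TB"
  shows "y \<in> signed_perms B" "signed_bij y" "y ` B = B" "y (g q) = g (y q)" "joint_orbit y p = B" "signed_perm B y" "y \<in> cent B"
proof -
  show cent: "y \<in> cent B" and "joint_orbit y p = B" using assms by (auto simp: trans_perms_def)
  show s: "y \<in> signed_perms B" "y (g q) = g (y q)" using centD[OF cent] by auto
  show "signed_bij y" "y ` B = B" using signed_permsD[OF s(1)] by auto
  show "signed_perm B y" using signed_set s(1) by (simp add: signed_perm_def)
qed

lemma commute_powers:
  assumes "y \<in> cent B" shows "(y ^^ j) ((g ^^ l) q) = (g ^^ l) ((y ^^ j) q)"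
proof -
  have "y ((g ^^ l) q) = (g ^^ l) (y q)" for q
    by (rule funpow_commute_apply[of g y, symmetric]) (simp add: centD(2)[OF assms])
  then show ?thesis by (rule funpow_commute_apply[of y "g ^^ l"])
qed

lemma joint_orbit_iff:
  assumes "y \<in> cent B"
  shows "joint_orbit y p = B \<longleftrightarrow> (\<forall>q\<in>B. \<exists>j. q \<in> scyc g ((y ^^ j) p))"
proof -
  have "joint_orbit y p = (\<Union>j. scyc g ((y ^^ j) p))"
    unfolding joint_orbit_def scyc_def commute_powers[OF assms] by blast
  then show ?thesis using joint_orbit_props(1)[OF inv_set_B assms p] by auto
qed

lemma TB_cover:
  assumes y: "y \<in> TB" and q: "q \<in> B"
  shows "\<exists>j. q \<in> scyc g ((y ^^ j) p)" "\<exists>j. q \<in> scyc y ((g ^^ j) p)"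
proof -
  show "\<exists>j. q \<in> scyc g ((y ^^ j) p)" using joint_orbit_iff TD(5,7)[OF y] q by blast
  have "q \<in> joint_orbit y p" using TD(5)[OF y] q by simp
  then show "\<exists>j. q \<in> scyc y ((g ^^ j) p)" unfolding joint_orbit_def scyc_def by blast
qed

lemma TB_time:
  assumes y: "y \<in> TB"
  shows "d > 0" "card B = d * card Orb" "(y ^^ j) p \<in> Orb \<longleftrightarrow> d dvd j"
    "inj_on (\<lambda>j. scyc g ((y ^^ j) p)) {..<d}" "(\<Union>j<d. scyc g ((y ^^ j) p)) = B"
  using return_time[OF TD(2)[OF y] TD(4)[OF y] p TB_cover(1)[OF y] TD(3)[OF y]] by (simp_all add: d_def)

text \<open>Every point of \<open>B\<close> has the form \<open>s * (y ^^ j) ((g ^^ l) p)\<close>,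
  and maps commuting with \<open>y\<close>, \<open>g\<close> and negation respect such an
  expression.\<close>

lemma TB_commute_eq:
  assumes y: "y \<in> TB" and u: "signed_bij u" "\<And>q. u (g q) = g (u q)" "\<And>q. u (y q) = y (u q)"
    and v: "signed_bij v" "\<And>q. v (g q) = g (v q)" "\<And>q. v (y q) = y (v q)" and eq: "u p = v p" and q: "q \<in> B"
  shows "u q = v q"
proof -
  have "q \<in> joint_orbit y p" using TD(5)[OF y] q by simp
  then obtain s j l where s: "s \<in> signs" "q = s * (y ^^ j) ((g ^^ l) p)" by (rule blkE)
  have "w q = s * (y ^^ j) ((g ^^ l) (w p))" if "signed_bij w" "\<And>q. w (g q) = g (w q)" "\<And>q. w (y q) = y (w q)" for w
    unfolding s(2) by (simp only: signed_bijD(2)[OF that(1) s(1)] funpow_commute_apply[of y w, OF that(3)[symmetric]]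
      funpow_commute_apply[of g w, OF that(2)[symmetric]])
  from this[OF u] this[OF v] eq show ?thesis by simp
qed

section \<open>Twisting by the group generated by \<open>g\<close> and negation on one signed
  cycle\<close>

definition act :: "int \<Rightarrow> nat \<Rightarrow> int \<Rightarrow> int" where
  "act s a q = s * (g ^^ a) q"

lemma act_props:
  assumes s: "s \<in> signs"
  shows "signed_bij (act s a)" "act s a (g q) = g (act s a q)" "y \<in> cent B \<Longrightarrow> act s a (y q) = y (act s a q)"
    "act s a q \<in> scyc g q" "act s a ` scyc g q = scyc g q"
proof -
  have u: "signed_bij ((*) s)" using s by (auto simp: signed_bij_def bij_uminus fun_eq_iff intro!: bijI')
      (metis minus_minus)
  have "act s a = (*) s \<circ> (g ^^ a)" by (simp add: act_def fun_eq_iff)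
  then show b: "signed_bij (act s a)" using signed_bij_comp[OF u signed_bij_funpow[OF x(2)]] by simp
  show c: "act s a (g q) = g (act s a q)" for q by (simp only: act_def x(6)[OF s] funpow_swap1)
  show "act s a (y q) = y (act s a q)" if y: "y \<in> cent B"
    using commute_powers[OF y, of 1 a q] signed_bijD(2)[OF signed_permsD(2)[OF centD(1)[OF y]] s] by (simp add: act_def)
  show m: "act s a q \<in> scyc g q" using scycI[OF s] by (simp add: act_def)
  show "act s a ` scyc g q = scyc g q" using scyc_image[OF b c] scyc_eq[OF m] by simp
qed

definition twist :: "int \<Rightarrow> nat \<Rightarrow> int \<Rightarrow> int" where
  "twist s a = perm_restrict (act s a) Orb"

lemma scyc_inv: "q \<in> Orb \<longleftrightarrow> g q \<in> Orb" "- q \<in> Orb \<longleftrightarrow> q \<in> Orb"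
proof -
  show "q \<in> Orb \<longleftrightarrow> g q \<in> Orb" using scyc_eq_iff scyc_eq[OF scyc_x] by blast
  show "- q \<in> Orb \<longleftrightarrow> q \<in> Orb" using scyc_eq_iff scyc_eq[OF scyc_minus] by blast
qed

lemma signed_set_O: "signed_set Orb"
proof -
  have "uminus ` Orb \<subseteq> Orb" using scyc_inv(2) by blast
  moreover have "signed_bij uminus" by (simp add: signed_bij_def bij_uminus)
  ultimately have "uminus ` Orb = Orb" using signed_bij_image_eq finite_scyc[OF p] by blast
  then show ?thesis using finite_scyc[OF p] scyc_subset[OF p] P(2) by (auto simp: signed_set_def)
qed

lemma twist_in_X: "s \<in> signs \<Longrightarrow> twist s a \<in> cent B"
proof -
  assume s: "s \<in> signs"
  have "twist s a \<in> signed_perms Orb"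
    unfolding twist_def by (intro perm_restrict_signed_perms act_props s signed_set_O)
  then have "twist s a \<in> signed_perms B"
    using scyc_subset[OF p] by (auto simp: signed_perms_def intro: permutes_subset)
  then show ?thesis using scyc_inv act_props(2)[OF s] by (simp add: cent_def twist_def perm_restrict_def)
qed

lemma twist_simps: "q \<in> Orb \<Longrightarrow> twist s a q = act s a q" "q \<notin> Orb \<Longrightarrow> twist s a q = q"
  by (simp_all add: twist_def perm_restrict_def)

lemma twist_in_scyc: "s \<in> signs \<Longrightarrow> twist s a q \<in> scyc g q"
  using act_props(4) scyc_self by (cases "q \<in> Orb") (simp_all add: twist_simps)

lemma cent_comp: "u \<in> cent B \<Longrightarrow> v \<in> cent B \<Longrightarrow> u \<circ> v \<in> cent B"
  by (simp add: cent_def signed_perms_comp)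

text \<open>A twist preserves every signed cycle of \<open>g\<close>, so the composite visits the
  same ones as \<open>y\<close> and stays transitive. In its first \<open>d\<close> steps from
  \<open>p\<close> it is at a point of \<open>Orb\<close> only at the start, so the twist takes
  effect exactly once.\<close>

lemma comp_twist:
  assumes y: "y \<in> TB" and s: "s \<in> signs"
  shows "y \<circ> twist s a \<in> TB" "((y \<circ> twist s a) ^^ d) p = act s a ((y ^^ d) p)"
proof -
  let ?y = "y \<circ> twist s a"
  have yX: "y \<in> cent B" by (rule TD(7)[OF y])
  have cent: "?y \<in> cent B" by (intro cent_comp yX twist_in_X s)
  have img: "y ` scyc g q = scyc g (y q)" for q
    by (rule scyc_image[OF TD(2)[OF y] TD(4)[OF y]])
  have "scyc g ((?y ^^ j) p) = scyc g ((y ^^ j) p)" for j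
  proof (induction j)
    case (Suc j)
    have "scyc g ((?y ^^ Suc j) p) = y ` scyc g (twist s a ((?y ^^ j) p))" by (simp add: img)
    also have "\<dots> = y ` scyc g ((?y ^^ j) p)" using scyc_eq[OF twist_in_scyc[OF s]] by simp
    also have "\<dots> = scyc g ((y ^^ Suc j) p)" by (simp only: Suc img funpow.simps comp_apply)
    finally show ?case .
  qed simp
  then have "joint_orbit ?y p = B" using TB_cover(1)[OF y] unfolding joint_orbit_iff[OF cent] by simp
  then show "?y \<in> TB" using cent by (simp add: trans_perms_def)
  have "(?y ^^ Suc j) p = act s a ((y ^^ Suc j) p)" if "j < d" for j
    using that
  proof (induction j)
    case 0
    show ?case using scyc_self[of p g] act_props(3)[OF s yX, of a p] by (simp add: twist_simps)
  next
    case (Suc j)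
    have "(y ^^ Suc j) p \<notin> Orb" using TB_time(3)[OF y, of "Suc j"] Suc.prems by (auto dest: dvd_imp_le)
    moreover have "act s a ((y ^^ Suc j) p) \<in> Orb \<longleftrightarrow> (y ^^ Suc j) p \<in> Orb"
      using act_props(4)[OF s, of a "(y ^^ Suc j) p"] scyc_eq scyc_eq_iff by metis
    moreover have IH: "(?y ^^ Suc j) p = act s a ((y ^^ Suc j) p)" using Suc.IH Suc.prems Suc_lessD by blast
    ultimately have "twist s a ((?y ^^ Suc j) p) = act s a ((y ^^ Suc j) p)"
      by (simp only: twist_simps(2) simp_thms)
    then have "(?y ^^ Suc (Suc j)) p = y (act s a ((y ^^ Suc j) p))"
      by (simp only: funpow.simps(2)[of "Suc j"] comp_apply)
    also have "\<dots> = act s a ((y ^^ Suc (Suc j)) p)" using act_props(3)[OF s yX, of a] by simp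
    finally show ?case .
  qed
  from this[of "d - 1"] TB_time(1)[OF y] show "(?y ^^ d) p = act s a ((y ^^ d) p)" by simp
qed

definition M :: nat where "M = card (cyc g p)"

text \<open>The pairs of an element of \<open>S\<close> and a residue modulo \<open>M\<close>
  parametrize the action of \<open>g\<close> and negation on \<open>Orb\<close>. For class -1,
  negation is already a power of \<open>g\<close>, so only the sign 1 is kept.\<close>

definition S :: "int set" where "S = (if neg_cyc g p then {1} else signs)"

lemma M_pos: "M > 0"
  unfolding M_def by (rule card_cyc_pos)

lemma S_signs: "s \<in> S \<Longrightarrow> s \<in> signs"
  by (simp add: S_def split: if_splits)

lemma funpow_g_eq_iff: "(g ^^ a) p = (g ^^ b) p \<longleftrightarrow> a mod M = b mod M"
proof -
  have *: "(g ^^ a) p = (g ^^ b) p \<longleftrightarrow> M dvd b - a" if "a \<le> b" for a b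
  proof -
    have "(g ^^ b) p = (g ^^ a) ((g ^^ (b - a)) p)" using that by (metis comp_apply funpow_add le_add_diff_inverse)
    then have "(g ^^ a) p = (g ^^ b) p \<longleftrightarrow> (g ^^ (b - a)) p = p"
      using signed_bijD(3)[OF signed_bij_funpow[OF x(2)]] by metis
    then show ?thesis by (simp add: M_def funpow_eq_self_iff)
  qed
  show ?thesis
  proof (cases "a \<le> b")
    case True
    then show ?thesis using * mod_eq_dvd_iff_nat[OF True, of M] by metis
  next
    case False
    then have "b \<le> a" by simp
    then show ?thesis using *[of b a] mod_eq_dvd_iff_nat[of b a M] by metis
  qed
qed

lemma act_p_eq_iff:
  assumes "s \<in> S" "s' \<in> S"
  shows "act s a p = act s' b p \<longleftrightarrow> s = s' \<and> a mod M = b mod M"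
proof (cases "s = s'")
  case True
  then show ?thesis using S_signs[OF assms(1)] by (auto simp: act_def funpow_g_eq_iff)
next
  case False
  then have n: "\<not> neg_cyc g p" and s: "s' = - s" "s \<in> signs" using assms by (auto simp: S_def split: if_splits)
  have "(g ^^ a) p \<noteq> - (g ^^ b) p"
  proof
    assume eq: "(g ^^ a) p = - (g ^^ b) p"
    obtain b' where b': "\<And>p. (g ^^ b') ((g ^^ b) p) = p" using funpow_inverse by metis
    have "(g ^^ b') ((g ^^ a) p) = - p" unfolding eq x(10) b' ..
    then have "(g ^^ (b' + a)) p = - p" by (simp add: funpow_add)
    then show False using n neg_cyc_iff by blast
  qed
  then show ?thesis using False s by (auto simp: act_def)
qed

lemma O_coordinates:
  assumes "q \<in> Orb" obtains s a where "s \<in> S" "a < M" "q = act s a p"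
proof -
  have "\<exists>s a. s \<in> S \<and> q = act s a p"
  proof (cases "neg_cyc g p")
    case True
    then have "q \<in> cyc g p" using scyc_neg assms by simp
    then show ?thesis using True by (auto simp: cyc_def S_def act_def)
  next
    case False
    then show ?thesis using assms by (auto simp: scyc_def S_def act_def)
  qed
  then obtain s a where s: "s \<in> S" "q = act s a p" by auto
  then have "q = act s (a mod M) p" using act_p_eq_iff[of s s a "a mod M"] by simp
  then show thesis using that[of s "a mod M"] s(1) M_pos by simp
qed

definition T1 :: "(int \<Rightarrow> int) set" where "T1 = {y \<in> TB. (y ^^ d) p = p}"

lemma twist_inverse:
  assumes s: "s \<in> signs" obtains b where "twist s a \<circ> twist s b = id"
proof -
  obtain b where b: "\<And>p. (g ^^ a) ((g ^^ b) p) = p" using funpow_inverse by metis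
  have "twist s a (twist s b q) = q" for q
  proof (cases "q \<in> Orb")
    case True
    then have "act s b q \<in> Orb" using act_props(4)[OF s] scyc_eq by metis
    then have "twist s a (twist s b q) = s * (s * (g ^^ a) ((g ^^ b) q))"
      using True by (simp only: twist_simps act_def x(11)[OF s])
    then show ?thesis using s by (auto simp: b)
  qed (simp add: twist_simps)
  then have "twist s a \<circ> twist s b = id" by (simp add: fun_eq_iff)
  then show thesis by (rule that)
qed

text \<open>Under twisting, \<open>(y ^^ d) p\<close> runs through \<open>Orb\<close>, each point
  being reached once. Hence every element of \<open>TB\<close> is uniquely a twist of one for which
  this point is \<open>p\<close>.\<close>

lemma sum_TB:
  fixes W :: "(int \<Rightarrow> int) \<Rightarrow> complex"
  shows "(\<Sum>y\<in>TB. W y) = (\<Sum>y\<in>T1. \<Sum>s\<in>S. \<Sum>a<M. W (y \<circ> twist s a))"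
proof -
  have "bij_betw (\<lambda>(y, s, a). y \<circ> twist s a) (T1 \<times> S \<times> {..<M}) TB"
    unfolding bij_betw_def
  proof
    have d: "((y \<circ> twist s a) ^^ d) p = act s a p" if "y \<in> T1" "s \<in> S" for y s a
      using comp_twist(2)[of y s a] that S_signs[of s] by (simp add: T1_def)
    show "inj_on (\<lambda>(y, s, a). y \<circ> twist s a) (T1 \<times> S \<times> {..<M})"
    proof (rule inj_onI)
      fix u v
      assume uv: "u \<in> T1 \<times> S \<times> {..<M}" "v \<in> T1 \<times> S \<times> {..<M}"
        "(\<lambda>(y, s, a). y \<circ> twist s a) u = (\<lambda>(y, s, a). y \<circ> twist s a) v"
      obtain y s a y' s' a' where c: "u = (y, s, a)" "v = (y', s', a')" by (cases u, cases v)
      have *: "y \<in> T1" "s \<in> S" "a \<in> {..<M}" "y' \<in> T1" "s' \<in> S" "a' \<in> {..<M}" "y \<circ> twist s a = y' \<circ> twist s' a'"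
        using uv by (simp_all only: c mem_Sigma_iff prod.case)
      then have "act s a p = act s' a' p" using d[OF *(1,2), of a] d[OF *(4,5), of a'] by simp
      then have sa: "s = s'" "a = a'" using act_p_eq_iff[OF *(2,5), of a a'] *(3,6) by simp_all
      obtain b where "twist s a \<circ> twist s b = id" using twist_inverse[OF S_signs[OF *(2)]] .
      then have "y = y'" using *(7) unfolding sa by (metis comp_assoc comp_id)
      then show "u = v" using sa c by simp
    qed
    show "(\<lambda>(y, s, a). y \<circ> twist s a) ` (T1 \<times> S \<times> {..<M}) = TB"
    proof
      show "(\<lambda>(y, s, a). y \<circ> twist s a) ` (T1 \<times> S \<times> {..<M}) \<subseteq> TB"
        using comp_twist(1) S_signs by (auto simp: T1_def)
      show "TB \<subseteq> (\<lambda>(y, s, a). y \<circ> twist s a) ` (T1 \<times> S \<times> {..<M})"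
      proof
        fix y assume y: "y \<in> TB"
        then have "(y ^^ d) p \<in> Orb" using TB_time(3)[OF y, of d] by simp
        then obtain s a where s: "s \<in> S" "a < M" "(y ^^ d) p = act s a p" by (rule O_coordinates)
        note sg = S_signs[OF s(1)]
        obtain b where b: "twist s a \<circ> twist s b = id" using twist_inverse[OF sg] .
        \<comment> \<open>A right inverse of a right inverse is the original twist, so
          \<open>twist s b\<close> is a two-sided inverse.\<close>
        obtain c where c: "twist s b \<circ> twist s c = id" using twist_inverse[OF sg] .
        have "twist s c = twist s a" using b c by (metis comp_assoc comp_id id_comp)
        then have ba: "twist s b \<circ> twist s a = id" using c by simp
        let ?y = "y \<circ> twist s b"
        have "(?y ^^ d) p = act s b (act s a p)" using comp_twist(2)[OF y sg, of b] s(3) by simp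
        also have "act s a p \<in> Orb" using act_props(4)[OF sg] by simp
        then have "act s b (act s a p) = (twist s b \<circ> twist s a) p" using scyc_self[of p g] by (simp add: twist_simps)
        finally have "?y \<in> T1" using comp_twist(1)[OF y sg, of b] ba by (simp add: T1_def)
        moreover have "y = ?y \<circ> twist s a" using ba by (simp add: comp_assoc)
        ultimately show "y \<in> (\<lambda>(y, s, a). y \<circ> twist s a) ` (T1 \<times> S \<times> {..<M})"
          using s(1,2) by (intro image_eqI[of _ _ "(?y, s, a)"]) auto
      qed
    qed
  qed
  from sum.reindex_bij_betw[OF this, of W]
  have "(\<Sum>y\<in>TB. W y) = (\<Sum>(y, s, a)\<in>T1 \<times> S \<times> {..<M}. W (y \<circ> twist s a))"
    by (simp add: split_def)
  then show ?thesis by (simp add: sum.cartesian_product case_prod_beta)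
qed

end

context block
begin

lemma cent_funpow: "y \<in> cent B \<Longrightarrow> y ^^ j \<in> cent B"
proof (induction j)
  case 0
  show ?case by (simp add: cent_def signed_perms_id flip: id_def)
qed (simp add: cent_comp)

lemma one_in_S: "1 \<in> S"
  by (simp add: S_def)

lemma S_power: "s \<in> S \<Longrightarrow> s ^ l \<in> S"
  using S_signs[of s] by (cases "even l") (auto simp: S_def)

lemma act_one_zero: "act 1 0 q = q"
  by (simp add: act_def)

lemma act_act: "s \<in> signs \<Longrightarrow> t \<in> signs \<Longrightarrow> act s a (act t b q) = act (s * t) (a + b) q"
  by (simp only: act_def x(11) funpow_add comp_apply mult.assoc)

lemma power_time_aux:
  assumes y: "y \<in> TB" and s: "s \<in> S" and eq: "(y ^^ d) p = act s a p"
  shows "(y ^^ (d * l)) p = act (s ^ l) (a * l) p"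
proof (induction l)
  case 0
  show ?case by (simp add: act_one_zero)
next
  case (Suc l)
  have sg: "s ^ l \<in> signs" "s \<in> signs" using S_signs S_power s by blast+
  have "(y ^^ (d * Suc l)) p = (y ^^ d) ((y ^^ (d * l)) p)" by (simp add: funpow_add)
  also have "\<dots> = act (s ^ l) (a * l) ((y ^^ d) p)"
    unfolding Suc by (rule act_props(3)[OF sg(1) cent_funpow[OF TD(7)[OF y]], symmetric])
  also have "\<dots> = act (s ^ Suc l) (a * Suc l) p"
    unfolding eq act_act[OF sg] by (simp add: mult.commute add.commute)
  finally show ?case .
qed

lemma funpow_y_eq_act_iff:
  assumes y: "y \<in> TB" and s: "s \<in> S" and eq: "(y ^^ d) p = act s a p" and t: "t \<in> S"
  shows "(y ^^ j) p = act t b p \<longleftrightarrow> (\<exists>l. j = d * l \<and> s ^ l = t \<and> (a * l) mod M = b mod M)"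
proof
  assume *: "(y ^^ j) p = act t b p"
  have "act t b p \<in> Orb" by (rule act_props(4)[OF S_signs[OF t]])
  then have "d dvd j" unfolding *[symmetric] TB_time(3)[OF y] .
  then obtain l where l: "j = d * l" by auto
  then have "act (s ^ l) (a * l) p = act t b p" using * power_time_aux[OF y s eq] by simp
  then show "\<exists>l. j = d * l \<and> s ^ l = t \<and> (a * l) mod M = b mod M"
    using l act_p_eq_iff[OF S_power[OF s] t] by blast
next
  assume "\<exists>l. j = d * l \<and> s ^ l = t \<and> (a * l) mod M = b mod M"
  then obtain l where l: "j = d * l" "s ^ l = t" "(a * l) mod M = b mod M" by blast
  then show "(y ^^ j) p = act t b p"
    using power_time_aux[OF y s eq, of l] act_p_eq_iff[OF S_power[OF s] t, of l "a * l" b] by simp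
qed

text \<open>If \<open>g ^^ b\<close> takes \<open>p\<close> to \<open>- p\<close>, then
  \<open>M\<close> divides \<open>2 * b\<close> but not \<open>b\<close>. So \<open>b\<close> is an
  odd multiple of \<open>M div 2\<close> and congruent to it modulo \<open>M\<close>.\<close>

lemma neg_half: "neg_cyc g p \<Longrightarrow> M = 2 * slen g p \<and> (g ^^ slen g p) p = - p"
proof -
  assume n: "neg_cyc g p"
  have M: "M = 2 * slen g p" using card_cyc_neg[OF n p] by (simp add: M_def)
  obtain b where b: "(g ^^ b) p = - p" using n neg_cyc_iff by blast
  have "(g ^^ (2 * b)) p = p" using b by (simp only: mult_2 funpow_add comp_apply x(10) minus_minus)
  then have "2 * slen g p dvd 2 * b" using funpow_eq_self_iff M by (simp add: M_def)
  then obtain t where t: "b = slen g p * t" by auto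
  have "odd t"
  proof
    assume "even t"
    then have "M dvd b" using t M by auto
    then have "(g ^^ b) p = p" using funpow_eq_self_iff by (simp add: M_def)
    then show False using b p P(2) by auto
  qed
  then obtain h where "t = 2 * h + 1" by (auto elim: oddE)
  then have "b mod M = slen g p mod M" by (simp add: t M algebra_simps)
  then show ?thesis using M b funpow_g_eq_iff by metis
qed

lemma card_Orb: "card Orb = (if neg_cyc g p then M else 2 * M)"
  using card_scyc[OF p] neg_half card_cyc_pos_type[of p] p by (simp add: M_def)

text \<open>If \<open>y ^^ d\<close> is \<open>act s a\<close> and \<open>r\<close> is the order of \<open>g ^^ a\<close> at \<open>p\<close>, this primitive \<open>r\<close>-th root of unity
  is, up to the sign of \<open>s\<close>, the value of the character at \<open>y ^^ d\<close>.\<close>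

definition rho :: "int \<Rightarrow> nat \<Rightarrow> complex" where
  "rho s r = (if neg_cyc g p then if even r then \<eta> (d * r div 2) ^ d else \<zeta> (d * r) ^ d
     else if s = 1 \<or> even r then \<zeta> (d * r) ^ d else - (\<eta> (d * r) ^ d))"

section \<open>The character value at \<open>g\<close> on a transitive block\<close>

context
  fixes y s a
  assumes y: "y \<in> TB" and s: "s \<in> S" and eq: "(y ^^ d) p = act s a p" and a: "a < M"
begin

interpretation y: signed_perm_roots B y \<zeta> \<eta>
  using TD(6)[OF y] by (intro signed_perm_roots.intro root_choice_axioms)

interpretation yg: commuting B y \<zeta> \<eta> g
  by (intro y.commutingI x) (simp add: TD(4)[OF y])

text \<open>The number of signed cycles of \<open>y\<close> in \<open>B\<close>: the counterpart of
  \<open>d\<close> with \<open>y\<close> and \<open>g\<close> exchanged.\<close>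

definition m :: nat where "m = card B div card (scyc y p)"

private abbreviation "r \<equiv> M div gcd a M"
private abbreviation "w \<equiv> omega_char B y g"
private abbreviation "v \<equiv> cval y"

lemma m_time:
  "m > 0" "card B = m * card (scyc y p)" "(g ^^ j) p \<in> scyc y p \<longleftrightarrow> m dvd j"
  "inj_on (\<lambda>j. scyc y ((g ^^ j) p)) {..<m}" "(\<Union>j<m. scyc y ((g ^^ j) p)) = B"
  using y.return_time[OF x(2) TD(4)[OF y, symmetric] p TB_cover(2)[OF y] x(3)] by (simp_all add: m_def)

lemma g_in_B: "(g ^^ j) p \<in> B"
  by (rule funpow_in_invariant[OF x(3) p])

lemma transversal_powers: "transversal B y ((\<lambda>j. (g ^^ j) p) ` {..<m})"
  unfolding transversal_def
proof (intro conjI)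
  show "(\<lambda>j. (g ^^ j) p) ` {..<m} \<subseteq> B" using g_in_B by auto
  show "inj_on (scyc y) ((\<lambda>j. (g ^^ j) p) ` {..<m})"
    using m_time(4) by (auto simp: inj_on_def)
  show "scyc y ` (\<lambda>j. (g ^^ j) p) ` {..<m} = scyc y ` B"
  proof
    show "scyc y ` B \<subseteq> scyc y ` (\<lambda>j. (g ^^ j) p) ` {..<m}"
    proof
      fix Q assume "Q \<in> scyc y ` B"
      then obtain q where q: "q \<in> B" "Q = scyc y q" by auto
      then obtain j where j: "j < m" "q \<in> scyc y ((g ^^ j) p)" using m_time(5) by blast
      then have "Q = scyc y ((g ^^ j) p)" using q y.scyc_eq by simp
      then show "Q \<in> scyc y ` (\<lambda>j. (g ^^ j) p) ` {..<m}" using j(1) by auto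
    qed
  qed (use g_in_B in auto)
qed

lemma v_nonzero: "q \<in> B \<Longrightarrow> v q \<noteq> 0"
  by (rule y.value_functionD(1)[OF y.value_function_cval])

text \<open>With \<open>p, g p, ..., g^(m-1) p\<close> as the transversal of the signed cycles of
  \<open>y\<close>, the product telescopes.\<close>

lemma omega_char_block: "w = v ((g ^^ m) p) / v p"
proof -
  have inj: "inj_on (\<lambda>j. (g ^^ j) p) {..<m}" using m_time(4) by (auto simp: inj_on_def)
  have "w = (\<Prod>j<m. v ((g ^^ Suc j) p) / v ((g ^^ j) p))"
    unfolding yg.omega_char_eq[OF y.value_function_cval transversal_powers] using inj by (simp add: prod.reindex)
  also have "(\<Prod>j<k. v ((g ^^ Suc j) p) / v ((g ^^ j) p)) = v ((g ^^ k) p) / v ((g ^^ 0) p)" for k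
  proof (induction k)
    case (Suc k)
    then show ?case using v_nonzero[OF g_in_B[of k]] by simp
  qed (use v_nonzero[OF p] in simp)
  finally show ?thesis by simp
qed

lemma omega_char_power: "v ((g ^^ (m * t)) p) = w ^ t * v p"
proof (induction t)
  case (Suc t)
  interpret gm: commuting B y \<zeta> \<eta> "g ^^ m"
  proof (rule y.commutingI[OF signed_bij_funpow[OF x(2)]])
    show "(g ^^ m) ` B = B" using signed_permsD(3)[OF signed_perms_funpow[OF perm]] .
    show "(g ^^ m) (y q) = y ((g ^^ m) q)" for q using commute_powers[OF TD(7)[OF y], of 1 m q] by simp
  qed
  have "(g ^^ (m * t)) p \<in> scyc y p" using m_time(3) by simp
  from gm.ratio_const[OF y.value_function_cval p this]
  have "v ((g ^^ m) ((g ^^ (m * t)) p)) = w * v ((g ^^ (m * t)) p)"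
    using v_nonzero[OF g_in_B] by (simp add: omega_char_block field_simps)
  then show ?case using Suc by (simp add: funpow_add mult.commute mult.left_commute)
qed simp

text \<open>Evaluating the value function on both sides translates a relation between
  \<open>g\<close> and \<open>y\<close> at \<open>p\<close> into an equation for \<open>w\<close>.
  It is used for three relations: \<open>y ^^ d\<close> acting as \<open>act s a\<close>,
  \<open>g ^^ M\<close> fixing \<open>p\<close>, and, for class -1, \<open>g ^^ slen g p\<close>
  negating \<open>p\<close>.\<close>

lemma omega_char_power_div: "(g ^^ b) p = t * (y ^^ j) p \<Longrightarrow> t \<in> signs \<Longrightarrow> m dvd b \<and> w ^ (b div m) = csign y p t * croot y p ^ j"
proof -
  assume b: "(g ^^ b) p = t * (y ^^ j) p" and t: "t \<in> signs"
  have "(g ^^ b) p \<in> scyc y p" unfolding b by (rule scycI[OF t])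
  then have "m dvd b" by (simp only: m_time(3))
  then obtain e where e: "b = m * e" by auto
  have "w ^ e * v p = csign y p t * croot y p ^ j * v p"
    unfolding omega_char_power[symmetric] e[symmetric] b by (rule y.value_functionD(2)[OF y.value_function_cval p t])
  then show ?thesis using v_nonzero[OF p] e m_time(1) by simp
qed

lemma power_A: "m dvd a" "w ^ (a div m) = csign y p s * croot y p ^ d"
proof -
  have "(g ^^ a) p = s * (y ^^ d) p" using eq S_signs[OF s] by (auto simp: act_def)
  then show "m dvd a" "w ^ (a div m) = csign y p s * croot y p ^ d" using omega_char_power_div S_signs[OF s] by blast+
qed

lemma power_B: "m dvd M" "w ^ (M div m) = 1"
proof -
  have "(g ^^ M) p = 1 * (y ^^ 0) p" using funpow_eq_self_iff[of M p] by (simp add: M_def)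
  then have "m dvd M \<and> w ^ (M div m) = csign y p 1 * croot y p ^ 0" by (intro omega_char_power_div) simp_all
  then show "m dvd M" "w ^ (M div m) = 1" by simp_all
qed

lemma power_C: "neg_cyc g p \<Longrightarrow> m dvd slen g p \<and> w ^ (slen g p div m) = csign y p (-1)"
  using omega_char_power_div[of "slen g p" "-1" 0] neg_half by simp

lemma r_pos: "r > 0"
  using M_pos by (simp add: div_greater_zero_iff)

lemma M_eq: "M = gcd a M * r" "a = gcd a M * (a div gcd a M)"
  by simp_all

lemma r_dvd_iff: "(a * l) mod M = 0 \<longleftrightarrow> r dvd l"
  using dvd_mult_iff_div_gcd[OF M_pos] by (simp add: mod_eq_0_iff_dvd)

lemma return_iff: "(y ^^ j) p = p \<longleftrightarrow> (\<exists>l. j = d * l \<and> s ^ l = 1 \<and> r dvd l)"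
  using funpow_y_eq_act_iff[OF y s eq one_in_S, of j 0] r_dvd_iff by (simp add: act_one_zero)

text \<open>At \<open>p\<close>, \<open>y ^^ (d * l)\<close> acts as the sign \<open>s ^ l\<close>
  times \<open>g ^^ (a * l)\<close>. The power of \<open>g\<close> is trivial iff \<open>r\<close>
  divides \<open>l\<close>; for \<open>s = -1\<close> the sign moreover requires \<open>l\<close> to
  be even.\<close>

lemma card_cyc_y: "card (cyc y p) = (if s = 1 \<or> even r then d * r else 2 * (d * r))"
proof -
  have d: "d > 0" by (rule TB_time(1)[OF y])
  have dv: "card (cyc y p) dvd j \<longleftrightarrow> (if s = 1 \<or> even r then d * r else 2 * (d * r)) dvd j" for j
  proof -
    have "(\<exists>l. j = d * l \<and> s ^ l = 1 \<and> r dvd l) \<longleftrightarrow> (\<exists>l. j = d * l \<and> (if s = 1 \<or> even r then r else 2 * r) dvd l)"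
    proof -
      have "s ^ l = 1 \<and> r dvd l \<longleftrightarrow> (if s = 1 \<or> even r then r else 2 * r) dvd l" for l
      proof (cases "s = 1")
        case False
        then have s: "s = -1" using S_signs[OF s] by simp
        have "odd r \<Longrightarrow> coprime 2 r" by simp
        then show ?thesis using s by (auto simp: uminus_power_if divides_mult dest: dvd_mult_left dvd_mult_right dvd_trans)
      qed simp
      then show ?thesis by simp
    qed
    also have "\<dots> \<longleftrightarrow> (if s = 1 \<or> even r then d * r else 2 * (d * r)) dvd j"
      using d by (auto simp: mult.left_commute[of 2] elim!: dvdE)
    finally show ?thesis using return_iff by (simp add: y.funpow_eq_self_iff)
  qed
  have "c = c'" if "\<And>j. c dvd j \<longleftrightarrow> c' dvd j" for c c' :: nat
    using that by (metis dvd_antisym dvd_refl)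
  from this[OF dv] show ?thesis .
qed

text \<open>If \<open>g\<close> has class -1 at \<open>p\<close>, negation is the residue
  \<open>slen g p\<close> of order 2 modulo \<open>M\<close>, and it lies in the subgroup generated
  by \<open>a\<close> iff the order \<open>r\<close> of \<open>a\<close> is even. If
  \<open>g\<close> has class +1, the sign can only come from \<open>s ^ l\<close> with
  \<open>l\<close> odd and divisible by \<open>r\<close>.\<close>

lemma neg_y_iff: "neg_cyc y p \<longleftrightarrow> (if neg_cyc g p then even r else s = -1 \<and> odd r)"
proof (cases "neg_cyc g p")
  case True
  let ?i = "slen g p"
  have M: "M = 2 * ?i" and i: "- p = act 1 ?i p" using neg_half[OF True] by (simp_all add: act_def)
  have s1: "s = 1" using s True by (simp add: S_def)
  have ip: "?i > 0" by (rule slen_pos[OF p])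
  have iM: "?i mod M = ?i" using M ip by simp
  have "neg_cyc y p \<longleftrightarrow> (\<exists>l. (a * l) mod M = ?i)"
    unfolding y.neg_cyc_iff unfolding i funpow_y_eq_act_iff[OF y s eq one_in_S] using s1 iM by simp
  also have "\<dots> \<longleftrightarrow> even r"
  proof
    assume "\<exists>l. (a * l) mod M = ?i"
    then obtain l where l: "(a * l) mod M = ?i" ..
    then have "\<not> r dvd l" using r_dvd_iff[of l] ip by simp
    have "(a * (2 * l)) mod M = (2 * ((a * l) mod M)) mod M" by (simp add: mod_mult_right_eq mult.left_commute)
    also have "\<dots> = 0" unfolding l using M by simp
    finally have "r dvd 2 * l" by (simp only: r_dvd_iff)
    then show "even r" using \<open>\<not> r dvd l\<close> by (metis coprime_dvd_mult_right_iff coprime_right_2_iff_odd)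
  next
    assume "even r"
    then obtain l where l: "r = 2 * l" by auto
    then have "\<not> r dvd l" using r_pos by (auto dest: dvd_imp_le)
    then have n: "(a * l) mod M \<noteq> 0" by (simp only: r_dvd_iff not_False_eq_True)
    have "(a * (2 * l)) mod M = 0" using r_dvd_iff[of "2 * l"] l by simp
    then have "2 * ?i dvd 2 * (a * l)" unfolding M by (simp add: mod_eq_0_iff_dvd mult.left_commute)
    then obtain t where t: "a * l = ?i * t" by auto
    have "odd t" using n t M by auto
    then obtain h where "t = 2 * h + 1" by (auto elim: oddE)
    then have "a * l = ?i + M * h" using t M by (simp add: algebra_simps)
    then show "\<exists>l. (a * l) mod M = ?i" using M ip by (intro exI[of _ l]) simp
  qed
  finally show ?thesis using True by simp
next
  case False
  have i: "- p = act (- 1) 0 p" by (simp add: act_def)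
  have m: "-1 \<in> S" using False by (simp add: S_def)
  have "neg_cyc y p \<longleftrightarrow> (\<exists>l. s ^ l = -1 \<and> r dvd l)"
    unfolding y.neg_cyc_iff unfolding i funpow_y_eq_act_iff[OF y s eq m] using r_dvd_iff by auto
  also have "\<dots> \<longleftrightarrow> s = -1 \<and> odd r"
  proof
    assume "\<exists>l. s ^ l = -1 \<and> r dvd l"
    then obtain l where l: "s ^ l = -1" "r dvd l" by blast
    then have "s = -1" using S_signs[OF s] by auto
    then have "odd l" using l(1) by (auto simp: uminus_power_if split: if_splits)
    then show "s = -1 \<and> odd r" using \<open>s = -1\<close> l(2) dvd_trans by blast
  qed (auto intro!: exI[of _ r])
  finally show ?thesis using False by simp
qed

text \<open>Counting \<open>B\<close> through \<open>g\<close> and through \<open>y\<close> gives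
  \<open>m = gcd a M\<close>, unless \<open>g\<close> has class -1 and \<open>r\<close> is odd. Then
  \<open>y\<close> has class +1 and \<open>gcd a M = 2 * m\<close>, so \<open>a div m\<close> is
  twice \<open>a div gcd a M\<close>. In that case \<open>w ^ r = 1\<close> comes from
  \<open>g ^^ slen g p\<close> negating \<open>p\<close>, as the relation for \<open>g ^^ M\<close>
  only yields \<open>w ^ (2 * r) = 1\<close>. The extra factor depends on \<open>a\<close> only
  through \<open>r\<close>, as the bijection onto roots of unity requires.\<close>

lemma omega_char_equations:
  shows "w ^ r = 1" (is ?A)
    and "w ^ ((if neg_cyc g p \<and> odd r then 2 else 1) * (a div gcd a M)) = rho s r" (is ?B)
proof -
  let ?G = "gcd a M"
  have d: "d > 0" by (rule TB_time(1)[OF y])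
  have G: "?G > 0" using M_pos by simp
  have B: "card B = (if neg_cyc g p then d * (?G * r) else 2 * (d * (?G * r)))"
    using TB_time(2)[OF y] card_Orb M_eq(1) by (simp split: if_splits)
  have dr: "d * r > 0" using d r_pos by simp
  have "?A \<and> ?B"
  proof (cases "neg_cyc g p \<and> odd r")
    case True
    have s1: "s = 1" using s True by (simp add: S_def)
    have ny: "\<not> neg_cyc y p" using True neg_y_iff by simp
    then have slen: "slen y p = d * r" using y.card_cyc_pos_type(1)[OF ny p] card_cyc_y s1 by simp
    then have "d * r * ?G = d * r * (2 * m)"
      using m_time(2) B True y.card_scyc[OF p] by (simp add: mult_ac)
    then have Gm: "?G = 2 * m" using dr by simp
    have "a div m = 2 * (a div ?G)" using M_eq(2) m_time(1) unfolding Gm by (metis mult.assoc mult.commute nonzero_mult_div_cancel_left less_not_refl)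
    moreover have "slen g p div m = r"
      using neg_half True M_eq(1) m_time(1) unfolding Gm by (metis mult.assoc mult.commute nonzero_mult_div_cancel_left less_not_refl zero_neq_numeral mult_left_cancel)
    ultimately show ?thesis
      using power_A(2) power_C True ny s1 slen by (simp add: rho_def csign_def croot_def)
  next
    case False
    have scyc: "card (scyc y p) = (if neg_cyc g p then d * r else 2 * (d * r))"
    proof (cases "neg_cyc y p")
      case True
      then show ?thesis using y.scyc_neg[OF True] card_cyc_y neg_y_iff False s by (auto simp: S_def split: if_splits)
    next
      case n: False
      then show ?thesis using y.card_cyc_pos_type(2)[OF n p] card_cyc_y neg_y_iff False S_signs[OF s]
        by (auto split: if_splits)
    qed
    then have "d * r * ?G = d * r * m" using m_time(2) B by (simp add: mult_ac split: if_splits)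
    then have Gm: "m = ?G" using dr by simp
    have slen: "slen y p = (if neg_cyc g p then d * r div 2 else d * r)"
      using scyc by (simp add: slen_def)
    have A: "w ^ (a div ?G) = csign y p s * croot y p ^ d" "w ^ r = 1"
      using power_A(2) power_B(2) by (simp_all add: Gm)
    show ?thesis
      using A False neg_y_iff slen s S_signs[OF s] by (auto simp: rho_def csign_def croot_def S_def split: if_splits)
  qed
  then show ?A ?B by blast+
qed

end

end

section \<open>Parities of negation, of powers, and from arbitrary half-systems\<close>

lemma parity_uminus: "signed_set P \<Longrightarrow> parity P uminus = (-1) ^ (card P div 2)"
proof -
  assume P: "signed_set P"
  note S = signed_setD[OF P]
  let ?A = "{i \<in> P. i > 0}"
  have "P = ?A \<union> uminus ` ?A"
  proof (intro Set.set_eqI iffI)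
    fix i assume i: "i \<in> P"
    then have "i \<noteq> 0" using S(2) by metis
    then show "i \<in> ?A \<union> uminus ` ?A"
      using i S(3) by (cases "i > 0") (auto intro!: image_eqI[of _ _ "- i"])
  qed (use S(3) in auto)
  moreover have "card (?A \<union> uminus ` ?A) = 2 * card ?A"
    using S(1) by (subst card_Un_disjoint) (auto simp: card_image)
  ultimately have "card P = 2 * card ?A" by simp
  moreover have "parity P uminus = (-1) ^ card ?A"
    using parity_sign(1)[OF P, of uminus] P by (simp add: signed_set_def)
  ultimately show ?thesis by simp
qed

lemma signed_set_image:
  assumes w: "signed_bij w" and P: "signed_set P" shows "signed_set (w ` P)"
proof -
  have "w 0 = 0" using signed_bijD(1)[OF w, of 0] by simp
  then have "0 \<notin> w ` P" using signed_setD(2)[OF P] signed_bijD(3)[OF w, of _ 0] by auto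
  moreover have "uminus ` w ` P = w ` uminus ` P" by (simp add: image_image signed_bijD(1)[OF w])
  ultimately show ?thesis using P by (simp add: signed_set_def)
qed

lemma parity_funpow:
  assumes "signed_set P" "signed_bij w" "w ` P = P"
  shows "parity P (w ^^ j) = parity P w ^ j"
proof (induction j)
  case (Suc j)
  have "(w ^^ j) ` P = P" by (induction j) (simp, metis assms(3) funpow.simps(2) image_comp)
  then show ?case
    using parity_comp[OF assms(1) signed_bij_funpow[OF assms(2)] _ assms(2), of j] Suc
    by (simp only: funpow.simps power_Suc)
qed (simp add: parity_id flip: id_def)

text \<open>The product \<open>sgn r * sgn (w r)\<close> is unchanged under \<open>r -> -r\<close>,
  so the positive points may be replaced by any representatives modulo sign.\<close>

lemma parity_transversal:
  assumes w: "signed_bij w" and R: "finite R" "0 \<notin> R" "R \<inter> uminus ` R = {}"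
  shows "parity (R \<union> uminus ` R) w = (\<Prod>r\<in>R. sgn r * sgn (w r))"
proof -
  have "bij_betw abs R {i \<in> R \<union> uminus ` R. i > 0}"
    unfolding bij_betw_def
  proof
    show "inj_on abs R"
    proof (rule inj_onI)
      fix i j assume ij: "i \<in> R" "j \<in> R" "\<bar>i\<bar> = \<bar>j\<bar>"
      have "i \<noteq> - j" using ij R(3) by blast
      then show "i = j" using ij(3) by linarith
    qed
    show "abs ` R = {i \<in> R \<union> uminus ` R. i > 0}"
    proof (intro Set.set_eqI iffI)
      fix i assume "i \<in> abs ` R"
      then obtain r where r: "r \<in> R" "i = \<bar>r\<bar>" by auto
      then have "r \<noteq> 0" using R(2) by metis
      then show "i \<in> {i \<in> R \<union> uminus ` R. i > 0}" using r by (auto simp: abs_if)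
    next
      fix i assume "i \<in> {i \<in> R \<union> uminus ` R. i > 0}"
      then consider "i \<in> R" "i > 0" | r where "r \<in> R" "i = - r" "i > 0" by blast
      then show "i \<in> abs ` R"
        by cases (rule image_eqI[of _ _ i], simp_all, rule image_eqI, simp_all)
    qed
  qed
  then have "parity (R \<union> uminus ` R) w = (\<Prod>r\<in>R. sgn (w \<bar>r\<bar>))"
    unfolding parity_def by (rule prod.reindex_bij_betw[symmetric])
  also have "\<dots> = (\<Prod>r\<in>R. sgn r * sgn (w r))"
  proof (rule prod.cong)
    fix r assume "r \<in> R"
    then have "sgn r * sgn r = 1" using R(2) by (auto simp: sgn_if)
    then show "sgn (w \<bar>r\<bar>) = sgn r * sgn (w r)"
      using signed_sgn_abs[OF w, of r] by (metis mult.assoc mult.commute mult_1_right)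
  qed simp
  finally show ?thesis .
qed

section \<open>Comparison of the two sums\<close>

text \<open>Equality is tested on \<open>P\<close> only, because \<open>g\<close> may move points
  outside \<open>P\<close> while \<open>x\<close> does not.\<close>

definition root_weight :: "nat \<Rightarrow> (int \<Rightarrow> int) \<Rightarrow> int set \<Rightarrow> (int \<Rightarrow> int) \<Rightarrow> complex" where
  "root_weight k g P x = (if \<forall>q\<in>P. (x ^^ k) q = g q then 1 else 0)"

context root_choice
begin

definition torsion_weight :: "nat \<Rightarrow> (int \<Rightarrow> int) \<Rightarrow> int set \<Rightarrow> (int \<Rightarrow> int) \<Rightarrow> complex" where
  "torsion_weight k g P x = (if x ^^ k = id then omega_char P x g else 0)"

definition signed_torsion_weight :: "nat \<Rightarrow> (int \<Rightarrow> int) \<Rightarrow> int set \<Rightarrow> (int \<Rightarrow> int) \<Rightarrow> complex" where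
  "signed_torsion_weight k g P x = of_int (parity P x) * torsion_weight k g P x"

end

context block
begin

text \<open>The maps compared all commute with \<open>y\<close>, \<open>g\<close> and negation, so
  agreement at \<open>p\<close> spreads over the block. At \<open>p\<close> the powers of
  \<open>y\<close> are known.\<close>

lemma funpow_eq_on_block:
  assumes y: "y \<in> TB" and s: "s \<in> S" and eq: "(y ^^ d) p = act s a p"
  shows "y ^^ k = id \<longleftrightarrow> d dvd k \<and> s ^ (k div d) = 1 \<and> M dvd a * (k div d)"
    "(\<forall>q\<in>B. (y ^^ k) q = g q) \<longleftrightarrow> d dvd k \<and> s ^ (k div d) = 1 \<and> (a * (k div d)) mod M = 1 mod M"
proof -
  have d: "d > 0" by (rule TB_time(1)[OF y])
  have *: "(\<exists>l. k = d * l \<and> Q l) \<longleftrightarrow> d dvd k \<and> Q (k div d)" for Q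
    using d by auto
  have yk: "signed_bij (y ^^ k)" "(y ^^ k) (g q) = g ((y ^^ k) q)" "(y ^^ k) (y q) = y ((y ^^ k) q)" for q
    using signed_bij_funpow[OF TD(2)[OF y]] centD(2)[OF cent_funpow[OF TD(7)[OF y]]] by (auto simp: funpow_swap1)
  have "y ^^ k = id \<longleftrightarrow> (y ^^ k) p = p"
  proof
    assume p: "(y ^^ k) p = p"
    have "(y ^^ k) q = id q" for q
    proof (cases "q \<in> B")
      case True
      show ?thesis
        by (rule TB_commute_eq[OF y yk signed_bij_id _ _ _ True]) (simp_all add: p)
    next
      case False
      then show ?thesis using signed_permsD(4)[OF signed_perms_funpow[OF TD(1)[OF y]]] by simp
    qed
    then show "y ^^ k = id" by blast
  qed simp
  then show "y ^^ k = id \<longleftrightarrow> d dvd k \<and> s ^ (k div d) = 1 \<and> M dvd a * (k div d)"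
    using funpow_y_eq_act_iff[OF y s eq one_in_S, of k 0] by (simp add: act_one_zero * mod_eq_0_iff_dvd)
  have "(\<forall>q\<in>B. (y ^^ k) q = g q) \<longleftrightarrow> (y ^^ k) p = g p"
    using p TB_commute_eq[OF y yk x(2) refl TD(4)[OF y, symmetric]] by blast
  also have "g p = act 1 1 p" by (simp add: act_def)
  finally show "(\<forall>q\<in>B. (y ^^ k) q = g q) \<longleftrightarrow> d dvd k \<and> s ^ (k div d) = 1 \<and> (a * (k div d)) mod M = 1 mod M"
    using funpow_y_eq_act_iff[OF y s eq one_in_S, of k 1] by (simp add: *)
qed

text \<open>In each case a \<open>d\<close>-th power is taken of a root whose order is
  \<open>d\<close> times a known number: \<open>d * r\<close>, or \<open>2 * (d * r)\<close> in the
  last case, where the minus sign halves the order because \<open>r\<close> is odd.\<close>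

lemma rho_order:
  assumes d: "d > 0" and r: "r > 0"
  shows "root_order r (rho s r)"
proof -
  have z: "root_order r (\<zeta> (d * r) ^ d)" using zeta[of "d * r"] d r by (intro root_order_power) simp_all
  moreover have "root_order r (\<eta> (d * r div 2) ^ d)" if "even r"
  proof -
    have "2 * (d * r div 2) = d * r" using that by simp
    moreover have "d * r div 2 > 0" using that d r by (auto elim!: evenE)
    ultimately show ?thesis using eta[of "d * r div 2"] d by (intro root_order_power) simp_all
  qed
  moreover have "root_order r (- (\<eta> (d * r) ^ d))" if "odd r"
  proof (rule root_order_minus[OF _ that])
    show "root_order (2 * r) (\<eta> (d * r) ^ d)"
      using eta[of "d * r"] d r by (intro root_order_power) (simp_all add: mult.left_commute)
  qed
  ultimately show ?thesis by (simp add: rho_def)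
qed

context
  fixes y s
  assumes y: "y \<in> T1" and s: "s \<in> S"
begin

lemma d_pos: "d > 0"
proof -
  have "y \<in> TB" using y by (simp add: T1_def)
  then show ?thesis by (rule TB_time(1))
qed

lemma twisted: "y \<circ> twist s a \<in> TB" "((y \<circ> twist s a) ^^ d) p = act s a p"
  using comp_twist[of y s a] y S_signs[OF s] by (simp_all add: T1_def)

lemma twisted_equations:
  assumes "a < M"
  shows "omega_char B (y \<circ> twist s a) g ^ (M div gcd a M) = 1"
    "omega_char B (y \<circ> twist s a) g ^ ((if neg_cyc g p \<and> odd (M div gcd a M) then 2 else 1) * (a div gcd a M)) = rho s (M div gcd a M)"
  using omega_char_equations[OF twisted(1) s twisted(2) assms] by simp_all

lemma rho_order': "r > 0 \<Longrightarrow> r dvd M \<Longrightarrow> root_order r (rho s r)"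
  by (rule rho_order[OF d_pos])

lemma torsion_sum:
  "(\<Sum>a | a < M \<and> M dvd a * l. omega_char B (y \<circ> twist s a) g) = of_nat (card {a. a < M \<and> a * l mod M = 1 mod M})"
  by (rule sum_torsion_eq_card[of M "\<lambda>a. omega_char B (y \<circ> twist s a) g" "\<lambda>q. if neg_cyc g p \<and> odd q then 2 else 1" "rho s",
    OF M_pos twisted_equations rho_order'])

lemma alternating_torsion_sum:
  assumes "M = 2 * i" "even i" "even l"
  shows "(\<Sum>a | a < M \<and> M dvd a * l. (-1) ^ a * omega_char B (y \<circ> twist s a) g) = 0"
  by (rule alternating_sum_torsion[of M "\<lambda>a. omega_char B (y \<circ> twist s a) g" "\<lambda>q. if neg_cyc g p \<and> odd q then 2 else 1" "rho s",
    OF M_pos twisted_equations rho_order' assms])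

lemma twisted_weights:
  "torsion_weight k g B (y \<circ> twist s a) =
    (if d dvd k \<and> s ^ (k div d) = 1 \<and> M dvd a * (k div d) then omega_char B (y \<circ> twist s a) g else 0)"
  "root_weight k g B (y \<circ> twist s a) =
    (if d dvd k \<and> s ^ (k div d) = 1 \<and> (a * (k div d)) mod M = 1 mod M then 1 else 0)"
  unfolding torsion_weight_def root_weight_def funpow_eq_on_block[OF twisted(1) s twisted(2)] by simp_all

lemma twisted_sum:
  "(\<Sum>a<M. torsion_weight k g B (y \<circ> twist s a)) = (\<Sum>a<M. root_weight k g B (y \<circ> twist s a))"
proof (cases "d dvd k \<and> s ^ (k div d) = 1")
  case True
  have "(\<Sum>a<M. torsion_weight k g B (y \<circ> twist s a)) = (\<Sum>a | a < M \<and> M dvd a * (k div d). omega_char B (y \<circ> twist s a) g)"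
    using True by (simp add: twisted_weights lessThan_def flip: sum.inter_filter)
  also have "\<dots> = of_nat (card {a. a < M \<and> a * (k div d) mod M = 1 mod M})" by (rule torsion_sum)
  also have "\<dots> = (\<Sum>a | a < M \<and> a * (k div d) mod M = 1 mod M. 1)" by simp
  also have "\<dots> = (\<Sum>a<M. root_weight k g B (y \<circ> twist s a))"
    using True by (simp add: twisted_weights lessThan_def sum.inter_filter[symmetric] del: sum_constant)
  finally show ?thesis .
next
  case False
  then have "torsion_weight k g B (y \<circ> twist s a) = 0" "root_weight k g B (y \<circ> twist s a) = 0" for a
    unfolding twisted_weights by auto
  then show ?thesis by simp
qed

end

lemma local_sum: "(\<Sum>u\<in>TB. torsion_weight k g B u) = (\<Sum>u\<in>TB. root_weight k g B u)"
  unfolding sum_TB by (intro sum.cong refl twisted_sum)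

section \<open>Parities on a transitive block and the vanishing of the weighted sum\<close>

lemma parity_twist:
  assumes "s \<in> signs"
  shows "parity B (twist s a) = (if s = 1 then 1 else (-1) ^ (card Orb div 2)) * parity Orb g ^ a"
proof -
  have fin: "finite Orb" "finite (B - Orb)" using finite_scyc[OF p] P(1) by auto
  have gO: "g ` Orb = Orb" using act_props(5)[of 1 1 p] by (simp add: act_def)
  have gO': "(g ^^ a) ` Orb = Orb" using act_props(5)[of 1 a p] by (simp add: act_def)
  have "B = Orb \<union> (B - Orb)" using scyc_subset[OF p] by auto
  then have "parity B (twist s a) = parity Orb (twist s a) * parity (B - Orb) (twist s a)"
    using parity_union[OF fin, of "twist s a"] by simp
  also have "parity (B - Orb) (twist s a) = parity (B - Orb) id" by (rule parity_cong) (simp add: twist_simps)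
  also have "parity Orb (twist s a) = parity Orb (((*) s) \<circ> (g ^^ a))" by (rule parity_cong) (simp add: twist_simps act_def)
  also have "\<dots> = parity Orb ((*) s) * parity Orb (g ^^ a)"
  proof (rule parity_comp[OF signed_set_O signed_bij_funpow[OF x(2)] gO'])
    have "act s 0 = (*) s" by (simp add: act_def fun_eq_iff)
    then show "signed_bij ((*) s)" using act_props(1)[OF assms, of 0] by simp
  qed
  also have "parity Orb (g ^^ a) = parity Orb g ^ a" by (rule parity_funpow[OF signed_set_O x(2) gO])
  also have "parity Orb ((*) s) = (if s = 1 then 1 else (-1) ^ (card Orb div 2))"
  proof (cases "s = 1")
    case True
    then show ?thesis by (simp add: parity_def)
  next
    case False
    then have "(*) s = uminus" using assms by (auto simp: fun_eq_iff)
    then show ?thesis using parity_uminus[OF signed_set_O] False by simp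
  qed
  finally show ?thesis by (simp only: parity_id mult_1_right)
qed

text \<open>For class -1, \<open>g ^^ slen g p\<close> is negation on \<open>Orb\<close>. For class
  +1, the cycle of \<open>p\<close> is a half-system permuted by \<open>g\<close>, so the sign of
  each of its points enters twice.\<close>

lemma parity_Orb:
  "parity Orb g * parity Orb g = 1"
  "neg_cyc g p \<Longrightarrow> parity Orb g ^ slen g p = (-1) ^ slen g p"
  "\<not> neg_cyc g p \<Longrightarrow> parity Orb g = 1"
proof -
  have gO: "g ` Orb = Orb" using act_props(5)[of 1 1 p] by (simp add: act_def)
  show "parity Orb g * parity Orb g = 1" using parity_sign(2)[OF signed_set_O, of g] gO by simp
  show "parity Orb g ^ slen g p = (-1) ^ slen g p" if n: "neg_cyc g p"
  proof -
    have "(g ^^ slen g p) q = - q" if "q \<in> Orb" for q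
    proof -
      obtain s j where q: "s \<in> signs" "q = s * (g ^^ j) p" using \<open>q \<in> Orb\<close> by (rule scycE)
      have "(g ^^ slen g p) q = s * (g ^^ j) ((g ^^ slen g p) p)"
        unfolding q(2) x(11)[OF q(1)] by (metis add.commute comp_apply funpow_add)
      then show ?thesis using neg_half[OF n] q by (simp add: x(10))
    qed
    then have "parity Orb (g ^^ slen g p) = parity Orb uminus" by (rule parity_cong)
    then show ?thesis
      using parity_funpow[OF signed_set_O x(2) gO] parity_uminus[OF signed_set_O] card_scyc[OF p] by simp
  qed
  show "parity Orb g = 1" if n: "\<not> neg_cyc g p"
  proof -
    let ?C = "cyc g p"
    have fin: "finite ?C" using card_cyc_pos[of p] card_gt_0_iff by blast
    have z: "0 \<notin> ?C" using cyc_subset[OF p] P(2) by auto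
    have "?C \<inter> uminus ` ?C = {}"
    proof (rule ccontr)
      assume "?C \<inter> uminus ` ?C \<noteq> {}"
      then have "card (?C \<inter> uminus ` ?C) > 0" using fin by (subst card_gt_0_iff) auto
      then have "card Orb \<noteq> 2 * card ?C"
        unfolding scyc_eq_cyc using card_Un_Int[OF fin, of "uminus ` ?C"] fin by (simp add: card_image)
      then show False using card_cyc_pos_type(2)[OF n p] by simp
    qed
    then have "parity Orb g = (\<Prod>r\<in>?C. sgn r * sgn (g r))"
      unfolding scyc_eq_cyc by (intro parity_transversal x(2) fin z)
    also have "\<dots> = (\<Prod>r\<in>?C. sgn r) * (\<Prod>r\<in>?C. sgn (g r))" by (rule prod.distrib)
    also have "(\<Prod>r\<in>?C. sgn (g r)) = (\<Prod>r\<in>g ` ?C. sgn r)"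
      using x(2) by (subst prod.reindex) (auto simp: signed_bij_def bij_def intro: inj_on_subset)
    also have "g ` ?C = ?C"
    proof (rule signed_bij_image_eq[OF x(2) fin])
      show "g ` ?C \<subseteq> ?C" by (auto simp: cyc_def) (metis funpow.simps(2) comp_apply rangeI)
    qed
    also have "(\<Prod>r\<in>?C. sgn r) * (\<Prod>r\<in>?C. sgn r) = (\<Prod>r\<in>?C. sgn r * sgn r)" by (rule prod.distrib[symmetric])
    also have "\<dots> = 1" using z by (intro prod.neutral) (auto simp: sgn_if)
    finally show ?thesis .
  qed
qed

text \<open>The power \<open>y ^^ j\<close> carries \<open>Orb\<close> to another signed cycle of
  \<open>g\<close> and commutes with \<open>g\<close>, so \<open>g\<close> has equal parity on each
  of the \<open>d\<close> signed cycles.\<close>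

lemma parity_B:
  assumes y: "y \<in> TB" shows "parity B g = parity Orb g ^ d"
proof -
  have img: "(y ^^ j) ` Orb = scyc g ((y ^^ j) p)" for j
    by (rule funpow_image_scyc[OF TD(2)[OF y] TD(4)[OF y] p TB_cover(1)[OF y] TD(3)[OF y]])
  have yj: "signed_bij (y ^^ j)" for j by (rule signed_bij_funpow[OF TD(2)[OF y]])
  have gO: "g ` Orb = Orb" using act_props(5)[of 1 1 p] by (simp add: act_def)
  have S: "signed_set ((y ^^ j) ` Orb)" for j
by (rule signed_set_image[OF yj signed_set_O])
  have piece: "parity (scyc g ((y ^^ j) p)) g = parity Orb g" for j
  proof -
    have "parity Orb (g \<circ> (y ^^ j)) = parity ((y ^^ j) ` Orb) g * parity Orb (y ^^ j)"
      by (rule parity_comp_aux[OF signed_set_O S yj refl x(2)])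
    moreover have "parity Orb ((y ^^ j) \<circ> g) = parity Orb (y ^^ j) * parity Orb g"
      by (rule parity_comp[OF signed_set_O x(2) gO yj])
    moreover have "g \<circ> (y ^^ j) = (y ^^ j) \<circ> g" using centD(2)[OF cent_funpow[OF TD(7)[OF y]]] by (simp add: fun_eq_iff)
    moreover have "parity Orb (y ^^ j) \<noteq> 0"
      using signed_bijD(3)[OF yj[of j], of _ 0] signed_bijD(1)[OF yj[of j], of 0] finite_scyc[OF p] P(2) scyc_subset[OF p]
      unfolding parity_def by (subst prod_zero_iff) (auto simp: sgn_0_0)
    ultimately show ?thesis unfolding img by simp
  qed
  have "parity (\<Union>j<k. scyc g ((y ^^ j) p)) g = parity Orb g ^ k" if "k \<le> d" for k
    using that
  proof (induction k)
    case 0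
    show ?case by (simp add: parity_def)
  next
    case (Suc k)
    have yB: "(y ^^ j) p \<in> B" for j by (rule funpow_in_invariant[OF TD(3)[OF y] p])
    have disj: "(\<Union>j<k. scyc g ((y ^^ j) p)) \<inter> scyc g ((y ^^ k) p) = {}"
    proof (rule ccontr)
      assume "(\<Union>j<k. scyc g ((y ^^ j) p)) \<inter> scyc g ((y ^^ k) p) \<noteq> {}"
      then obtain j q where "j < k" "q \<in> scyc g ((y ^^ j) p)" "q \<in> scyc g ((y ^^ k) p)" by blast
      then have "scyc g ((y ^^ j) p) = scyc g ((y ^^ k) p)" using scyc_eq by metis
      then have "j = k" using inj_onD[OF TB_time(4)[OF y], of j k] \<open>j < k\<close> Suc.prems by simp
      then show False using \<open>j < k\<close> by simp
    qed
    have "parity ((\<Union>j<k. scyc g ((y ^^ j) p)) \<union> scyc g ((y ^^ k) p)) g = parity (\<Union>j<k. scyc g ((y ^^ j) p)) g * parity (scyc g ((y ^^ k) p)) g"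
      using finite_scyc[OF yB] by (intro parity_union disj) auto
    then show ?case using Suc by (simp add: lessThan_Suc Un_commute piece mult.commute)
  qed
  from this[of d] show ?thesis by (simp add: TB_time(5)[OF y])
qed

text \<open>By hypothesis \<open>-g\<close> has parity -1 on \<open>B\<close>. The \<open>d\<close>
  signed cycles contribute equally, so \<open>d\<close> is odd and \<open>-g\<close> has parity -1
  on \<open>Orb\<close>; if \<open>d\<close> divides \<open>k\<close>, the quotient is even. For
  class -1 this forces \<open>slen g p\<close> to be even and \<open>g\<close> to have parity -1 on
  \<open>Orb\<close>, so the alternating sum applies. For class +1, \<open>slen g p\<close> is odd:
  twisting by -1 reverses the parity, whereas the torsion sums for the two signs agree.\<close>

lemma local_sum_zero:
  assumes k: "even k" and \<epsilon>: "(-1) ^ (card B div 2) * parity B g = -1"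
  shows "(\<Sum>u\<in>TB. signed_torsion_weight k g B u) = 0"
  unfolding sum_TB
proof (rule sum.neutral, rule ballI)
  fix y assume y: "y \<in> T1"
  then have yT: "y \<in> TB" by (simp add: T1_def)
  let ?i = "slen g p" and ?e = "parity Orb g" and ?l = "k div d"
  have cO: "card Orb = 2 * ?i" by (rule card_scyc[OF p])
  have "card B div 2 = ?i * d" using TB_time(2)[OF yT] cO by simp
  then have pw: "((-1) ^ ?i * ?e) ^ d = -1"
    using \<epsilon> parity_B[OF yT] by (simp add: power_mult_distrib power_mult)
  have e1: "?e = 1 \<or> ?e = -1" using parity_Orb(1) by (simp add: square_eq_1_iff)
  then have ie: "(-1) ^ ?i * ?e = 1 \<or> (-1) ^ ?i * ?e = -1" by (cases "even ?i") auto
  then have ie': "(-1) ^ ?i * ?e = -1" using pw by (metis power_one one_neq_neg_one)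
  have d: "odd d" using pw unfolding ie' by (metis minus_one_power_iff one_neq_neg_one)
  have l: "even ?l" if "d dvd k" using that k d by (metis dvd_mult_div_cancel even_mult_iff)
  have parity: "parity B (y \<circ> twist s a) = parity B y * (if s = 1 then 1 else (-1) ^ ?i) * ?e ^ a" if "s \<in> S" for s a
    using parity_comp[OF signed_set signed_permsD(2,3)[OF centD(1)[OF twist_in_X]] TD(2)[OF yT], of s a]
      parity_twist[of s a] S_signs[OF that] cO by simp
  show "(\<Sum>s\<in>S. \<Sum>a<M. signed_torsion_weight k g B (y \<circ> twist s a)) = 0"
  proof (cases "d dvd k")
    case False
    have "signed_torsion_weight k g B (y \<circ> twist s a) = 0" if "s \<in> S" for s a
      unfolding signed_torsion_weight_def twisted_weights[OF y that] using False by simp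
    then show ?thesis by simp
  next
    case True
    have sl: "s ^ ?l = 1" if "s \<in> S" for s using l[OF True] S_signs[OF that] by auto
    have sum: "(\<Sum>a<M. signed_torsion_weight k g B (y \<circ> twist s a)) =
       of_int (parity B y * (if s = 1 then 1 else (-1) ^ ?i)) * (\<Sum>a | a < M \<and> M dvd a * ?l. of_int ?e ^ a * omega_char B (y \<circ> twist s a) g)"
      if s: "s \<in> S" for s
    proof -
      have "(\<Sum>a<M. signed_torsion_weight k g B (y \<circ> twist s a)) =
        (\<Sum>a<M. if M dvd a * ?l then of_int (parity B y * (if s = 1 then 1 else (-1) ^ ?i)) * (of_int ?e ^ a * omega_char B (y \<circ> twist s a) g) else 0)"
        unfolding signed_torsion_weight_def twisted_weights[OF y s] parity[OF s] using True sl[OF s]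
        by (intro sum.cong refl) (simp add: mult.assoc)
      also have "\<dots> = (\<Sum>a | a < M \<and> M dvd a * ?l. of_int (parity B y * (if s = 1 then 1 else (-1) ^ ?i)) * (of_int ?e ^ a * omega_char B (y \<circ> twist s a) g))"
        by (simp add: lessThan_def flip: sum.inter_filter)
      finally show ?thesis by (simp only: sum_distrib_left)
    qed
    show ?thesis
    proof (cases "neg_cyc g p")
      case n: True
      have i: "even ?i"
      proof (rule ccontr)
        assume "odd ?i"
        then have "?e ^ ?i = ?e" using e1 by auto
        then have "?e = -1" using parity_Orb(2)[OF n] \<open>odd ?i\<close> by simp
        moreover have "- ?e = -1" using ie' \<open>odd ?i\<close> by simp
        ultimately show False by simp
      qed
      then have e: "?e = -1" using ie' by simp
      have "M = 2 * ?i" using neg_half[OF n] by simp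
      from alternating_torsion_sum[OF y one_in_S this i l[OF True]]
      show ?thesis using n sum[OF one_in_S] by (simp add: S_def e)
    next
      case n: False
      have e: "?e = 1" by (rule parity_Orb(3)[OF n])
      then have i: "(-1) ^ ?i = (-1 :: int)" using ie' by simp
      have S: "1 \<in> S" "-1 \<in> S" "S = {1, -1}" using n by (simp_all add: S_def)
      show ?thesis
        unfolding S(3) using sum[OF S(1)] sum[OF S(2)] torsion_sum[OF y S(1), of ?l] torsion_sum[OF y S(2), of ?l]
        by (simp add: e i)
    qed
  qed
qed

end

section \<open>Passage from blocks to the whole set\<close>

context signed_map
begin

text \<open>The results on blocks assume \<open>g\<close> supported on \<open>B\<close>. Restricting
  \<open>g\<close> to \<open>B\<close> changes neither which elements of
  \<open>signed_perms B\<close> commute with it nor their joint orbits through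
  \<open>p\<close>.\<close>

lemma block_local:
  assumes zeta: "root_choice \<zeta> \<eta>" and B: "inv_set B" and p: "p \<in> B"
  shows "block B (perm_restrict g B) \<zeta> \<eta> p" "signed_map.trans_perms (perm_restrict g B) B p = trans_perms B p"
proof -
  let ?g = "perm_restrict g B"
  have gs: "?g \<in> signed_perms B" by (rule perm_restrict_signed_perms[OF g inv_setD[OF B]])
  then show "block B ?g \<zeta> \<eta> p"
    using zeta p inv_setD(1)[OF B] by (simp add: block_def signed_perm_def block_axioms_def)
  interpret r: signed_map ?g by unfold_locales (rule signed_permsD(2)[OF gs])
  have gB: "g q \<in> B \<longleftrightarrow> q \<in> B" for q
    using inv_setD(2)[OF B] signed_bijD(3)[OF g] by (metis imageE imageI)
  have "x (g q) = g (x q) \<longleftrightarrow> x (?g q) = ?g (x q)" if x: "x \<in> signed_perms B" for x q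
  proof (cases "q \<in> B")
    case True
    then have "x q \<in> B" using signed_permsD(3)[OF x] by blast
    then show ?thesis using True by (simp add: perm_restrict_def)
  next
    case False
    then show ?thesis using signed_permsD(4)[OF x] gB by (simp add: perm_restrict_def)
  qed
  then have "r.cent B = cent B" by (auto simp: r.cent_def cent_def)
  moreover have "(?g ^^ l) p = (g ^^ l) p" for l
    using perm_restrict_funpow[of g B l p] inv_setD(2)[OF B] p by simp
  then have "r.joint_orbit x p = joint_orbit x p" for x by (simp add: r.joint_orbit_def joint_orbit_def)
  ultimately show "r.trans_perms B p = trans_perms B p" by (simp add: r.trans_perms_def trans_perms_def)
qed

end

locale map_roots = signed_map g + root_choice \<zeta> \<eta> for g \<zeta> \<eta>
begin

lemma cent_perm_roots: "inv_set P \<Longrightarrow> x \<in> cent P \<Longrightarrow> signed_perm_roots P x \<zeta> \<eta>"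
  by (intro signed_perm_roots.intro root_choice_axioms) (simp add: signed_perm_def inv_setD centD(1))

lemma scyc_invariant:
  assumes "inv_set A" "x ` A = A" "q \<in> A" shows "scyc x q \<subseteq> A"
proof
  fix r assume "r \<in> scyc x q"
  then obtain s j where "s \<in> signs" "r = s * (x ^^ j) q" by (rule scycE)
  then show "r \<in> A"
    using signed_setD(4)[OF inv_setD(1)[OF assms(1)]] funpow_in_invariant[OF assms(2,3)] by simp
qed

lemma omega_char_restrict:
  assumes P: "inv_set P" and A: "inv_set A" and AP: "A \<subseteq> P" and x: "x \<in> cent P" and xA: "x ` A = A"
    and h: "\<And>q. q \<in> A \<Longrightarrow> h q = g q"
  shows "omega_char A x g = omega_char A (perm_restrict x A) h"
proof (rule omega_char_cong)
  interpret signed_perm_roots P x \<zeta> \<eta> by (rule cent_perm_roots[OF P x])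
  show "rep x q \<in> A" if "q \<in> A" for q using rep_in AP scyc_invariant[OF A xA that] that by blast
qed (use xA inv_setD(2)[OF A] h in \<open>auto simp: perm_restrict_def\<close>)

lemma omega_char_split:
  assumes inv: "inv_set P" and A: "inv_set A" and AP: "A \<subseteq> P" and xX: "x \<in> cent P" and xA: "x ` A = A"
  shows "omega_char P x g = omega_char A (perm_restrict x A) g * omega_char (P - A) (perm_restrict x (P - A)) g"
proof -
  interpret signed_perm_roots P x \<zeta> \<eta> by (rule cent_perm_roots[OF inv xX])
  have D: "inv_set (P - A)" by (rule inv_set_diff[OF inv A])
  have xD: "x ` (P - A) = P - A" by (rule signed_bij_image_diff[OF x(2,3) xA])
  have "P = A \<union> (P - A)" using AP by auto
  then have "omega_char P x g = omega_char A x g * omega_char (P - A) x g"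
    using omega_char_union[of A "P - A" g] AP scyc_invariant[OF A xA] scyc_invariant[OF D xD] by auto
  then show ?thesis using omega_char_restrict[OF inv A AP xX xA] omega_char_restrict[OF inv D _ xX xD] by simp
qed

lemma funpow_split:
  assumes P: "inv_set P" and AP: "A \<subseteq> P" and x: "x \<in> cent P" and xA: "x ` A = A"
  shows "x ^^ k = id \<longleftrightarrow> perm_restrict x A ^^ k = id \<and> perm_restrict x (P - A) ^^ k = id"
    "(\<forall>q\<in>P. (x ^^ k) q = g q) \<longleftrightarrow>
      (\<forall>q\<in>A. (perm_restrict x A ^^ k) q = g q) \<and> (\<forall>q\<in>P - A. (perm_restrict x (P - A) ^^ k) q = g q)"
proof -
  have xs: "x \<in> signed_perms P" by (rule centD(1)[OF x])
  have xD: "x ` (P - A) = P - A" by (rule signed_bij_image_diff[OF signed_permsD(2,3)[OF xs] xA])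
  have r: "(perm_restrict x A ^^ k) q = (if q \<in> A then (x ^^ k) q else q)"
    "(perm_restrict x (P - A) ^^ k) q = (if q \<in> P - A then (x ^^ k) q else q)" for q
    using perm_restrict_funpow xA xD by (metis order_refl)+
  have off: "(x ^^ k) q = q" if "q \<notin> P" for q
    using signed_permsD(4)[OF signed_perms_funpow[OF xs] that] .
  show "x ^^ k = id \<longleftrightarrow> perm_restrict x A ^^ k = id \<and> perm_restrict x (P - A) ^^ k = id"
    unfolding fun_eq_iff r id_apply using off AP by (metis DiffI)
  show "(\<forall>q\<in>P. (x ^^ k) q = g q) \<longleftrightarrow>
      (\<forall>q\<in>A. (perm_restrict x A ^^ k) q = g q) \<and> (\<forall>q\<in>P - A. (perm_restrict x (P - A) ^^ k) q = g q)"
    unfolding r using AP by auto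
qed

lemma multiplicative_torsion: "multiplicative (torsion_weight k g)"
  unfolding multiplicative_def torsion_weight_def using funpow_split(1) omega_char_split by auto

lemma multiplicative_root: "multiplicative (root_weight k g)"
  unfolding multiplicative_def
proof (intro allI impI, elim conjE)
  fix P A x assume "inv_set P" "A \<subseteq> P" "x \<in> cent P" "x ` A = A"
  note split = funpow_split(2)[OF this, of k]
  show "root_weight k g P x = root_weight k g A (perm_restrict x A) * root_weight k g (P - A) (perm_restrict x (P - A))"
    unfolding root_weight_def split by simp
qed

lemma parity_split:
  assumes "inv_set P" "inv_set A" "A \<subseteq> P"
  shows "parity P x = parity A (perm_restrict x A) * parity (P - A) (perm_restrict x (P - A))"
proof -
  have "finite A" "finite (P - A)" using assms by (auto simp: inv_set_def signed_set_def)
  moreover have "P = A \<union> (P - A)" using assms(3) by auto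
  ultimately have "parity P x = parity A x * parity (P - A) x" using parity_union[of A "P - A" x] by auto
  moreover have "parity A x = parity A (perm_restrict x A)" "parity (P - A) x = parity (P - A) (perm_restrict x (P - A))"
    by (intro parity_cong, simp add: perm_restrict_def)+
  ultimately show ?thesis by simp
qed

lemma multiplicative_signed_torsion: "multiplicative (signed_torsion_weight k g)"
  using multiplicative_torsion parity_split
  unfolding multiplicative_def signed_torsion_weight_def by (metis mult.assoc mult.left_commute of_int_mult)

lemma weight_restrict:
  assumes B: "inv_set B" and x: "x \<in> cent B"
  shows "torsion_weight k (perm_restrict g B) B x = torsion_weight k g B x"
    "root_weight k (perm_restrict g B) B x = root_weight k g B x"
proof -
  have x1: "x ` B = B" using centD(1)[OF x] by (rule signed_permsD)
  have "perm_restrict x B = x" using centD(1)[OF x] by (simp add: signed_perms_def)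
  then have "omega_char B x g = omega_char B x (perm_restrict g B)"
    using omega_char_restrict[OF B B subset_refl x x1, of "perm_restrict g B"] by (simp add: perm_restrict_def)
  then show "torsion_weight k (perm_restrict g B) B x = torsion_weight k g B x"
    by (simp add: torsion_weight_def)
qed (simp add: root_weight_def perm_restrict_def)

lemma sum_torsion_eq_sum_root:
  assumes "inv_set P"
  shows "(\<Sum>x\<in>cent P. torsion_weight k g P x) = (\<Sum>x\<in>cent P. root_weight k g P x)"
proof (rule sum_eq_by_blocks[OF multiplicative_torsion multiplicative_root _ _ assms])
  show "torsion_weight k g {} id = root_weight k g {} id"
    by (simp add: torsion_weight_def root_weight_def omega_char_def flip: id_def)
  fix B p assume B: "inv_set B" "p \<in> B"
  note b = block_local[OF root_choice_axioms B]
  have cent: "u \<in> cent B" if "u \<in> trans_perms B p" for u using that by (simp add: trans_perms_def)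
  show "(\<Sum>u\<in>trans_perms B p. torsion_weight k g B u) = (\<Sum>u\<in>trans_perms B p. root_weight k g B u)"
    using block.local_sum[OF b(1), of k] weight_restrict[OF B(1) cent] by (simp add: b(2))
qed

lemma sum_signed_torsion_eq_0:
  assumes "inv_set P" "even k" "(-1) ^ (card P div 2) * parity P g = -1"
  shows "(\<Sum>x\<in>cent P. signed_torsion_weight k g P x) = 0"
proof (rule sum_eq_0_by_blocks[where \<epsilon> = "\<lambda>P. (-1) ^ (card P div 2) * parity P g = -1",
      OF multiplicative_signed_torsion _ _ _ assms(1,3)])
  fix B p assume B: "inv_set B" "p \<in> B" and \<epsilon>: "(-1) ^ (card B div 2) * parity B g = -1"
  note b = block_local[OF root_choice_axioms B]
  have cent: "u \<in> cent B" if "u \<in> trans_perms B p" for u using that by (simp add: trans_perms_def)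
  have "parity B g = parity B (perm_restrict g B)" by (rule parity_cong) (simp add: perm_restrict_def)
  then have "(\<Sum>u\<in>trans_perms B p. signed_torsion_weight k (perm_restrict g B) B u) = 0"
    using block.local_sum_zero[OF b(1) assms(2)] \<epsilon> by (simp add: b(2))
  then show "(\<Sum>u\<in>trans_perms B p. signed_torsion_weight k g B u) = 0"
    using weight_restrict(1)[OF B(1) cent] by (simp add: signed_torsion_weight_def)
next
  show "\<not> (-1) ^ (card ({} :: int set) div 2) * parity {} g = -1" by (simp add: parity_def)
next
  fix P A assume P: "inv_set P" and A: "inv_set A" and AP: "A \<subseteq> P" and \<epsilon>: "(-1) ^ (card P div 2) * parity P g = -1"
  have D: "inv_set (P - A)" by (rule inv_set_diff[OF P A])
  have fin: "finite A" "finite (P - A)" using A D by (simp_all add: inv_set_def signed_set_def)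
  \<comment> \<open>The power of -1 is the parity of negation on \<open>Q\<close>, so the condition
    is one on the parity of \<open>uminus \<circ> g\<close>, which is multiplicative over
    splittings.\<close>
  have e: "(-1) ^ (card Q div 2) * parity Q g = parity Q (uminus \<circ> g)" if "inv_set Q" for Q
    using parity_comp[OF inv_setD(1)[OF that] g inv_setD(2)[OF that], of uminus] parity_uminus[OF inv_setD(1)[OF that]]
    by (simp add: signed_bij_def bij_uminus)
  have "P = A \<union> (P - A)" using AP by auto
  then have "parity P (uminus \<circ> g) = parity A (uminus \<circ> g) * parity (P - A) (uminus \<circ> g)"
    using parity_union[OF fin, of "uminus \<circ> g"] by simp
  moreover have "parity Q (uminus \<circ> g) = 1 \<or> parity Q (uminus \<circ> g) = -1" if "inv_set Q" for Q
  proof -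
    have "(uminus \<circ> g) ` Q \<subseteq> Q" using that by (auto simp: inv_set_def signed_setD(3))
    then show ?thesis using parity_sign(2)[OF inv_setD(1)[OF that]] by (metis square_eq_1_iff)
  qed
  ultimately show "(-1) ^ (card A div 2) * parity A g = -1 \<or> (-1) ^ (card (P - A) div 2) * parity (P - A) g = -1"
    using \<epsilon> A D unfolding e[OF P] e[OF A] e[OF D] by fastforce
qed

end

lemma card_signed_points: "card (signed_points n) = 2 * n"
  by (simp add: signed_points_def card_Diff_singleton)

theorem theorem1p7:
  fixes n :: nat and k :: int and \<zeta> \<eta> :: "nat \<Rightarrow> complex" and g :: "int \<Rightarrow> int"
  assumes "n \<ge> 2"
    and "odd n \<or> odd k"
    and "\<And>i. i \<ge> 1 \<Longrightarrow> faithful_root i (\<zeta> i)"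
    and "\<And>i. i \<ge> 1 \<Longrightarrow> faithful_root (2 * i) (\<eta> i)"
    and "g \<in> carrier (D_group n)"
  shows "of_nat (roots (D_group n) k g) =
    (\<Sum>C \<in> {C \<in> conj_classes (D_group n).
              (\<lambda>x. x [^]\<^bsub>D_group n\<^esub> k) ` C = {\<one>\<^bsub>D_group n\<^esub>}}.
       psi_D n \<zeta> \<eta> C g)"
proof -
  let ?P = "signed_points n" and ?m = "nat \<bar>k\<bar>" and ?D = "carrier (D_group n)"
  note S = signed_set_signed_points[of n]
  have gD: "g \<in> signed_perms ?P" "parity ?P g = 1" using assms(5) by (simp_all add: carrier_D_group)
  interpret root_choice \<zeta> \<eta>
    by unfold_locales (use assms(3,4) in \<open>auto intro!: faithful_root_order\<close>)
  interpret map_roots g \<zeta> \<eta>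
    by unfold_locales (rule signed_permsD(2)[OF gD(1)])
  have inv: "inv_set ?P" using S signed_permsD(3)[OF gD(1)] by (simp add: inv_set_def)
  have cent: "cent ?P = {x \<in> signed_perms ?P. x \<circ> g = g \<circ> x}" by (auto simp: cent_def fun_eq_iff)
  have fin: "finite (cent ?P)" by (rule finite_cent[OF inv])
  have D: "x \<in> ?D \<longleftrightarrow> x \<in> signed_perms ?P \<and> parity ?P x = 1" for x by (simp add: carrier_D_group)
  have pm: "parity ?P x = 1 \<or> parity ?P x = -1" if "x \<in> signed_perms ?P" for x
    using parity_sign(2)[OF S, of x] signed_permsD(3)[OF that] by (metis square_eq_1_iff subset_refl)
  have pow: "parity ?P (x ^^ j) = parity ?P x ^ j" if "x \<in> signed_perms ?P" for x j
    by (rule parity_funpow[OF S signed_permsD(2,3)[OF that]])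
  let ?R = "{h \<in> signed_perms ?P. h ^^ ?m = g}"
  have "(\<Sum>x\<in>cent ?P. root_weight ?m g ?P x) = (\<Sum>x\<in>{x \<in> cent ?P. \<forall>q\<in>?P. (x ^^ ?m) q = g q}. 1)"
    unfolding root_weight_def using fin by (rule sum.inter_filter[symmetric])
  also have "{x \<in> cent ?P. \<forall>q\<in>?P. (x ^^ ?m) q = g q} = ?R"
  proof (intro Set.set_eqI iffI)
    fix x assume "x \<in> {x \<in> cent ?P. \<forall>q\<in>?P. (x ^^ ?m) q = g q}"
    then have x: "x \<in> signed_perms ?P" "\<And>q. q \<in> ?P \<Longrightarrow> (x ^^ ?m) q = g q" by (auto simp: cent_def)
    have "(x ^^ ?m) q = g q" for q
      using x(2) signed_permsD(4)[OF signed_perms_funpow[OF x(1)]] signed_permsD(4)[OF gD(1)] by metis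
    then show "x \<in> ?R" using x(1) by blast
  next
    fix x assume "x \<in> ?R"
    then show "x \<in> {x \<in> cent ?P. \<forall>q\<in>?P. (x ^^ ?m) q = g q}" by (auto simp: cent_def funpow_swap1)
  qed
  finally have total: "(\<Sum>x\<in>cent ?P. torsion_weight ?m g ?P x) = of_nat (card ?R)"
    using sum_torsion_eq_sum_root[OF inv] by simp
  have filter: "(\<Sum>x\<in>{x \<in> ?D. x ^^ ?m = id \<and> x \<circ> g = g \<circ> x}. omega_char ?P x g)
      = (\<Sum>x\<in>cent ?P. if parity ?P x = 1 then torsion_weight ?m g ?P x else 0)"
  proof -
    have "{x \<in> ?D. x ^^ ?m = id \<and> x \<circ> g = g \<circ> x} = {x \<in> cent ?P. parity ?P x = 1 \<and> x ^^ ?m = id}"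
      by (auto simp: D cent)
    then have "(\<Sum>x\<in>{x \<in> ?D. x ^^ ?m = id \<and> x \<circ> g = g \<circ> x}. omega_char ?P x g)
      = (\<Sum>x\<in>cent ?P. if parity ?P x = 1 \<and> x ^^ ?m = id then omega_char ?P x g else 0)"
      using sum.inter_filter[OF fin] by simp
    then show ?thesis unfolding torsion_weight_def by (simp add: if_if_eq_conj)
  qed
  have "of_nat (roots (D_group n) k g) = (\<Sum>x\<in>{x \<in> ?D. x ^^ ?m = id \<and> x \<circ> g = g \<circ> x}. omega_char ?P x g)"
  proof (cases "odd k")
    case True
    then have m: "odd ?m" by (simp add: even_nat_iff)
    \<comment> \<open>An odd power has the parity of its base, so all \<open>?m\<close>-th roots of
      \<open>g\<close>, and all elements with trivial \<open>?m\<close>-th power, lie in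
      \<open>D_n\<close>.\<close>
    have odd: "parity ?P x = parity ?P (x ^^ ?m)" if "x \<in> signed_perms ?P" for x
      using pow[OF that] pm[OF that] m by auto
    have "{h \<in> ?D. h ^^ ?m = g} = ?R" using odd gD(2) by (auto simp: D)
    moreover have "(if parity ?P x = 1 then torsion_weight ?m g ?P x else 0) = torsion_weight ?m g ?P x" if "x \<in> cent ?P" for x
      using odd[of x] that parity_id[of ?P] by (auto simp: torsion_weight_def cent_def simp flip: id_def)
    ultimately show ?thesis unfolding filter roots_D_group by (simp add: total)
  next
    case False
    then have n: "odd n" and m: "even ?m" using assms(2) by (simp_all add: even_nat_iff)
    \<comment> \<open>For odd \<open>n\<close>, negation has parity -1, and \<open>g\<close> has
      parity 1.\<close>
    have zero: "(\<Sum>x\<in>cent ?P. signed_torsion_weight ?m g ?P x) = 0"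
      by (rule sum_signed_torsion_eq_0[OF inv m]) (simp add: card_signed_points gD(2) n)
    \<comment> \<open>Twice the indicator of \<open>D_n\<close> is
      \<open>1 + parity\<close>.\<close>
    have "2 * (\<Sum>x\<in>cent ?P. if parity ?P x = 1 then torsion_weight ?m g ?P x else 0)
        = (\<Sum>x\<in>cent ?P. torsion_weight ?m g ?P x + signed_torsion_weight ?m g ?P x)"
      unfolding sum_distrib_left
    proof (rule sum.cong)
      fix x assume "x \<in> cent ?P"
      then show "2 * (if parity ?P x = 1 then torsion_weight ?m g ?P x else 0)
          = torsion_weight ?m g ?P x + signed_torsion_weight ?m g ?P x"
        using pm[of x] by (auto simp: cent_def signed_torsion_weight_def)
    qed simp
    also have "\<dots> = of_nat (card ?R)" by (simp add: sum.distrib total zero)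
    also have "card ?R = 2 * card {h \<in> ?D. h ^^ ?m = g}"
    proof -
      \<comment> \<open>Negation is central, squares to the identity and has parity -1. As
        \<open>?m\<close> is even, composing with it exchanges the \<open>?m\<close>-th roots of
        \<open>g\<close> inside and outside \<open>D_n\<close>.\<close>
      let ?u = "perm_restrict uminus ?P"
      have u: "?u \<in> signed_perms ?P"
        by (rule perm_restrict_signed_perms[OF _ S]) (use S in \<open>simp_all add: signed_bij_def bij_uminus signed_set_def\<close>)
      have du: "parity ?P ?u = -1"
        using parity_uminus[OF S] n parity_cong[of ?P ?u uminus] by (simp add: card_signed_points perm_restrict_def)
      have uu: "?u (?u q) = q" for q
        using signed_setD(3)[OF S] by (simp add: perm_restrict_def)
      let ?E = "{h \<in> signed_perms ?P. parity ?P h = -1 \<and> h ^^ ?m = g}"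
      have neg: "?u \<circ> h \<in> signed_perms ?P \<and> parity ?P (?u \<circ> h) = - parity ?P h \<and> (?u \<circ> h) ^^ ?m = h ^^ ?m"
        if h: "h \<in> signed_perms ?P" for h
      proof (intro conjI)
        show "?u \<circ> h \<in> signed_perms ?P" by (rule signed_perms_comp[OF u h])
        show "parity ?P (?u \<circ> h) = - parity ?P h"
          using parity_comp[OF S signed_permsD(2,3)[OF h] signed_permsD(2)[OF u]] du by simp
        have hP: "h q \<in> ?P \<longleftrightarrow> q \<in> ?P" for q
          using signed_permsD(1)[OF h] by (rule permutes_in_image)
        have uh: "?u (h q) = h (?u q)" for q
          using hP[of q] signed_bijD(1)[OF signed_permsD(2)[OF h]] by (simp add: perm_restrict_def)
        obtain t where t: "?m = 2 * t" using m by (rule evenE)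
        have "(?u \<circ> h) ^^ 2 = h ^^ 2" by (simp add: numeral_2_eq_2 fun_eq_iff uh uu)
        then show "(?u \<circ> h) ^^ ?m = h ^^ ?m" unfolding t by (metis funpow_mult mult.commute)
      qed
      have "bij_betw ((\<circ>) ?u) {h \<in> ?D. h ^^ ?m = g} ?E"
        by (rule bij_betwI[of _ _ _ "(\<circ>) ?u"]) (use neg uu in \<open>auto simp: D fun_eq_iff\<close>)
      then have "card ?E = card {h \<in> ?D. h ^^ ?m = g}" by (rule bij_betw_same_card[symmetric])
      moreover have "?R = {h \<in> ?D. h ^^ ?m = g} \<union> ?E" using pm by (auto simp: D)
      moreover have "{h \<in> ?D. h ^^ ?m = g} \<inter> ?E = {}" by (auto simp: D)
      moreover have "finite (signed_perms ?P)" by (rule finite_signed_perms[OF signed_setD(1)[OF S]])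
      ultimately show ?thesis by (simp add: card_Un_disjoint D)
    qed
    finally show ?thesis unfolding filter roots_D_group by simp
  qed
  then show ?thesis by (simp only: sum_psi_D[OF assms(5)])
qed

end
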